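(* Let $d\ge 1$. There is a constant $C>0$ such that for every pair of weights $\sigma, w$ on $\mathbb{B}^d$ belonging to the class $B_\infty$ and whose joint $B_2$ characteristic $[w,\sigma]_{B_2}$ is finite, the Bergman projection $P$ satisfies $$\lVert P(\sigma\,\cdot)\rVert_{L^2(\sigma)\to L^2(w)} \le C\,[w,\sigma]_{B_2}^{1/2}\Big([w]_{B_\infty}^{1/2}+[\sigma]_{B_\infty}^{1/2}\Big),$$ that is, $\lVert P(\sigma f)\rVert_{L^2(w)}\le C\,[w,\sigma]_{B_2}^{1/2}\big([w]_{B_\infty}^{1/2}+[\sigma]_{B_\infty}^{1/2}\big)\lVert f\rVert_{L^2(\sigma)}$ for all $f\in L^2(\sigma)$. The constant $C$ is independent of $\sigma$ and $w$.
   Context: $\mathbb{B}^d$ is the open unit ball of $\mathbb{C}^d$, $\nu$ is the normalised Lebesgue (volume) measure on $\mathbb{B}^d$, $|E|:=\nu(E)$. A weight is a positive function in $L^1_{\mathrm{loc}}(\mathbb{B}^d)$; $w(E):=\int_E w\,d\nu$ and $L^2(w):=L^2(\mathbb{B}^d,w\,d\nu)$. The Bergman projection is $$Pf(z)=\int_{\mathbb{B}^d}\frac{f(\zeta)}{(1-z\bar\zeta)^{d+1}}\,d\nu(\zeta),\qquad z\bar\zeta:=\langle z,\zeta\rangle=\sum_j z_j\overline{\zeta_j}.$$ Dyadic tents. Let $\varphi_z$ be the biholomorphic involution of $\mathbb{B}^d$ exchanging $z$ and $0$, and $\beta(z,w)=\frac12\log\frac{1+|\varphi_z(w)|}{1-|\varphi_z(w)|}$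 the Bergman metric. $B(z_0,r)$ is the ball in the metric $\beta$, $\mathbb{S}_r=\partial B(0,r)$ (with $\mathbb{S}_0=\{0\}$), and $\pi_{r}$ is the radial projection onto $\mathbb{S}_{r}$. Fix parameters $R,\delta>0$. For each $n\in\mathbb{N}$ choose points $\{z_j^n\}_{j=1}^{J_n}\subset\mathbb{S}_{nR}$ and a partition of $\mathbb{S}_{nR}$ into Borel sets $\Omega_j^n$, $1\le j\le J_n$, with $B(z_j^n,\delta)\cap\mathbb{S}_{nR}\subseteq\Omega_j^n\subseteq B(z_j^n,C_0\delta)\cap\mathbb{S}_{nR}$ for some constant $C_0>0$. The kubes are $K_1^0=B(0,R)$ and, for $n\ge1$, $K_j^n=\{\zeta\in B(0,(n+1)R)\setminus B(0,nR):\pi_{nR}(\zeta)\in\Omega_j^n\}$, with centre $c_j^n=\pi_{(n+\frac12)R}(z_j^n)$. The centre $c_i^{n+1}$ is a child of $c_k^n$ if $\pi_{nR}(c_i^{n+1})\in\Omega_k^n$ (all centres of generation $1$ are children of the root, the centre of $K_1^0$). The centres so ordered form a tree, called a Bergman tree; for $\alpha$ in the tree $K_\alpha$ is the kube with centre $\alpha$, and the dyadic tent is $\hat K_\alpha=\bigcup_{\beta\ge\alpha}K_\beta$, the union over $\alpha$ and all its descendants $\beta$. For $z\in\mathbb{B}^d\setminus\{0\}$ the Carleson tent is $T_z=\{\zeta\in\mathbb{B}^d:|1-\langle\zeta,z/|z|\rangle|\le1-|z|\}$, and $T_0=\mathbb{B}^d$. Throughout, one fixes a finite collection of Bergman trees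 $\mathcal{T}_1,\dots,\mathcal{T}_N$, depending only on $d$, such that every Carleson tent $T_z$ is contained in some dyadic tent $\hat K_\alpha$ with $\alpha\in\mathcal{T}_\ell$ for some $\ell$ and $|\hat K_\alpha|$ comparable to $|T_z|$ with constants independent of $z$ (such a collection exists). $\mathscr{T}$ denotes the collection of all dyadic tents $\hat K_\alpha$, $\alpha\in\mathcal{T}_\ell$, $1\le\ell\le N$. Characteristics: $[w,\sigma]_{B_2}=\sup_{\hat K\in\mathscr{T}}\frac{w(\hat K)}{|\hat K|}\frac{\sigma(\hat K)}{|\hat K|}$. With $Mf(z)=\sup_{\hat K\in\mathscr{T}}\big(\frac1{|\hat K|}\int_{\hat K}|f|\,d\nu\big)\mathbf{1}_{\hat K}(z)$, set $$[\sigma]_{B_\infty}=\sup_{\hat K\in\mathscr{T}}\frac1{\sigma(\hat K)}\int_{\hat K}M(\sigma\mathbf{1}_{\hat K})\,d\nu ,$$ and $\sigma\in B_\infty$ means $[\sigma]_{B_\infty}<\infty$. *)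

theory Defs
  imports "HOL-Analysis.Analysis"
begin

section \<open>The unit ball, its normalised volume and the Bergman projection\<close>

abbreviation unit_ball :: "(complex ^ 'd) set" where
  "unit_ball \<equiv> ball 0 1"

definition nu :: "(complex ^ 'd) measure" where
  "nu = uniform_measure (lebesgue_on unit_ball) unit_ball"

definition herm :: "complex ^ 'd \<Rightarrow> complex ^ 'd \<Rightarrow> complex" where
  "herm z w = (\<Sum>j\<in>UNIV. z $ j * cnj (w $ j))"

definition bergman_proj :: "(complex ^ 'd \<Rightarrow> complex) \<Rightarrow> complex ^ 'd \<Rightarrow> complex" where
  "bergman_proj f z = (\<integral>\<zeta>. f \<zeta> / (1 - herm z \<zeta>) ^ (CARD('d) + 1) \<partial>nu)"


section \<open>The Bergman metric\<close>

text \<open>The standard involutive automorphism of the ball exchanging \<open>z\<close> and \<open>0\<close>: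
  with \<open>p\<close> the orthogonal projection of \<open>w\<close> onto the complex line spanned by \<open>z\<close>,
  it is \<open>(z - p - sqrt (1 - |z|^2) (w - p)) / (1 - \<langle>w, z\<rangle>)\<close>.
  For \<open>z = 0\<close> division by zero gives \<open>p = 0\<close>, hence \<open>w \<mapsto> - w\<close>.\<close>

definition ball_invol :: "complex ^ 'd \<Rightarrow> complex ^ 'd \<Rightarrow> complex ^ 'd" where
  "ball_invol z w =
     (let p = (herm w z / herm z z) *s z
      in inverse (1 - herm w z) *s (z - p - sqrt (1 - (norm z)\<^sup>2) *\<^sub>R (w - p)))"

definition bergman_dist :: "complex ^ 'd \<Rightarrow> complex ^ 'd \<Rightarrow> real" where
  "bergman_dist z w = 1 / 2 * ln ((1 + norm (ball_invol z w)) / (1 - norm (ball_invol z w)))"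

definition bergman_ball :: "complex ^ 'd \<Rightarrow> real \<Rightarrow> (complex ^ 'd) set" where
  "bergman_ball z r = {w \<in> unit_ball. bergman_dist z w < r}"

definition bergman_sphere :: "real \<Rightarrow> (complex ^ 'd) set" where
  "bergman_sphere r = (if r = 0 then {0} else frontier (bergman_ball 0 r))"

text \<open>\<open>bergman_sphere r\<close> is the Euclidean sphere of radius \<open>tanh r\<close> about \<open>0\<close>
  (lemma \<open>bergman_sphere_eq\<close> below).\<close>

definition radial_proj :: "real \<Rightarrow> complex ^ 'd \<Rightarrow> complex ^ 'd" where
  "radial_proj r \<zeta> = (tanh r / norm \<zeta>) *\<^sub>R \<zeta>"


section \<open>Bergman trees and tents\<close>

text \<open>The data of a Bergman tree: in generation \<open>n\<close> there are \<open>num T n\<close> points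
  \<open>pt T n j\<close> and cells \<open>cell T n j\<close>, indexed by \<open>1 \<le> j \<le> num T n\<close>.
  A vertex is represented by its index \<open>(n, j)\<close> instead of its centre; distinct indices have
  distinct centres, and the only vertex of generation \<open>0\<close> is \<open>(0, 1)\<close>.\<close>

record 'd bergman_tree =
  num :: "nat \<Rightarrow> nat"
  pt :: "nat \<Rightarrow> nat \<Rightarrow> complex ^ 'd"
  cell :: "nat \<Rightarrow> nat \<Rightarrow> (complex ^ 'd) set"

definition is_bergman_tree :: "real \<Rightarrow> real \<Rightarrow> 'd::finite bergman_tree \<Rightarrow> bool" where
  "is_bergman_tree R \<delta> T \<longleftrightarrow>
     (\<exists>C0 > 0. \<forall>n.
        (\<Union>j\<in>{1..num T n}. cell T n j) = bergman_sphere (n * R) \<and>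
        disjoint_family_on (cell T n) {1..num T n} \<and>
        (\<forall>j\<in>{1..num T n}.
           pt T n j \<in> bergman_sphere (n * R) \<and>
           cell T n j \<in> sets borel \<and>
           bergman_ball (pt T n j) \<delta> \<inter> bergman_sphere (n * R) \<subseteq> cell T n j \<and>
           cell T n j \<subseteq> bergman_ball (pt T n j) (C0 * \<delta>) \<inter> bergman_sphere (n * R)))"

definition vertices :: "'d::finite bergman_tree \<Rightarrow> (nat \<times> nat) set" where
  "vertices T = {(n, j). j \<in> {1..num T n}}"

definition centre :: "real \<Rightarrow> 'd::finite bergman_tree \<Rightarrow> nat \<Rightarrow> nat \<Rightarrow> complex ^ 'd" where
  "centre R T n j = radial_proj ((n + 1 / 2) * R) (pt T n j)"

definition kube :: "real \<Rightarrow> 'd::finite bergman_tree \<Rightarrow> nat \<times> nat \<Rightarrow> (complex ^ 'd) set" where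
  "kube R T = (\<lambda>(n, j).
     if n = 0 then bergman_ball 0 R
     else {\<zeta> \<in> bergman_ball 0 ((n + 1) * R) - bergman_ball 0 (n * R).
             radial_proj (n * R) \<zeta> \<in> cell T n j})"

definition child_of :: "real \<Rightarrow> 'd::finite bergman_tree \<Rightarrow> nat \<times> nat \<Rightarrow> nat \<times> nat \<Rightarrow> bool" where
  "child_of R T = (\<lambda>(n, k) (m, i).
     (n, k) \<in> vertices T \<and> (m, i) \<in> vertices T \<and> m = n + 1 \<and>
     (n = 0 \<or> radial_proj (n * R) (centre R T (n + 1) i) \<in> cell T n k))"

definition dyadic_tent :: "real \<Rightarrow> 'd::finite bergman_tree \<Rightarrow> nat \<times> nat \<Rightarrow> (complex ^ 'd) set" where
  "dyadic_tent R T a = (\<Union>b\<in>{b. (child_of R T)\<^sup>*\<^sup>* a b}. kube R T b)"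

definition dyadic_tents :: "real \<Rightarrow> 'd::finite bergman_tree set \<Rightarrow> (complex ^ 'd) set set" where
  "dyadic_tents R Ts = {dyadic_tent R T a | T a. T \<in> Ts \<and> a \<in> vertices T}"

definition carleson_tent :: "complex ^ 'd \<Rightarrow> (complex ^ 'd) set" where
  "carleson_tent z =
     (if z = 0 then unit_ball
      else {\<zeta> \<in> unit_ball. cmod (1 - herm \<zeta> ((1 / norm z) *\<^sub>R z)) \<le> 1 - norm z})"

definition tents_cover :: "real \<Rightarrow> 'd::finite bergman_tree set \<Rightarrow> bool" where
  "tents_cover R Ts \<longleftrightarrow>
     (\<exists>c > 0. \<forall>z\<in>unit_ball. \<exists>K\<in>dyadic_tents R Ts.
        carleson_tent z \<subseteq> K \<and>
        measure nu K \<le> c * measure nu (carleson_tent z) \<and>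
        measure nu (carleson_tent z) \<le> c * measure nu K)"

definition admissible_trees :: "real \<Rightarrow> real \<Rightarrow> 'd::finite bergman_tree set \<Rightarrow> bool" where
  "admissible_trees R \<delta> Ts \<longleftrightarrow>
     finite Ts \<and> (\<forall>T\<in>Ts. is_bergman_tree R \<delta> T) \<and> tents_cover R Ts"


section \<open>Weights and characteristics\<close>

text \<open>Functions are total on \<open>complex ^ 'd\<close>, but as \<open>space nu = unit_ball\<close>, nothing
  below depends on their values outside the ball.\<close>

definition weight :: "(complex ^ 'd \<Rightarrow> real) \<Rightarrow> bool" where
  "weight w \<longleftrightarrow>
     (\<forall>z\<in>unit_ball. w z > 0) \<and> w \<in> borel_measurable nu \<and>
     (\<forall>K. compact K \<and> K \<subseteq> unit_ball \<longrightarrow> set_integrable nu K w)"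

definition wmeasure :: "(complex ^ 'd \<Rightarrow> real) \<Rightarrow> (complex ^ 'd) measure" where
  "wmeasure w = density nu (\<lambda>z. ennreal (w z))"

definition L2 :: "(complex ^ 'd \<Rightarrow> real) \<Rightarrow> (complex ^ 'd \<Rightarrow> complex) set" where
  "L2 w = {f \<in> borel_measurable (wmeasure w). integrable (wmeasure w) (\<lambda>z. (cmod (f z))\<^sup>2)}"

definition L2norm :: "(complex ^ 'd \<Rightarrow> real) \<Rightarrow> (complex ^ 'd \<Rightarrow> complex) \<Rightarrow> real" where
  "L2norm w f = sqrt (\<integral>z. (cmod (f z))\<^sup>2 \<partial>wmeasure w)"

text \<open>In the following three definitions \<open>K\<close> ranges over the collection \<open>\<K>\<close> of
  dyadic tents. A weight is only locally integrable, so it may have infinite mass on a tent;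
  the characteristics are therefore extended nonnegative reals. For positive weights
  \<open>B2_char \<K> w \<sigma> < \<infinity>\<close> forces \<open>w(K)\<close> and \<open>\<sigma>(K)\<close> to be finite
  for every tent, so that no quotient by \<open>\<infinity>\<close> arises in \<open>Binf_char\<close>.\<close>

definition B2_char ::
    "(complex ^ 'd) set set \<Rightarrow> (complex ^ 'd \<Rightarrow> real) \<Rightarrow> (complex ^ 'd \<Rightarrow> real) \<Rightarrow> ennreal" where
  "B2_char \<K> w \<sigma> =
     (SUP K\<in>\<K>. emeasure (wmeasure w) K / emeasure nu K * (emeasure (wmeasure \<sigma>) K / emeasure nu K))"

definition maximal_fn ::
    "(complex ^ 'd) set set \<Rightarrow> (complex ^ 'd \<Rightarrow> real) \<Rightarrow> complex ^ 'd \<Rightarrow> ennreal" where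
  "maximal_fn \<K> f z =
     (SUP K\<in>\<K>. (\<integral>\<^sup>+\<zeta>\<in>K. ennreal \<bar>f \<zeta>\<bar> \<partial>nu) / emeasure nu K * indicator K z)"

definition Binf_char :: "(complex ^ 'd) set set \<Rightarrow> (complex ^ 'd \<Rightarrow> real) \<Rightarrow> ennreal" where
  "Binf_char \<K> \<sigma> =
     (SUP K\<in>\<K>. (\<integral>\<^sup>+z\<in>K. maximal_fn \<K> (\<lambda>\<zeta>. \<sigma> \<zeta> * indicator K \<zeta>) z \<partial>nu)
                / emeasure (wmeasure \<sigma>) K)"


section \<open>Basic facts confirming the explicit formulas\<close>

lemma herm_self: "herm z z = complex_of_real ((norm z)\<^sup>2)"
proof -
  have "(norm z)\<^sup>2 = (\<Sum>j\<in>UNIV. (cmod (z $ j))\<^sup>2)"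
    by (simp add: norm_vec_def L2_set_def sum_nonneg)
  then show ?thesis
    by (simp add: herm_def complex_norm_square flip: of_real_power)
qed

lemma herm_smult_left: "herm (c *s v) z = c * herm v z"
  by (simp add: herm_def sum_distrib_left mult.assoc)

lemma herm_scaleR_left: "herm (r *\<^sub>R v) z = complex_of_real r * herm v z"
  by (simp add: herm_def sum_distrib_left scaleR_conv_of_real[where 'a=complex] mult.assoc)

lemma herm_diff_left: "herm (u - v) z = herm u z - herm v z"
  by (simp add: herm_def sum_subtractf left_diff_distrib)

lemma herm_zero [simp]: "herm z 0 = 0" "herm 0 z = 0"
  by (simp_all add: herm_def)

lemma ball_invol_0_left: "ball_invol 0 w = - w"
  by (simp add: ball_invol_def vec_eq_iff)

lemma ball_invol_0_right: "ball_invol z 0 = z"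
  by (simp add: ball_invol_def)

lemma ball_invol_self: "z \<in> unit_ball \<Longrightarrow> ball_invol z z = 0"
  by (cases "z = 0") (simp_all add: ball_invol_def herm_self)

lemma ball_invol_involution:
  assumes z: "z \<in> unit_ball" and w: "herm w z \<noteq> 1"
  shows "ball_invol z (ball_invol z w) = w"
proof (cases "z = 0")
  case True
  then show ?thesis by (simp add: ball_invol_0_left)
next
  case False
  define r where "r = complex_of_real ((norm z)\<^sup>2)"
  define t where "t = herm w z"
  define s where "s = complex_of_real (sqrt (1 - (norm z)\<^sup>2))"
  have nz: "(norm z)\<^sup>2 < 1" using z by (simp add: power_less_one_iff)
  have r0: "r \<noteq> 0" using False by (simp add: r_def)
  have r1: "1 - r \<noteq> 0"
  proof
    assume "1 - r = 0"
    then have "complex_of_real ((norm z)\<^sup>2) = complex_of_real 1" by (simp add: r_def)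
    then show False using nz unfolding of_real_eq_iff by simp
  qed
  have t1: "1 - t \<noteq> 0" using w by (auto simp: t_def)
  have s2: "s * s = 1 - r"
    using nz by (simp add: s_def r_def flip: of_real_mult of_real_power)
  have hz: "herm z z = r" by (simp add: herm_self r_def)
  have comp: "ball_invol z v $ i =
      (z $ i - herm v z / r * z $ i - s * (v $ i - herm v z / r * z $ i)) / (1 - herm v z)" for v i
    by (simp add: ball_invol_def hz s_def Let_def scaleR_conv_of_real[where 'a=complex] divide_inverse algebra_simps)
  have "herm (ball_invol z w) z = inverse (1 - t) * (r - t / r * r - s * (t - t / r * r))"
    unfolding ball_invol_def Let_def herm_smult_left herm_scaleR_left herm_diff_left hz
      t_def[symmetric] s_def[symmetric] ..
  then have ht: "herm (ball_invol z w) z = (r - t) / (1 - t)"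
    using r0 by (simp add: divide_inverse[of "r - t"] mult.commute)
  have d: "1 - (r - t) / (1 - t) = (1 - r) / (1 - t)"
    using t1 by (simp add: field_simps)
  show ?thesis
  proof (rule vec_eq_iff[THEN iffD2], rule allI)
    fix i
    define x where "x = z $ i"
    define q where "q = w $ i - t / r * x"
    have m: "ball_invol z w $ i = (x - t / r * x - s * q) / (1 - t)"
      by (simp add: comp x_def q_def t_def)
    have Q: "ball_invol z w $ i - (r - t) / (1 - t) / r * x = - s * q / (1 - t)"
    proof -
      have k: "(r - t) / (1 - t) / r = (1 - t / r) / (1 - t)"
      proof -
        have "(r - t) / r = 1 - t / r" using r0 by (simp add: diff_divide_distrib)
        then show ?thesis by (metis divide_divide_eq_left mult.commute)
      qed
      have "(x - t / r * x - s * q) / (1 - t) - (1 - t / r) / (1 - t) * x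
          = ((x - t / r * x - s * q) - (1 - t / r) * x) / (1 - t)"
        by (simp only: diff_divide_distrib[symmetric] times_divide_eq_left)
      also have "(x - t / r * x - s * q) - (1 - t / r) * x = - s * q"
        by (simp add: left_diff_distrib)
      finally show ?thesis unfolding m k .
    qed
    have "ball_invol z (ball_invol z w) $ i =
        (x - (r - t) / (1 - t) / r * x - s * (- s * q / (1 - t))) / ((1 - r) / (1 - t))"
      unfolding comp[of "ball_invol z w"] ht d x_def[symmetric] Q ..
    also have "\<dots> = (x - (r - t) / (1 - t) / r * x + (1 - r) * q / (1 - t)) / ((1 - r) / (1 - t))"
      by (simp flip: s2)
    also have "\<dots> = (x * (1 - t) - (r - t) / r * x + (1 - r) * q) / (1 - r)"
    proof -
      have "(r - t) / (1 - t) / r * x * (1 - t) = (r - t) / r * x" "(1 - r) * q / (1 - t) * (1 - t) = (1 - r) * q"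
        using t1 by simp_all
      then have "(x - (r - t) / (1 - t) / r * x + (1 - r) * q / (1 - t)) * (1 - t)
          = x * (1 - t) - (r - t) / r * x + (1 - r) * q"
        by (simp only: distrib_right left_diff_distrib)
      then show ?thesis by (simp only: divide_divide_eq_right)
    qed
    also have "x * (1 - t) - (r - t) / r * x = (1 - r) * (t / r * x)"
      using r0 by (simp add: field_simps)
    also have "((1 - r) * (t / r * x) + (1 - r) * q) / (1 - r) = t / r * x + q"
      using r1 by (simp only: distrib_left[symmetric] nonzero_mult_div_cancel_left[OF r1])
    finally show "ball_invol z (ball_invol z w) $ i = w $ i" by (simp add: q_def)
  qed
qed

lemma bergman_dist_0: "bergman_dist 0 w = artanh (norm w)"
  by (simp add: bergman_dist_def ball_invol_0_left artanh_def)

lemma bergman_ball_0_eq: "bergman_ball (0 :: complex ^ 'd) r = (if r > 0 then ball 0 (tanh r) else {})"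
proof -
  have "artanh (norm w) < r \<longleftrightarrow> norm w < tanh r" if "norm w < 1" for w :: "complex ^ 'd"
  proof -
    have w: "tanh (artanh (norm w)) = norm w"
    proof -
      have 1: "1 + norm w > 0" "1 - norm w > 0"
        using that norm_ge_zero[of w] by linarith+
      have "exp (- 2 * artanh (norm w)) = inverse ((1 + norm w) / (1 - norm w))"
        using 1 by (simp add: artanh_def exp_minus)
      also have "\<dots> = (1 - norm w) / (1 + norm w)" by simp
      finally have e: "exp (- 2 * artanh (norm w)) = (1 - norm w) / (1 + norm w)" .
      show ?thesis
        unfolding tanh_real_altdef e using 1 by (simp add: field_simps)
    qed
    then show ?thesis
      using tanh_real_less_iff[of "artanh (norm w)" r] by simp
  qed
  then have "bergman_ball (0 :: complex ^ 'd) r = unit_ball \<inter> ball 0 (tanh r)"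
    by (auto simp: bergman_ball_def bergman_dist_0)
  moreover have "ball 0 (tanh r) \<subseteq> (unit_ball :: (complex ^ 'd) set)"
    using tanh_real_lt_1[of r] by (intro subset_ball) simp
  ultimately show ?thesis
    using tanh_real_nonpos_iff[of r] by (cases "r > 0") (auto simp: ball_empty)
qed

lemma bergman_sphere_eq: "r \<ge> 0 \<Longrightarrow> bergman_sphere r = sphere 0 (tanh r)"
  by (auto simp: bergman_sphere_def bergman_ball_0_eq frontier_ball)

lemma emeasure_nu_unit_ball: "emeasure nu (unit_ball :: (complex ^ 'd) set) = 1"
proof -
  have "emeasure (lebesgue_on unit_ball) (unit_ball :: (complex ^ 'd) set)
      = emeasure lborel (unit_ball :: (complex ^ 'd) set)"
    by (simp add: emeasure_restrict_space)
  moreover have "emeasure lborel (unit_ball :: (complex ^ 'd) set) \<noteq> 0"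
    using open_not_negligible[of "unit_ball :: (complex ^ 'd) set"]
    by (simp add: negligible_iff_emeasure0)
  moreover have "emeasure lborel (unit_ball :: (complex ^ 'd) set) \<noteq> \<infinity>"
    using emeasure_lborel_ball_finite[of "0 :: complex ^ 'd" 1] by simp
  ultimately show ?thesis
    unfolding nu_def by (intro emeasure_uniform_measure_1) simp_all
qed

end

theory Submission
  imports Defs
begin

text \<open>Choose \<open>u\<close> on the ray through \<open>z\<close> with \<open>1 - |u|\<close> of the order of \<open>|1 - \<langle>z, \<zeta>\<rangle>|\<close>; then
  \<open>z\<close> and \<open>\<zeta>\<close> lie in the Carleson tent of \<open>u\<close>, hence in a comparable dyadic tent. So the
  Bergman kernel is dominated by a finite sum of positive operators
  \<open>f \<mapsto> \<Sum>\<^sub>Q \<langle>f\<rangle>\<^sub>Q 1\<^sub>Q\<close>, one for each tree, and only tents comparable to a Carleson tent occur.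
  Such a tent is comparable to its top kube, so these tents form a sparse laminar family. The
  two-weight bound for such an operator is proved by Treil's splitting: on the tents where the
  \<open>f\<close>-side dominates, stopping tents for the averages of \<open>f\<close> reduce the bilinear form to a
  testing inequality. The \<open>B\<^sub>2\<close> condition and sparseness bound the testing constant by
  \<open>\<Sum>\<^bsub>P \<subseteq> Q\<^esub> \<sigma>(P)\<close>, which the \<open>B\<^sub>\<infinity>\<close> condition bounds by a multiple of \<open>\<sigma>(Q)\<close>.\<close>

section \<open>A two-weight inequality on finite forests\<close>

text \<open>Each half of the splitting uses the packing of one weight only, which is why the square
  roots of the two \<open>B\<^sub>\<infty>\<close> constants are added; the joint
  \<open>B\<^sub>2\<close> constant and the sparseness constant enter both halves alike. The weights
  need not be doubling, so the finite argument sees a weight only through masses of sets. Each set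
  of a finite family is represented by the points that lie in no smaller member: functions become
  finite families of averages, the operator becomes constant on each such part, and stopping
  vertices exist because finite sets have maximal elements. The estimate usually taken from the
  dyadic maximal theorem is replaced by the lacunarity of the stopping levels. A norm bound is
  extracted from the bilinear one by pairing the operator with its own output, which is a finite
  quantity because of the truncation. Monotone convergence in the generation removes the truncation
  at the very end.\<close>

lemma sum_mult_le_sqrt:
  fixes a b :: "'i \<Rightarrow> real"
  shows "(\<Sum>i\<in>I. a i * b i) \<le> sqrt (\<Sum>i\<in>I. (a i)\<^sup>2) * sqrt (\<Sum>i\<in>I. (b i)\<^sup>2)"
  using Cauchy_Schwarz_ineq_sum[of a b I]
  by (metis real_le_rsqrt real_sqrt_mult)

lemma sum_powi_two_less:
  fixes I :: "int set"
  assumes "finite I" "\<And>i. i \<in> I \<Longrightarrow> i < M"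
  shows "(\<Sum>i\<in>I. 2 powi i) < (2 powi M :: real)"
  using assms
proof (induction I arbitrary: M rule: finite_linorder_max_induct)
  case empty
  then show ?case by simp
next
  case (insert b A)
  have "(\<Sum>i\<in>insert b A. 2 powi i) = 2 powi b + (\<Sum>i\<in>A. 2 powi i :: real)"
    using insert by (subst sum.insert) auto
  also have "\<dots> < 2 powi b + 2 powi b" using insert by auto
  also have "\<dots> = 2 powi (b + 1)" by (simp add: power_int_add)
  also have "\<dots> \<le> 2 powi M" using insert.prems[of b] by (intro power_int_increasing) auto
  finally show ?case .
qed

text \<open>Distinct powers of two add up to less than twice the largest of them, and the square of
  the largest is one of the terms on the right.\<close>

lemma sum_powi_two_square_le:
  fixes k :: "'i \<Rightarrow> int"
  assumes "finite I" "inj_on k I"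
  shows "(\<Sum>i\<in>I. 2 powi k i)\<^sup>2 \<le> 4 * (\<Sum>i\<in>I. (2 powi k i :: real)\<^sup>2)"
proof (cases "I = {}")
  case False
  define M where "M = Max (k ` I)"
  have M: "M \<in> k ` I" unfolding M_def using assms False by auto
  then obtain i where i: "i \<in> I" "k i = M" by auto
  have "(\<Sum>i\<in>I. 2 powi k i) = (\<Sum>j\<in>k ` I. 2 powi j :: real)"
    using assms by (simp add: sum.reindex)
  also have "\<dots> < 2 powi (M + 1)"
    using assms by (intro sum_powi_two_less) (auto simp: M_def)
  also have "\<dots> = 2 * 2 powi k i" using i by (simp add: power_int_add)
  finally have "(\<Sum>i\<in>I. 2 powi k i)\<^sup>2 \<le> (2 * 2 powi k i :: real)\<^sup>2"
    by (intro power_mono sum_nonneg) auto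
  also have "\<dots> = 4 * (2 powi k i)\<^sup>2" by (simp add: power_mult_distrib)
  also have "\<dots> \<le> 4 * (\<Sum>i\<in>I. (2 powi k i :: real)\<^sup>2)"
    using assms i by (intro mult_left_mono member_le_sum) auto
  finally show ?thesis .
qed simp

lemma sum_Un_le:
  fixes f :: "'i \<Rightarrow> real"
  assumes "finite A" "finite B" "\<And>x. x \<in> B \<Longrightarrow> 0 \<le> f x"
  shows "sum f (A \<union> B) \<le> sum f A + sum f B"
proof -
  have "sum f (A \<union> B) = sum f A + sum f (B - A)"
    using assms by (subst sum.union_disjoint[symmetric]) (auto intro!: sum.cong)
  also have "sum f (B - A) \<le> sum f B" using assms by (intro sum_mono2) auto
  finally show ?thesis by simp
qed

lemma sum_UNION_le:
  fixes f :: "'i \<Rightarrow> real"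
  assumes "finite I" "\<And>i. i \<in> I \<Longrightarrow> finite (A i)" "\<And>i x. i \<in> I \<Longrightarrow> x \<in> A i \<Longrightarrow> 0 \<le> f x"
  shows "sum f (\<Union>i\<in>I. A i) \<le> (\<Sum>i\<in>I. sum f (A i))"
  using assms
proof (induction I)
  case (insert i I)
  have "sum f (\<Union>i\<in>insert i I. A i) \<le> sum f (A i) + sum f (\<Union>i\<in>I. A i)"
    using insert.prems insert.hyps by (simp, intro sum_Un_le) auto
  also have "sum f (\<Union>i\<in>I. A i) \<le> (\<Sum>i\<in>I. sum f (A i))" using insert by auto
  finally show ?case using insert.hyps by simp
qed simp

text \<open>The model is a finite laminar family of nonempty sets ordered by inclusion: two members
  above a common one meet, hence are nested.\<close>

locale finite_forest =
  fixes V :: "'a::order set"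
  assumes finite_V: "finite V"
    and forest: "\<And>P Q R. P \<in> V \<Longrightarrow> Q \<in> V \<Longrightarrow> R \<in> V \<Longrightarrow> P \<le> Q \<Longrightarrow> P \<le> R \<Longrightarrow> Q \<le> R \<or> R \<le> Q"
begin

text \<open>A vertex stands for a set and also for the part of that set outside all smaller members.
  When \<open>u\<close> gives the masses of these parts, \<open>below u Q\<close> is the mass of the
  whole set; this is how measures and integrals enter the forest.\<close>

definition below :: "('a \<Rightarrow> real) \<Rightarrow> 'a \<Rightarrow> real" where
  "below u Q = (\<Sum>P | P \<in> V \<and> P \<le> Q. u P)"

text \<open>Summation over descendants is adjoint to summation over ancestors: the finite form of
  exchanging an integral with a sum over sets.\<close>

lemma sum_below_swap:
  assumes "U \<subseteq> V"
  shows "(\<Sum>Q\<in>U. c Q * below u Q) = (\<Sum>P\<in>V. u P * (\<Sum>Q | Q \<in> U \<and> P \<le> Q. c Q))"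
proof -
  have fU: "finite U" using assms finite_V finite_subset by auto
  have "(\<Sum>Q\<in>U. c Q * below u Q) = (\<Sum>Q\<in>U. \<Sum>P | P \<in> V \<and> P \<le> Q. u P * c Q)"
    by (simp add: below_def sum_distrib_left mult.commute)
  also have "\<dots> = (\<Sum>P\<in>V. \<Sum>Q | Q \<in> U \<and> P \<le> Q. u P * c Q)"
    using sum.swap_restrict[OF fU finite_V, of "\<lambda>Q P. u P * c Q" "\<lambda>Q P. P \<le> Q"] .
  finally show ?thesis by (simp add: sum_distrib_left)
qed

lemma below_nonneg: "(\<And>P. P \<in> V \<Longrightarrow> 0 \<le> u P) \<Longrightarrow> 0 \<le> below u Q"
  unfolding below_def by (intro sum_nonneg) auto

text \<open>The members of \<open>U\<close> above \<open>P\<close> form a chain, so every ordered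
  pair of them is counted by one of the two orders. By symmetry the two resulting sums agree, which
  gives the factor 2.\<close>

lemma square_sum_above_le:
  assumes "U \<subseteq> V" "P \<in> V" "\<And>Q. Q \<in> U \<Longrightarrow> 0 \<le> \<phi> Q"
  shows "(\<Sum>Q | Q \<in> U \<and> P \<le> Q. \<phi> Q)\<^sup>2
    \<le> (2::real) * (\<Sum>Q | Q \<in> U \<and> P \<le> Q. \<phi> Q * (\<Sum>R | R \<in> U \<and> Q \<le> R. \<phi> R))"
proof -
  define I where "I = {Q \<in> U. P \<le> Q}"
  have fI: "finite I" by (rule finite_subset[OF _ finite_V]) (use assms in \<open>auto simp: I_def\<close>)
  have pos: "0 \<le> \<phi> Q" if "Q \<in> I" for Q using assms that by (auto simp: I_def)
  have cmp: "Q \<le> R \<or> R \<le> Q" if "Q \<in> I" "R \<in> I" for Q R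
    using forest[of P Q R] assms that by (auto simp: I_def)
  have "(sum \<phi> I)\<^sup>2 = (\<Sum>Q\<in>I. \<Sum>R\<in>I. \<phi> Q * \<phi> R)"
    by (simp add: power2_eq_square sum_product)
  also have "\<dots> \<le> (\<Sum>Q\<in>I. \<Sum>R\<in>I. (if Q \<le> R then \<phi> Q * \<phi> R else 0) + (if R \<le> Q then \<phi> Q * \<phi> R else 0))"
    using cmp pos by (intro sum_mono) auto
  also have "\<dots> = (\<Sum>Q\<in>I. \<Sum>R\<in>I. (if Q \<le> R then \<phi> Q * \<phi> R else 0))
      + (\<Sum>Q\<in>I. \<Sum>R\<in>I. (if R \<le> Q then \<phi> Q * \<phi> R else 0))"
    by (simp add: sum.distrib)
  also have "(\<Sum>Q\<in>I. \<Sum>R\<in>I. (if R \<le> Q then \<phi> Q * \<phi> R else 0))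
      = (\<Sum>Q\<in>I. \<Sum>R\<in>I. (if Q \<le> R then \<phi> Q * \<phi> R else 0))"
    by (subst sum.swap) (intro sum.cong refl, simp add: mult.commute)
  also have "(\<Sum>Q\<in>I. \<Sum>R\<in>I. (if Q \<le> R then \<phi> Q * \<phi> R else 0))
      = (\<Sum>Q\<in>I. \<phi> Q * (\<Sum>R | R \<in> U \<and> Q \<le> R. \<phi> R))"
  proof (rule sum.cong[OF refl])
    fix Q assume Q: "Q \<in> I"
    have "(\<Sum>R | R \<in> U \<and> Q \<le> R. \<phi> R) = (\<Sum>R | R \<in> I \<and> Q \<le> R. \<phi> R)"
      using Q by (intro sum.cong) (auto simp: I_def)
    also have "\<dots> = (\<Sum>R\<in>I. if Q \<le> R then \<phi> R else 0)"
      using fI by (simp add: sum.inter_filter)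
    finally show "(\<Sum>R\<in>I. (if Q \<le> R then \<phi> Q * \<phi> R else 0)) = \<phi> Q * (\<Sum>R | R \<in> U \<and> Q \<le> R. \<phi> R)"
      by (simp add: sum_distrib_left if_distrib cong: if_cong)
  qed
  finally show ?thesis by (simp add: I_def)
qed

text \<open>Linearising the square along chains leaves exactly one factor \<open>below w Q\<close>;
  paired with \<open>below s Q\<close> it is absorbed into \<open>A * (m Q)\<^sup>2\<close>, so
  \<open>w\<close> is traded for \<open>m\<close>. A second exchange of sums brings in the packing
  of \<open>m\<close> and leaves only masses of \<open>s\<close>, which add up to at most
  \<open>a\<close> times that of \<open>F\<close>.\<close>

lemma testing:
  fixes A a c :: real
  assumes U: "U \<subseteq> V" "\<And>Q. Q \<in> U \<Longrightarrow> Q \<le> F" and F: "F \<in> V"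
    and s: "\<And>P. P \<in> V \<Longrightarrow> 0 \<le> s P" and w: "\<And>P. P \<in> V \<Longrightarrow> 0 \<le> w P"
    and m: "\<And>P. P \<in> V \<Longrightarrow> 0 < m P" and A: "0 \<le> A" "0 \<le> c"
    and B: "\<And>Q. Q \<in> V \<Longrightarrow> below s Q * below w Q \<le> A * (m Q)\<^sup>2"
    and C: "\<And>Q. Q \<in> V \<Longrightarrow> below m Q \<le> c * m Q"
    and S: "\<And>Q. Q \<in> V \<Longrightarrow> below (below s) Q \<le> a * below s Q"
  shows "(\<Sum>P\<in>V. w P * (\<Sum>Q | Q \<in> U \<and> P \<le> Q. below s Q / m Q)\<^sup>2) \<le> 2 * A * c * a * below s F"
proof -
  define \<phi> where "\<phi> Q = below s Q / m Q" for Q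
  define \<psi> where "\<psi> P = (\<Sum>Q | Q \<in> U \<and> P \<le> Q. \<phi> Q)" for P
  have fU: "finite U" using U finite_V finite_subset by auto
  have inV: "Q \<in> V" if "Q \<in> U" for Q using U that by auto
  have s0: "0 \<le> below s Q" for Q using s by (rule below_nonneg)
  have phi0: "0 \<le> \<phi> Q" if "Q \<in> U" for Q using s0 m[OF inV[OF that]] by (simp add: \<phi>_def)
  have psi0: "0 \<le> \<psi> Q" for Q using phi0 by (auto simp: \<psi>_def intro!: sum_nonneg)
  have "(\<Sum>P\<in>V. w P * (\<psi> P)\<^sup>2) \<le> (\<Sum>P\<in>V. w P * (2 * (\<Sum>Q | Q \<in> U \<and> P \<le> Q. \<phi> Q * \<psi> Q)))"
    unfolding \<psi>_def using U(1) phi0 w by (intro sum_mono mult_left_mono square_sum_above_le) auto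
  also have "\<dots> = 2 * (\<Sum>Q\<in>U. (\<phi> Q * \<psi> Q) * below w Q)"
    unfolding sum_below_swap[OF U(1)] by (simp add: sum_distrib_left mult_ac)
  also have "\<dots> \<le> 2 * (\<Sum>Q\<in>U. A * (\<psi> Q * m Q))"
  proof (intro mult_left_mono sum_mono)
    fix Q assume Q: "Q \<in> U"
    have mp: "m Q > 0" using m[OF inV[OF Q]] .
    have "\<phi> Q * below w Q \<le> A * m Q"
      using B[OF inV[OF Q]] mp by (simp add: \<phi>_def field_simps power2_eq_square)
    then have "\<psi> Q * (\<phi> Q * below w Q) \<le> \<psi> Q * (A * m Q)"
      using psi0 by (rule mult_left_mono)
    then show "\<phi> Q * \<psi> Q * below w Q \<le> A * (\<psi> Q * m Q)" by (simp add: mult_ac)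
  qed simp
  also have "\<dots> = 2 * A * (\<Sum>Q\<in>U. m Q * \<psi> Q)" by (simp add: sum_distrib_left mult_ac)
  \<comment> \<open>The outer sum is enlarged from \<open>U\<close> to \<open>V\<close> because the
    next exchange of sums has to produce \<open>below m\<close>, a sum over all of
    \<open>V\<close>.\<close>
  also have "\<dots> \<le> 2 * A * (\<Sum>Q\<in>V. m Q * \<psi> Q)"
    using A U finite_V m psi0
    by (intro mult_left_mono sum_mono2) (auto intro!: mult_nonneg_nonneg intro: less_imp_le)
  also have "\<dots> = 2 * A * (\<Sum>Q\<in>U. \<phi> Q * below m Q)"
    unfolding \<psi>_def sum_below_swap[OF U(1)] ..
  also have "\<dots> \<le> 2 * A * (\<Sum>Q\<in>U. c * below s Q)"
  proof (intro mult_left_mono sum_mono)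
    fix Q assume Q: "Q \<in> U"
    have "\<phi> Q * below m Q \<le> \<phi> Q * (c * m Q)"
      by (intro mult_left_mono C inV phi0 Q)
    also have "\<dots> = c * below s Q" using m[OF inV[OF Q]] by (simp add: \<phi>_def)
    finally show "\<phi> Q * below m Q \<le> c * below s Q" .
  qed (use A in simp)
  also have "\<dots> = 2 * A * c * (\<Sum>Q\<in>U. below s Q)" by (simp add: sum_distrib_left mult_ac)
  also have "\<dots> \<le> 2 * A * c * (a * below s F)"
  proof (intro mult_left_mono)
    have "(\<Sum>Q\<in>U. below s Q) \<le> below (below s) F"
      unfolding below_def[of "below s"] using U finite_V s0 by (intro sum_mono2) auto
    also have "\<dots> \<le> a * below s F" using S F by auto
    finally show "(\<Sum>Q\<in>U. below s Q) \<le> a * below s F" .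
  qed (use A in simp)
  finally show ?thesis by (simp add: \<psi>_def \<phi>_def mult_ac)
qed


text \<open>The stopping vertices \<open>Rec\<close> are those of \<open>V1\<close> at which the dyadic level \<open>\<kappa>\<close> of the average
  of \<open>f\<close> exceeds its value at all ancestors in \<open>V1\<close>. The function \<open>\<Phi>\<close> attached to a stopping
  vertex \<open>F\<close> is constant below each next stopping vertex \<open>G\<close>, and there the defining inequality of
  \<open>V1\<close> replaces \<open>g\<close> by \<open>f\<close>.\<close>

lemma stopping_half:
  fixes A a c :: real
  assumes s: "\<And>P. P \<in> V \<Longrightarrow> 0 \<le> s P" and w: "\<And>P. P \<in> V \<Longrightarrow> 0 \<le> w P"
    and f: "\<And>P. P \<in> V \<Longrightarrow> 0 \<le> f P" and g: "\<And>P. P \<in> V \<Longrightarrow> 0 \<le> g P"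
    and m: "\<And>P. P \<in> V \<Longrightarrow> 0 < m P" and A: "0 \<le> A" "0 \<le> c" "0 \<le> a"
    and spos: "\<And>P. P \<in> V \<Longrightarrow> 0 < below s P" and wpos: "\<And>P. P \<in> V \<Longrightarrow> 0 < below w P"
    and B: "\<And>Q. Q \<in> V \<Longrightarrow> below s Q * below w Q \<le> A * (m Q)\<^sup>2"
    and C: "\<And>Q. Q \<in> V \<Longrightarrow> below m Q \<le> c * m Q"
    and S: "\<And>Q. Q \<in> V \<Longrightarrow> below (below s) Q \<le> a * below s Q"
  defines "fs \<equiv> below (\<lambda>P. f P * s P)" and "gw \<equiv> below (\<lambda>P. g P * w P)"
  defines "V1 \<equiv> {Q \<in> V. 0 < fs Q \<and> (gw Q)\<^sup>2 * below s Q \<le> (fs Q)\<^sup>2 * below w Q}"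
  defines "nf \<equiv> (\<Sum>P\<in>V. (f P)\<^sup>2 * s P)" and "ng \<equiv> (\<Sum>P\<in>V. (g P)\<^sup>2 * w P)"
  shows "(\<Sum>Q\<in>V1. fs Q * gw Q / m Q) \<le> 4 * sqrt (2 * A * c * a) * sqrt nf * (sqrt ng + 4 * sqrt nf)"
proof -
  \<comment> \<open>On \<open>V1\<close>, \<open>e Q\<close> is the average of \<open>f\<close> over
    \<open>Q\<close> rounded down to a power of two. The rounding makes the levels integers, so that
    distinct levels are lacunary.\<close>
  define \<kappa> where "\<kappa> Q = \<lfloor>log 2 (fs Q / below s Q)\<rfloor>" for Q
  define e where "e Q = (2 powi \<kappa> Q :: real)" for Q
  define Rec where "Rec = {F \<in> V1. \<forall>P\<in>V1. F < P \<longrightarrow> \<kappa> P < \<kappa> F}"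
  \<comment> \<open>On the chain of members of \<open>V1\<close> above \<open>Q\<close> the level
    need not be monotone. \<open>Q\<close> belongs to \<open>Cl F\<close> when the largest level on
    that chain is attained at \<open>F\<close>; for a record \<open>F\<close> this is its topmost
    occurrence.\<close>
  define Cl where "Cl F = {Q \<in> V1. Q \<le> F \<and> (\<forall>P\<in>V1. Q \<le> P \<longrightarrow> \<kappa> P \<le> \<kappa> F)}" for F
  define Ch where "Ch F = {G \<in> Rec. G < F \<and> (\<forall>H\<in>Rec. G < H \<longrightarrow> \<not> H < F)}" for F
  \<comment> \<open>What is left of \<open>F\<close> after all stopping vertices strictly inside it
    are removed. For distinct stopping vertices these remainders are disjoint, so the part of
    \<open>g\<close> living on them is counted once.\<close>
  define E where "E F = {P \<in> V. P \<le> F \<and> (\<forall>H\<in>Rec. H < F \<longrightarrow> \<not> P \<le> H)}" for F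
  define X where "X = (\<Sum>F\<in>Rec. (e F)\<^sup>2 * below s F)"
  define T where "T = 2 * A * c * a"
  have V1V: "V1 \<subseteq> V" and RecV1: "Rec \<subseteq> V1" and ClV1: "Cl F \<subseteq> V1" and ChRec: "Ch F \<subseteq> Rec"
    and EV: "E F \<subseteq> V" for F
    by (auto simp: V1_def Rec_def Cl_def Ch_def E_def)
  have EV': "P \<in> V" if "P \<in> E F" for P F using that by (simp add: E_def)
  have ClV1': "Q \<in> V1" if "Q \<in> Cl F" for Q F using that by (simp add: Cl_def)
  note inV = V1V[THEN subsetD] RecV1[THEN subsetD, THEN V1V[THEN subsetD]]
  have fin: "finite V1" "finite Rec" "finite (Cl F)" "finite (Ch F)" "finite (E F)" for F
    using V1V RecV1 ClV1[of F] ChRec[of F] EV[of F] finite_V by (meson finite_subset)+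
  have T0: "0 \<le> T" using A by (simp add: T_def)
  have gw0: "0 \<le> gw Q" for Q unfolding gw_def using g w by (intro below_nonneg) auto
  have s0: "0 \<le> below s Q" and w0: "0 \<le> below w Q" for Q using s w by (auto intro: below_nonneg)
  have e0: "0 < e Q" for Q by (simp add: e_def)
  have e_le: "e Q * below s Q \<le> fs Q" and e_ge: "fs Q \<le> 2 * e Q * below s Q" if "Q \<in> V1" for Q
  proof -
    have sp: "below s Q > 0" using that V1V spos by auto
    have fp: "fs Q / below s Q > 0" using that sp by (simp add: V1_def)
    have 1: "of_int (\<kappa> Q) \<le> log 2 (fs Q / below s Q)" "log 2 (fs Q / below s Q) < of_int (\<kappa> Q + 1)"
      unfolding \<kappa>_def by linarith+
    have "2 powr of_int (\<kappa> Q) \<le> fs Q / below s Q" "fs Q / below s Q < 2 powr of_int (\<kappa> Q + 1)"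
      using 1 fp by (simp_all add: le_log_iff log_less_iff)
    then have "e Q \<le> fs Q / below s Q" "fs Q / below s Q < 2 * e Q"
      by (simp_all add: e_def powr_add flip: powr_real_of_int')
    then show "e Q * below s Q \<le> fs Q" "fs Q \<le> 2 * e Q * below s Q"
      using sp by (simp_all add: field_simps)
  qed
  have nf0: "0 \<le> nf" and ng0: "0 \<le> ng"
    unfolding nf_def ng_def using s w by (auto intro!: sum_nonneg)
  have X0: "0 \<le> X" unfolding X_def using s0 by (intro sum_nonneg) auto

  \<comment> \<open>This takes the place of the maximal function theorem. One factor
    \<open>e F\<close> is replaced by the average of \<open>f\<close>, and Cauchy-Schwarz gives a
    bound with the square root of \<open>X\<close> on the right; \<open>X\<close> is a finite sum,
    so this root can be divided out.\<close>
  have X_le: "X \<le> 4 * nf"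
  proof -
    have "X \<le> (\<Sum>F\<in>Rec. e F * fs F)"
      unfolding X_def power2_eq_square mult.assoc
      using e_le RecV1 e0 by (intro sum_mono mult_left_mono) (auto intro: less_imp_le)
    also have "\<dots> = (\<Sum>P\<in>V. (f P * s P) * (\<Sum>F | F \<in> Rec \<and> P \<le> F. e F))"
      unfolding fs_def using RecV1 V1V by (intro sum_below_swap) auto
    also have "\<dots> = (\<Sum>P\<in>V. (f P * sqrt (s P)) * (sqrt (s P) * (\<Sum>F | F \<in> Rec \<and> P \<le> F. e F)))"
    proof (intro sum.cong refl)
      fix P assume "P \<in> V"
      then have "s P = sqrt (s P) * sqrt (s P)" using s by simp
      then show "(f P * s P) * (\<Sum>F | F \<in> Rec \<and> P \<le> F. e F)
        = (f P * sqrt (s P)) * (sqrt (s P) * (\<Sum>F | F \<in> Rec \<and> P \<le> F. e F))"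
        by (metis mult.assoc)
    qed
    also have "\<dots> \<le> sqrt (\<Sum>P\<in>V. (f P * sqrt (s P))\<^sup>2) *
        sqrt (\<Sum>P\<in>V. (sqrt (s P) * (\<Sum>F | F \<in> Rec \<and> P \<le> F. e F))\<^sup>2)"
      by (rule sum_mult_le_sqrt)
    also have "(\<Sum>P\<in>V. (f P * sqrt (s P))\<^sup>2) = nf"
      unfolding nf_def using s by (intro sum.cong) (auto simp: power_mult_distrib)
    also have "sqrt nf * sqrt (\<Sum>P\<in>V. (sqrt (s P) * (\<Sum>F | F \<in> Rec \<and> P \<le> F. e F))\<^sup>2)
        \<le> sqrt nf * sqrt (4 * X)"
    proof (intro mult_left_mono real_sqrt_le_mono)
      have "(\<Sum>P\<in>V. (sqrt (s P) * (\<Sum>F | F \<in> Rec \<and> P \<le> F. e F))\<^sup>2)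
        \<le> (\<Sum>P\<in>V. s P * (\<Sum>F | F \<in> Rec \<and> P \<le> F. 4 * (e F)\<^sup>2))"
      proof (intro sum_mono)
        fix P assume P: "P \<in> V"
        define I where "I = {F \<in> Rec. P \<le> F}"
        \<comment> \<open>Going down a chain, the levels of the stopping vertices strictly increase,
          so the values \<open>e F\<close> are distinct powers of two.\<close>
        have "inj_on \<kappa> I"
        proof (rule inj_onI, rule ccontr)
          fix F G assume FG: "F \<in> I" "G \<in> I" "\<kappa> F = \<kappa> G" "F \<noteq> G"
          then have "F < G \<or> G < F" using forest[of P F G] P inV by (auto simp: I_def)
          then show False using FG by (auto simp: I_def Rec_def)
        qed
        moreover have "finite I" using fin by (simp add: I_def)
        ultimately have "(\<Sum>F\<in>I. e F)\<^sup>2 \<le> 4 * (\<Sum>F\<in>I. (e F)\<^sup>2)"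
          unfolding e_def by (intro sum_powi_two_square_le)
        then have "s P * (\<Sum>F\<in>I. e F)\<^sup>2 \<le> s P * (\<Sum>F\<in>I. 4 * (e F)\<^sup>2)"
          using s P by (intro mult_left_mono) (auto simp: sum_distrib_left)
        then show "(sqrt (s P) * (\<Sum>F | F \<in> Rec \<and> P \<le> F. e F))\<^sup>2
            \<le> s P * (\<Sum>F | F \<in> Rec \<and> P \<le> F. 4 * (e F)\<^sup>2)"
          using s P by (simp add: power_mult_distrib I_def)
      qed
      also have "\<dots> = (\<Sum>F\<in>Rec. 4 * (e F)\<^sup>2 * below s F)"
        using RecV1 V1V by (intro sum_below_swap[symmetric]) auto
      finally show "(\<Sum>P\<in>V. (sqrt (s P) * (\<Sum>F | F \<in> Rec \<and> P \<le> F. e F))\<^sup>2) \<le> 4 * X"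
        by (simp add: X_def sum_distrib_left mult.assoc)
    qed (use nf0 in simp)
    finally have X1: "X \<le> sqrt nf * sqrt (4 * X)" .
    show ?thesis
    proof (cases "X = 0")
      case False
      have "X\<^sup>2 \<le> (sqrt nf * sqrt (4 * X))\<^sup>2" using X1 X0 by (intro power_mono)
      also have "\<dots> = (4 * nf) * X" using nf0 X0 by (simp add: power_mult_distrib)
      finally show ?thesis using X0 False by (simp add: power2_eq_square)
    qed (use nf0 in simp)
  qed

  have local: "(\<Sum>Q\<in>Cl F. below s Q / m Q * gw Q)
      \<le> sqrt (T * below s F) * (sqrt (\<Sum>P\<in>E F. (g P)\<^sup>2 * w P) + sqrt (\<Sum>G\<in>Ch F. 4 * ((e G)\<^sup>2 * below s G)))"
    if F: "F \<in> Rec" for F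
  proof -
    define \<Phi> where "\<Phi> P = (\<Sum>Q | Q \<in> Cl F \<and> P \<le> Q. below s Q / m Q)" for P
    have Phi0: "0 \<le> \<Phi> P" for P
      unfolding \<Phi>_def using ClV1[of F] V1V m s0 by (intro sum_nonneg divide_nonneg_pos) auto
    have ClV: "Cl F \<subseteq> V" using ClV1[of F] V1V by auto
    have test: "(\<Sum>P\<in>V. w P * (\<Phi> P)\<^sup>2) \<le> T * below s F"
      unfolding \<Phi>_def T_def
      by (rule testing[OF ClV _ _ s w m A(1,2) B C S]) (use F inV in \<open>auto simp: Cl_def\<close>)
    have "(\<Sum>Q\<in>Cl F. below s Q / m Q * gw Q) = (\<Sum>P\<in>V. (g P * w P) * \<Phi> P)"
      unfolding gw_def \<Phi>_def by (rule sum_below_swap[OF ClV])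
    also have "\<dots> = (\<Sum>P | P \<in> V \<and> P \<le> F. (g P * w P) * \<Phi> P)"
    proof (rule sum.mono_neutral_right[OF finite_V])
      show "\<forall>i\<in>V - {P \<in> V. P \<le> F}. g i * w i * \<Phi> i = 0"
      proof
        fix P assume "P \<in> V - {P \<in> V. P \<le> F}"
        then have P: "P \<in> V" "\<not> P \<le> F" by auto
        then have "{Q \<in> Cl F. P \<le> Q} = {}" using order_trans by (fastforce simp: Cl_def)
        then have "\<Phi> P = 0" unfolding \<Phi>_def by (simp only: sum.empty)
        then show "g P * w P * \<Phi> P = 0" by simp
      qed
    qed auto
    also have "\<dots> \<le> (\<Sum>P\<in>E F. (g P * w P) * \<Phi> P) + (\<Sum>G\<in>Ch F. \<Sum>P | P \<in> V \<and> P \<le> G. (g P * w P) * \<Phi> P)"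
    proof -
      have sub: "{P \<in> V. P \<le> F} \<subseteq> E F \<union> (\<Union>G\<in>Ch F. {P \<in> V. P \<le> G})"
      proof
        fix P assume P: "P \<in> {P \<in> V. P \<le> F}"
        show "P \<in> E F \<union> (\<Union>G\<in>Ch F. {P \<in> V. P \<le> G})"
        proof (cases "P \<in> E F")
          case False
          define Y where "Y = {H \<in> Rec. H < F \<and> P \<le> H}"
          have "Y \<noteq> {}" "finite Y" using False P fin by (auto simp: Y_def E_def)
          then obtain G where G: "G \<in> Y" "\<And>H. H \<in> Y \<Longrightarrow> G \<le> H \<Longrightarrow> G = H"
            using finite_has_maximal[of Y] by metis
          have "G \<in> Ch F"
            using G(1) G(2) unfolding Ch_def Y_def by (auto intro: order_trans less_imp_le)
          then show ?thesis using G P by (auto simp: Y_def)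
        qed simp
      qed
      have nn: "0 \<le> (g P * w P) * \<Phi> P" if "P \<in> V" for P using that g w Phi0 by simp
      have "(\<Sum>P | P \<in> V \<and> P \<le> F. (g P * w P) * \<Phi> P)
          \<le> (\<Sum>P\<in>E F \<union> (\<Union>G\<in>Ch F. {P \<in> V. P \<le> G}). (g P * w P) * \<Phi> P)"
        using sub fin nn finite_V EV' by (intro sum_mono2) auto
      also have "\<dots> \<le> (\<Sum>P\<in>E F. (g P * w P) * \<Phi> P) + (\<Sum>P\<in>(\<Union>G\<in>Ch F. {P \<in> V. P \<le> G}). (g P * w P) * \<Phi> P)"
        using fin nn finite_V EV' by (intro sum_Un_le) auto
      also have "(\<Sum>P\<in>(\<Union>G\<in>Ch F. {P \<in> V. P \<le> G}). (g P * w P) * \<Phi> P)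
          \<le> (\<Sum>G\<in>Ch F. \<Sum>P | P \<in> V \<and> P \<le> G. (g P * w P) * \<Phi> P)"
        using fin finite_V nn by (intro sum_UNION_le) auto
      finally show ?thesis by simp
    qed
    also have "(\<Sum>P\<in>E F. (g P * w P) * \<Phi> P) \<le> sqrt (T * below s F) * sqrt (\<Sum>P\<in>E F. (g P)\<^sup>2 * w P)"
    proof -
      have "(\<Sum>P\<in>E F. (g P * w P) * \<Phi> P) = (\<Sum>P\<in>E F. (sqrt (w P) * \<Phi> P) * (g P * sqrt (w P)))"
      proof (intro sum.cong refl)
        fix P assume "P \<in> E F"
        then have "w P = sqrt (w P) * sqrt (w P)" using w EV' by auto
        then show "(g P * w P) * \<Phi> P = (sqrt (w P) * \<Phi> P) * (g P * sqrt (w P))"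
          by (metis mult.assoc mult.commute)
      qed
      also have "\<dots> \<le> sqrt (\<Sum>P\<in>E F. (sqrt (w P) * \<Phi> P)\<^sup>2) * sqrt (\<Sum>P\<in>E F. (g P * sqrt (w P))\<^sup>2)"
        by (rule sum_mult_le_sqrt)
      also have "(\<Sum>P\<in>E F. (g P * sqrt (w P))\<^sup>2) = (\<Sum>P\<in>E F. (g P)\<^sup>2 * w P)"
        using w EV' by (intro sum.cong) (auto simp: power_mult_distrib)
      also have "(\<Sum>P\<in>E F. (sqrt (w P) * \<Phi> P)\<^sup>2) = (\<Sum>P\<in>E F. w P * (\<Phi> P)\<^sup>2)"
        using w EV' by (intro sum.cong) (auto simp: power_mult_distrib)
      also have "sqrt \<dots> * sqrt (\<Sum>P\<in>E F. (g P)\<^sup>2 * w P) \<le> sqrt (T * below s F) * sqrt (\<Sum>P\<in>E F. (g P)\<^sup>2 * w P)"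
      proof (intro mult_right_mono real_sqrt_le_mono)
        have "(\<Sum>P\<in>E F. w P * (\<Phi> P)\<^sup>2) \<le> (\<Sum>P\<in>V. w P * (\<Phi> P)\<^sup>2)"
          using EV finite_V w by (intro sum_mono2) auto
        then show "(\<Sum>P\<in>E F. w P * (\<Phi> P)\<^sup>2) \<le> T * below s F" using test by simp
      qed (use w EV' in \<open>auto intro!: sum_nonneg\<close>)
      finally show ?thesis .
    qed
    also have "(\<Sum>G\<in>Ch F. \<Sum>P | P \<in> V \<and> P \<le> G. (g P * w P) * \<Phi> P)
        \<le> sqrt (T * below s F) * sqrt (\<Sum>G\<in>Ch F. 4 * ((e G)\<^sup>2 * below s G))"
    proof -
      \<comment> \<open>If some \<open>Q\<close> in \<open>Cl F\<close> were above \<open>P\<close>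
        but not above \<open>G\<close>, it would lie below \<open>G\<close>. Then \<open>G\<close>
        would be an ancestor of \<open>Q\<close> of level at most that of \<open>F\<close>, although
        a record below \<open>F\<close> has a higher level.\<close>
      have const: "\<Phi> P = \<Phi> G" if G: "G \<in> Ch F" and P: "P \<in> V" "P \<le> G" for G P
      proof -
        have GV: "G \<in> Rec" "G < F" "G \<in> V" using G inV by (auto simp: Ch_def)
        have "G \<le> Q" if Q: "Q \<in> Cl F" "P \<le> Q" for Q
        proof (rule ccontr)
          assume "\<not> G \<le> Q"
          then have "Q \<le> G" using forest[of P Q G] P Q GV ClV by auto
          then have "\<kappa> G \<le> \<kappa> F" using Q GV RecV1 by (auto simp: Cl_def)
          moreover have "\<kappa> F < \<kappa> G" using GV F RecV1 by (auto simp: Rec_def)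
          ultimately show False by simp
        qed
        then have "{Q \<in> Cl F. P \<le> Q} = {Q \<in> Cl F. G \<le> Q}" using P(2) order_trans by blast
        then show ?thesis by (simp add: \<Phi>_def)
      qed
      have disj: "G = H" if "G \<in> Ch F" "H \<in> Ch F" "P \<in> V" "P \<le> G" "P \<le> H" for G H P
        using that forest[of P G H] inV ChRec[of F] unfolding Ch_def by (auto simp: order_le_less)
      have "(\<Sum>G\<in>Ch F. \<Sum>P | P \<in> V \<and> P \<le> G. (g P * w P) * \<Phi> P) = (\<Sum>G\<in>Ch F. \<Phi> G * gw G)"
      proof (intro sum.cong refl)
        fix G assume G: "G \<in> Ch F"
        have "(\<Sum>P | P \<in> V \<and> P \<le> G. (g P * w P) * \<Phi> P) = (\<Sum>P | P \<in> V \<and> P \<le> G. (g P * w P) * \<Phi> G)"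
          using const[OF G] by (intro sum.cong) auto
        then show "(\<Sum>P | P \<in> V \<and> P \<le> G. (g P * w P) * \<Phi> P) = \<Phi> G * gw G"
          by (simp add: gw_def below_def sum_distrib_left mult.commute)
      qed
      also have "\<dots> \<le> (\<Sum>G\<in>Ch F. (\<Phi> G * sqrt (below w G)) * sqrt (4 * ((e G)\<^sup>2 * below s G)))"
      proof (intro sum_mono)
        fix G assume "G \<in> Ch F"
        then have G: "G \<in> V1" "G \<in> V" using ChRec RecV1 V1V by blast+
        have sp: "0 < below s G" using spos G by auto
        \<comment> \<open>Bounding the average of \<open>f\<close> from above by
          \<open>2 * e G\<close> leaves a spare factor \<open>below s G\<close> on both sides; it is
          positive and cancels.\<close>
        have "(gw G)\<^sup>2 * below s G \<le> (fs G)\<^sup>2 * below w G" using G by (simp add: V1_def)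
        also have "\<dots> \<le> (2 * e G * below s G)\<^sup>2 * below w G"
          using e_ge[OF G(1)] G(1) w0 by (intro mult_right_mono power_mono) (auto simp: V1_def)
        finally have "(gw G)\<^sup>2 * below s G \<le> (below w G * (4 * ((e G)\<^sup>2 * below s G))) * below s G"
          by (simp add: power2_eq_square mult_ac)
        then have "(gw G)\<^sup>2 \<le> below w G * (4 * ((e G)\<^sup>2 * below s G))" using sp by simp
        then have "gw G \<le> sqrt (below w G) * sqrt (4 * ((e G)\<^sup>2 * below s G))"
          by (metis real_le_rsqrt real_sqrt_mult)
        then show "\<Phi> G * gw G \<le> (\<Phi> G * sqrt (below w G)) * sqrt (4 * ((e G)\<^sup>2 * below s G))"
          using mult_left_mono[OF _ Phi0[of G]] by (simp add: mult.assoc)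
      qed
      also have "\<dots> \<le> sqrt (\<Sum>G\<in>Ch F. (\<Phi> G * sqrt (below w G))\<^sup>2)
          * sqrt (\<Sum>G\<in>Ch F. (sqrt (4 * ((e G)\<^sup>2 * below s G)))\<^sup>2)"
        by (rule sum_mult_le_sqrt)
      also have "(\<Sum>G\<in>Ch F. (sqrt (4 * ((e G)\<^sup>2 * below s G)))\<^sup>2) = (\<Sum>G\<in>Ch F. 4 * ((e G)\<^sup>2 * below s G))"
        using s0 by (intro sum.cong) auto
      \<comment> \<open>By constancy each square is again a sum of
        \<open>w P * (\<Phi> P)\<^sup>2\<close> over the vertices below \<open>G\<close>. The next
        stopping vertices have disjoint sets of descendants, so a single use of the testing bound
        covers all of them.\<close>
      also have "(\<Sum>G\<in>Ch F. (\<Phi> G * sqrt (below w G))\<^sup>2) = (\<Sum>G\<in>Ch F. \<Sum>P | P \<in> V \<and> P \<le> G. w P * (\<Phi> P)\<^sup>2)"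
      proof (intro sum.cong refl)
        fix G assume G: "G \<in> Ch F"
        have "(\<Sum>P | P \<in> V \<and> P \<le> G. w P * (\<Phi> P)\<^sup>2) = (\<Sum>P | P \<in> V \<and> P \<le> G. w P * (\<Phi> G)\<^sup>2)"
          using const[OF G] by (intro sum.cong) auto
        then show "(\<Phi> G * sqrt (below w G))\<^sup>2 = (\<Sum>P | P \<in> V \<and> P \<le> G. w P * (\<Phi> P)\<^sup>2)"
          using w0[of G] by (simp add: power_mult_distrib) (simp add: below_def sum_distrib_left mult.commute)
      qed
      also have "\<dots> = (\<Sum>P\<in>(\<Union>G\<in>Ch F. {P \<in> V. P \<le> G}). w P * (\<Phi> P)\<^sup>2)"
        using fin finite_V disj by (intro sum.UNION_disjoint[symmetric]) auto
      also have "sqrt \<dots> * sqrt (\<Sum>G\<in>Ch F. 4 * ((e G)\<^sup>2 * below s G))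
          \<le> sqrt (T * below s F) * sqrt (\<Sum>G\<in>Ch F. 4 * ((e G)\<^sup>2 * below s G))"
      proof (intro mult_right_mono real_sqrt_le_mono)
        have "(\<Sum>P\<in>(\<Union>G\<in>Ch F. {P \<in> V. P \<le> G}). w P * (\<Phi> P)\<^sup>2) \<le> (\<Sum>P\<in>V. w P * (\<Phi> P)\<^sup>2)"
          using finite_V w by (intro sum_mono2) auto
        then show "(\<Sum>P\<in>(\<Union>G\<in>Ch F. {P \<in> V. P \<le> G}). w P * (\<Phi> P)\<^sup>2) \<le> T * below s F"
          using test by simp
      qed (use s0 in \<open>auto intro!: sum_nonneg\<close>)
      finally show ?thesis .
    qed
    finally show ?thesis by (simp add: distrib_left)
  qed

  \<comment> \<open>Among the members of \<open>V1\<close> above \<open>Q\<close>, take those of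
    largest level and then a maximal one: nothing above it reaches the same level.\<close>
  have cover: "\<exists>F\<in>Rec. Q \<in> Cl F" if Q: "Q \<in> V1" for Q
  proof -
    define Y where "Y = {P \<in> V1. Q \<le> P}"
    have Y: "finite Y" "Y \<noteq> {}" using fin Q by (auto simp: Y_def)
    define M where "M = Max (\<kappa> ` Y)"
    have M: "M \<in> \<kappa> ` Y" "\<And>P. P \<in> Y \<Longrightarrow> \<kappa> P \<le> M" unfolding M_def using Y by auto
    define Z where "Z = {P \<in> Y. \<kappa> P = M}"
    have "finite Z" "Z \<noteq> {}" using Y M by (auto simp: Z_def)
    then obtain F where F: "F \<in> Z" "\<And>H. H \<in> Z \<Longrightarrow> F \<le> H \<Longrightarrow> F = H"
      using finite_has_maximal[of Z] by metis
    have "F \<in> Rec"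
    proof -
      have "\<kappa> P < \<kappa> F" if P: "P \<in> V1" "F < P" for P
      proof -
        have PY: "P \<in> Y" using P F by (auto simp: Y_def Z_def)
        have "\<kappa> P \<noteq> M"
        proof
          assume "\<kappa> P = M"
          then have "P \<in> Z" using PY by (simp add: Z_def)
          then have "F = P" using F(2) P(2) by (simp add: less_imp_le)
          then show False using P(2) by simp
        qed
        then show ?thesis using M(2)[OF PY] F by (auto simp: Z_def)
      qed
      then show ?thesis using F by (auto simp: Rec_def Z_def Y_def)
    qed
    moreover have "Q \<in> Cl F"
      using F M Q by (auto simp: Cl_def Z_def Y_def)
    ultimately show ?thesis by blast
  qed
  have "(\<Sum>Q\<in>V1. fs Q * gw Q / m Q) \<le> (\<Sum>F\<in>Rec. \<Sum>Q\<in>Cl F. fs Q * gw Q / m Q)"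
  proof -
    have nn: "0 \<le> fs Q * gw Q / m Q" if "Q \<in> V1" for Q
      using that gw0 m V1V by (auto simp: V1_def intro!: divide_nonneg_pos)
    have "(\<Sum>Q\<in>V1. fs Q * gw Q / m Q) \<le> (\<Sum>Q\<in>(\<Union>F\<in>Rec. Cl F). fs Q * gw Q / m Q)"
      using fin cover nn ClV1' by (intro sum_mono2) auto
    also have "\<dots> \<le> (\<Sum>F\<in>Rec. \<Sum>Q\<in>Cl F. fs Q * gw Q / m Q)"
      using fin nn ClV1' by (intro sum_UNION_le) auto
    finally show ?thesis .
  qed
  also have "\<dots> \<le> (\<Sum>F\<in>Rec. 2 * e F * (\<Sum>Q\<in>Cl F. below s Q / m Q * gw Q))"
    unfolding sum_distrib_left
  proof (intro sum_mono)
    fix F Q assume F: "F \<in> Rec" and Q: "Q \<in> Cl F"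
    then have QV: "Q \<in> V1" "Q \<in> V" using ClV1 V1V by blast+
    have "\<kappa> Q \<le> \<kappa> F" using Q by (auto simp: Cl_def)
    then have "e Q \<le> e F" unfolding e_def by (intro power_int_increasing) auto
    then have "fs Q \<le> 2 * e F * below s Q"
      using e_ge[OF QV(1)] mult_right_mono[OF _ s0[of Q]] by (smt (verit))
    then have "fs Q * (gw Q / m Q) \<le> 2 * e F * below s Q * (gw Q / m Q)"
      using gw0 m[OF QV(2)] by (intro mult_right_mono) auto
    then show "fs Q * gw Q / m Q \<le> 2 * e F * (below s Q / m Q * gw Q)" by simp
  qed
  also have "\<dots> \<le> (\<Sum>F\<in>Rec. 2 * e F * (sqrt (T * below s F) *
      (sqrt (\<Sum>P\<in>E F. (g P)\<^sup>2 * w P) + sqrt (\<Sum>G\<in>Ch F. 4 * ((e G)\<^sup>2 * below s G)))))"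
    using e0 by (intro sum_mono mult_left_mono local) (auto intro: less_imp_le)
  \<comment> \<open>Moving \<open>e F\<close> under the root puts both sums in Cauchy-Schwarz form
    with \<open>X\<close> as the first factor. The second factors are controlled because the sets
    \<open>E F\<close>, and likewise the sets \<open>Ch F\<close>, are disjoint for different
    \<open>F\<close>.\<close>
  also have "\<dots> = 2 * sqrt T * ((\<Sum>F\<in>Rec. sqrt ((e F)\<^sup>2 * below s F) * sqrt (\<Sum>P\<in>E F. (g P)\<^sup>2 * w P))
      + (\<Sum>F\<in>Rec. sqrt ((e F)\<^sup>2 * below s F) * sqrt (\<Sum>G\<in>Ch F. 4 * ((e G)\<^sup>2 * below s G))))"
    unfolding sum.distrib[symmetric] sum_distrib_left
    using e0 by (intro sum.cong) (auto simp: real_sqrt_mult abs_of_pos algebra_simps)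
  also have "(\<Sum>F\<in>Rec. sqrt ((e F)\<^sup>2 * below s F) * sqrt (\<Sum>P\<in>E F. (g P)\<^sup>2 * w P)) \<le> sqrt X * sqrt ng"
  proof -
    have "(\<Sum>F\<in>Rec. sqrt ((e F)\<^sup>2 * below s F) * sqrt (\<Sum>P\<in>E F. (g P)\<^sup>2 * w P))
      \<le> sqrt (\<Sum>F\<in>Rec. (sqrt ((e F)\<^sup>2 * below s F))\<^sup>2) * sqrt (\<Sum>F\<in>Rec. (sqrt (\<Sum>P\<in>E F. (g P)\<^sup>2 * w P))\<^sup>2)"
      by (rule sum_mult_le_sqrt)
    also have "(\<Sum>F\<in>Rec. (sqrt ((e F)\<^sup>2 * below s F))\<^sup>2) = X"
      unfolding X_def using s0 by (intro sum.cong) auto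
    also have "(\<Sum>F\<in>Rec. (sqrt (\<Sum>P\<in>E F. (g P)\<^sup>2 * w P))\<^sup>2) = (\<Sum>F\<in>Rec. \<Sum>P\<in>E F. (g P)\<^sup>2 * w P)"
    proof (intro sum.cong refl real_sqrt_pow2 sum_nonneg)
      show "0 \<le> (g P)\<^sup>2 * w P" if "P \<in> E F" for P F using w EV' that by auto
    qed
    also have "\<dots> = (\<Sum>P\<in>(\<Union>F\<in>Rec. E F). (g P)\<^sup>2 * w P)"
    proof (intro sum.UNION_disjoint[symmetric] ballI impI)
      fix F G assume FG: "F \<in> Rec" "G \<in> Rec" "F \<noteq> G"
      show "E F \<inter> E G = {}"
      proof (rule ccontr)
        assume "E F \<inter> E G \<noteq> {}"
        then obtain P where P: "P \<in> E F" "P \<in> E G" by auto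
        then have "F < G \<or> G < F" using forest[of P F G] FG inV by (auto simp: E_def)
        then show False using P FG by (auto simp: E_def)
      qed
    qed (use fin in auto)
    also have "sqrt X * sqrt \<dots> \<le> sqrt X * sqrt ng"
      unfolding ng_def using finite_V EV w X0 by (intro mult_left_mono real_sqrt_le_mono sum_mono2) auto
    finally show ?thesis .
  qed
  also have "(\<Sum>F\<in>Rec. sqrt ((e F)\<^sup>2 * below s F) * sqrt (\<Sum>G\<in>Ch F. 4 * ((e G)\<^sup>2 * below s G)))
      \<le> sqrt X * sqrt (4 * X)"
  proof -
    have "(\<Sum>F\<in>Rec. sqrt ((e F)\<^sup>2 * below s F) * sqrt (\<Sum>G\<in>Ch F. 4 * ((e G)\<^sup>2 * below s G)))
      \<le> sqrt (\<Sum>F\<in>Rec. (sqrt ((e F)\<^sup>2 * below s F))\<^sup>2)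
        * sqrt (\<Sum>F\<in>Rec. (sqrt (\<Sum>G\<in>Ch F. 4 * ((e G)\<^sup>2 * below s G)))\<^sup>2)"
      by (rule sum_mult_le_sqrt)
    also have "(\<Sum>F\<in>Rec. (sqrt ((e F)\<^sup>2 * below s F))\<^sup>2) = X"
      unfolding X_def using s0 by (intro sum.cong) auto
    also have "(\<Sum>F\<in>Rec. (sqrt (\<Sum>G\<in>Ch F. 4 * ((e G)\<^sup>2 * below s G)))\<^sup>2)
        = (\<Sum>F\<in>Rec. \<Sum>G\<in>Ch F. 4 * ((e G)\<^sup>2 * below s G))"
      using s0 by (intro sum.cong refl real_sqrt_pow2 sum_nonneg) auto
    also have "\<dots> = (\<Sum>G\<in>(\<Union>F\<in>Rec. Ch F). 4 * ((e G)\<^sup>2 * below s G))"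
    proof (intro sum.UNION_disjoint[symmetric] ballI impI)
      fix F G assume FG: "F \<in> Rec" "G \<in> Rec" "F \<noteq> G"
      show "Ch F \<inter> Ch G = {}"
      proof (rule ccontr)
        assume "Ch F \<inter> Ch G \<noteq> {}"
        then obtain H where H: "H \<in> Ch F" "H \<in> Ch G" by auto
        have "H \<in> V" using H ChRec inV by auto
        moreover have "H \<le> F" "H \<le> G" using H by (auto simp: Ch_def)
        ultimately have "F < G \<or> G < F" using forest[of H F G] FG inV by (auto simp: order_le_less)
        then show False using H FG by (auto simp: Ch_def)
      qed
    qed (use fin in auto)
    also have "sqrt X * sqrt \<dots> \<le> sqrt X * sqrt (4 * X)"
      unfolding X_def sum_distrib_left
      using fin ChRec[THEN subsetD] s0 X0[unfolded X_def]
      by (intro mult_left_mono real_sqrt_le_mono sum_mono2) auto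
    finally show ?thesis .
  qed
  finally have "(\<Sum>Q\<in>V1. fs Q * gw Q / m Q) \<le> 2 * sqrt T * (sqrt X * (sqrt ng + sqrt (4 * X)))"
    using T0 by (simp add: distrib_left mult_left_mono)
  also have "\<dots> \<le> 2 * sqrt T * (sqrt (4 * nf) * (sqrt ng + sqrt (4 * (4 * nf))))"
    using X_le X0 ng0 T0 nf0
    by (intro mult_left_mono mult_mono add_left_mono real_sqrt_le_mono) auto
  also have "\<dots> = 4 * sqrt T * sqrt nf * (sqrt ng + 4 * sqrt nf)"
    by (simp add: real_sqrt_mult)
  finally show ?thesis by (simp add: T_def)
qed


text \<open>The two halves compare \<open>(fs Q)\<^sup>2 / below s Q\<close> with
  \<open>(gw Q)\<^sup>2 / below w Q\<close> and follow from one lemma with the roles exchanged. The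
  bound of that lemma is not homogeneous in \<open>f\<close> and \<open>g\<close> separately; with
  both norms equal to 1 its numerical factor is 4 times 5, whence the constant 20.\<close>

lemma two_weight_normalised:
  fixes A a b c :: real
  assumes s: "\<And>P. P \<in> V \<Longrightarrow> 0 \<le> s P" and w: "\<And>P. P \<in> V \<Longrightarrow> 0 \<le> w P"
    and f: "\<And>P. P \<in> V \<Longrightarrow> 0 \<le> f P" and g: "\<And>P. P \<in> V \<Longrightarrow> 0 \<le> g P"
    and m: "\<And>P. P \<in> V \<Longrightarrow> 0 < m P" and A: "0 \<le> A" "0 \<le> c" "0 \<le> a" "0 \<le> b"
    and spos: "\<And>P. P \<in> V \<Longrightarrow> 0 < below s P" and wpos: "\<And>P. P \<in> V \<Longrightarrow> 0 < below w P"
    and B: "\<And>Q. Q \<in> V \<Longrightarrow> below s Q * below w Q \<le> A * (m Q)\<^sup>2"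
    and C: "\<And>Q. Q \<in> V \<Longrightarrow> below m Q \<le> c * m Q"
    and S: "\<And>Q. Q \<in> V \<Longrightarrow> below (below s) Q \<le> a * below s Q"
    and W: "\<And>Q. Q \<in> V \<Longrightarrow> below (below w) Q \<le> b * below w Q"
    and nf: "(\<Sum>P\<in>V. (f P)\<^sup>2 * s P) = 1" and ng: "(\<Sum>P\<in>V. (g P)\<^sup>2 * w P) = 1"
  shows "(\<Sum>Q\<in>V. below (\<lambda>P. f P * s P) Q * below (\<lambda>P. g P * w P) Q / m Q)
    \<le> 20 * sqrt (2 * A * c) * (sqrt a + sqrt b)"
proof -
  define fs where "fs = below (\<lambda>P. f P * s P)"
  define gw where "gw = below (\<lambda>P. g P * w P)"
  define V1 where "V1 = {Q \<in> V. 0 < fs Q \<and> (gw Q)\<^sup>2 * below s Q \<le> (fs Q)\<^sup>2 * below w Q}"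
  define V2 where "V2 = {Q \<in> V. 0 < gw Q \<and> (fs Q)\<^sup>2 * below w Q \<le> (gw Q)\<^sup>2 * below s Q}"
  have fs0: "0 \<le> fs Q" and gw0: "0 \<le> gw Q" for Q
    unfolding fs_def gw_def using f g s w by (auto intro!: below_nonneg)
  have B': "below w Q * below s Q \<le> A * (m Q)\<^sup>2" if "Q \<in> V" for Q
    using B[OF that] by (simp add: mult.commute)
  have fin: "finite V1" "finite V2" using finite_V by (auto simp: V1_def V2_def)
  have nn: "0 \<le> fs Q * gw Q / m Q" if "Q \<in> V" for Q
    using fs0 gw0 m[OF that] by simp
  have "(\<Sum>Q\<in>V. fs Q * gw Q / m Q) = (\<Sum>Q\<in>V1 \<union> V2. fs Q * gw Q / m Q)"
  proof (rule sum.mono_neutral_right[OF finite_V])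
    show "\<forall>Q\<in>V - (V1 \<union> V2). fs Q * gw Q / m Q = 0"
    proof
      fix Q assume "Q \<in> V - (V1 \<union> V2)"
      then have "fs Q = 0 \<or> gw Q = 0"
        using fs0[of Q] gw0[of Q] by (auto simp: V1_def V2_def order_le_less)
      then show "fs Q * gw Q / m Q = 0" by auto
    qed
  qed (auto simp: V1_def V2_def)
  also have "\<dots> \<le> (\<Sum>Q\<in>V1. fs Q * gw Q / m Q) + (\<Sum>Q\<in>V2. fs Q * gw Q / m Q)"
    using fin nn by (intro sum_Un_le) (auto simp: V2_def)
  also have "(\<Sum>Q\<in>V1. fs Q * gw Q / m Q) \<le> 4 * sqrt (2 * A * c * a) * sqrt 1 * (sqrt 1 + 4 * sqrt 1)"
    using stopping_half[of s w f g m A c a, OF s w f g m A(1-3) spos wpos B C S]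
    unfolding nf ng by (simp add: V1_def fs_def gw_def)
  also have "(\<Sum>Q\<in>V2. fs Q * gw Q / m Q) \<le> 4 * sqrt (2 * A * c * b) * sqrt 1 * (sqrt 1 + 4 * sqrt 1)"
    using stopping_half[of w s g f m A c b, OF w s g f m A(1,2,4) wpos spos B' C W]
    unfolding nf ng by (simp add: V2_def fs_def gw_def mult.commute)
  finally show ?thesis
    by (simp add: fs_def gw_def real_sqrt_mult algebra_simps)
qed

text \<open>The form is bilinear, so rescaling reduces it to the normalised case. A function of norm
  zero cannot be rescaled, but then its products with the weight vanish and the form is
  zero.\<close>

lemma two_weight:
  fixes A a b c :: real
  assumes s: "\<And>P. P \<in> V \<Longrightarrow> 0 \<le> s P" and w: "\<And>P. P \<in> V \<Longrightarrow> 0 \<le> w P"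
    and f: "\<And>P. P \<in> V \<Longrightarrow> 0 \<le> f P" and g: "\<And>P. P \<in> V \<Longrightarrow> 0 \<le> g P"
    and m: "\<And>P. P \<in> V \<Longrightarrow> 0 < m P" and A: "0 \<le> A" "0 \<le> c" "0 \<le> a" "0 \<le> b"
    and spos: "\<And>P. P \<in> V \<Longrightarrow> 0 < below s P" and wpos: "\<And>P. P \<in> V \<Longrightarrow> 0 < below w P"
    and B: "\<And>Q. Q \<in> V \<Longrightarrow> below s Q * below w Q \<le> A * (m Q)\<^sup>2"
    and C: "\<And>Q. Q \<in> V \<Longrightarrow> below m Q \<le> c * m Q"
    and S: "\<And>Q. Q \<in> V \<Longrightarrow> below (below s) Q \<le> a * below s Q"
    and W: "\<And>Q. Q \<in> V \<Longrightarrow> below (below w) Q \<le> b * below w Q"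
  shows "(\<Sum>Q\<in>V. below (\<lambda>P. f P * s P) Q * below (\<lambda>P. g P * w P) Q / m Q)
    \<le> 20 * sqrt (2 * A * c) * (sqrt a + sqrt b)
       * sqrt (\<Sum>P\<in>V. (f P)\<^sup>2 * s P) * sqrt (\<Sum>P\<in>V. (g P)\<^sup>2 * w P)"
proof -
  define x where "x = sqrt (\<Sum>P\<in>V. (f P)\<^sup>2 * s P)"
  define y where "y = sqrt (\<Sum>P\<in>V. (g P)\<^sup>2 * w P)"
  have x2: "(\<Sum>P\<in>V. (f P)\<^sup>2 * s P) = x\<^sup>2" and y2: "(\<Sum>P\<in>V. (g P)\<^sup>2 * w P) = y\<^sup>2"
    unfolding x_def y_def using s w by (simp_all add: sum_nonneg)
  have x0: "0 \<le> x" "0 \<le> y" unfolding x_def y_def using s w by (simp_all add: sum_nonneg)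
  have zero: "below (\<lambda>P. h P * u P) Q = 0"
    if "(\<Sum>P\<in>V. (h P)\<^sup>2 * u P) = 0" "\<And>P. P \<in> V \<Longrightarrow> 0 \<le> u P" for h u :: "'a \<Rightarrow> real" and Q
  proof -
    have "\<forall>P\<in>V. (h P)\<^sup>2 * u P = 0"
      using that finite_V by (subst (asm) sum_nonneg_eq_0_iff) auto
    then have "h P * u P = 0" if "P \<in> V" for P using that by auto
    then show ?thesis unfolding below_def by (intro sum.neutral) auto
  qed
  show ?thesis
  proof (cases "x = 0 \<or> y = 0")
    case True
    then have "(\<Sum>Q\<in>V. below (\<lambda>P. f P * s P) Q * below (\<lambda>P. g P * w P) Q / m Q) = 0"
      using zero[of f s] zero[of g w] s w x2 y2 by auto
    then show ?thesis using A x2 y2 x0 by simp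
  next
    case False
    then have xy: "0 < x" "0 < y" using x0 by auto
    have "(\<Sum>Q\<in>V. below (\<lambda>P. f P / x * s P) Q * below (\<lambda>P. g P / y * w P) Q / m Q)
      \<le> 20 * sqrt (2 * A * c) * (sqrt a + sqrt b)"
      using x2 y2 xy f g
      by (intro two_weight_normalised[OF s w _ _ m A spos wpos B C S W])
        (auto simp: power_divide simp flip: sum_divide_distrib)
    moreover have "below (\<lambda>P. f P / x * s P) Q = below (\<lambda>P. f P * s P) Q / x"
      "below (\<lambda>P. g P / y * w P) Q = below (\<lambda>P. g P * w P) Q / y" for Q
      by (simp_all add: below_def sum_divide_distrib)
    ultimately have "(\<Sum>Q\<in>V. below (\<lambda>P. f P * s P) Q * below (\<lambda>P. g P * w P) Q / m Q) / (x * y)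
      \<le> 20 * sqrt (2 * A * c) * (sqrt a + sqrt b)"
      by (simp add: sum_divide_distrib mult_ac)
    then show ?thesis using xy unfolding x_def[symmetric] y_def[symmetric]
      by (simp add: field_simps)
  qed
qed

end

section \<open>Volumes of Carleson tents and of boxes adapted to a direction\<close>

text \<open>The library states rotation invariance of Lebesgue measure only on \<open>real ^ 'n\<close> with a
  well-ordered index type. The type \<open>'d bit0\<close> is well-ordered and has \<open>2 * CARD('d)\<close> elements.\<close>

lemma ex_lborel_euclidean_isometry:
  "\<exists>J :: real ^ ('d::finite bit0) \<Rightarrow> complex ^ 'd. linear J \<and> bij J \<and> (\<forall>v. norm (J v) = norm v)
     \<and> distr lborel borel J = lborel"
proof -
  let ?B = "Basis :: (complex ^ 'd) set"
  have "card ?B = card (UNIV :: 'd bit0 set)" by simp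
  then obtain \<beta> where \<beta>: "bij_betw \<beta> (UNIV :: 'd bit0 set) ?B"
    using finite_same_card_bij[of "UNIV :: 'd bit0 set" ?B] by auto
  have inB: "\<beta> i \<in> ?B" for i using \<beta> by (auto simp: bij_betw_def)
  have inj: "inj \<beta>" and ran: "range \<beta> = ?B" using \<beta> by (auto simp: bij_betw_def)
  define J where "J v = (\<Sum>i\<in>UNIV. (v $ i) *\<^sub>R \<beta> i)" for v :: "real ^ 'd bit0"
  have bb: "\<beta> i \<bullet> \<beta> j = (if i = j then 1 else 0)" for i j
    using inj inner_Basis[OF inB inB, of i j] by (auto simp: inj_eq)
  have Jb: "J v \<bullet> \<beta> j = v $ j" for v j
    by (simp add: J_def inner_sum_left bb if_distrib sum.delta cong: if_cong)
  have lin: "linear J" unfolding J_def by (intro linearI) (simp_all add: scaleR_left_distrib sum.distrib scaleR_sum_right)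
  have "J v \<bullet> J v = v \<bullet> v" for v
  proof -
    have "J v \<bullet> J v = J v \<bullet> (\<Sum>i\<in>UNIV. (v $ i) *\<^sub>R \<beta> i)" by (simp only: J_def)
    also have "\<dots> = (\<Sum>i\<in>UNIV. v $ i * v $ i)" by (simp only: inner_sum_right inner_scaleR_right Jb)
    finally show ?thesis by (simp add: inner_vec_def)
  qed
  then have nrm: "norm (J v) = norm v" for v by (simp add: norm_eq_sqrt_inner)
  have "inj J" using lin nrm by (metis linear_injective_0 norm_eq_zero)
  moreover have "surj J"
  proof -
    have "x = J (\<chi> i. x \<bullet> \<beta> i)" for x
    proof (rule euclidean_eqI)
      fix b assume "b \<in> ?B"
      then obtain i where "b = \<beta> i" using ran by auto
      then show "x \<bullet> b = J (\<chi> i. x \<bullet> \<beta> i) \<bullet> b" by (simp add: Jb)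
    qed
    then show ?thesis by (metis surj_def)
  qed
  ultimately have bij: "bij J" by (simp add: bij_def)
  have meas: "J \<in> borel_measurable lborel"
    using lin by (simp add: borel_measurable_continuous_onI linear_continuous_on linear_linear)
  have "lborel = distr lborel borel J"
  proof (rule lborel_eqI)
    fix l u :: "complex ^ 'd"
    assume lu: "\<And>b. b \<in> ?B \<Longrightarrow> l \<bullet> b \<le> u \<bullet> b"
    let ?l = "\<chi> i. l \<bullet> \<beta> i" and ?u = "\<chi> i. u \<bullet> \<beta> i"
    have "J -` box l u = box ?l ?u"
      unfolding box_def[of l u] mem_box_cart set_eq_iff ran[symmetric] by (simp add: mem_box_cart Jb)
    then have "emeasure (distr lborel borel J) (box l u) = emeasure lborel (box ?l ?u)"
      using meas by (simp add: emeasure_distr)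
    also have "\<dots> = (\<Prod>b\<in>Basis. (?u - ?l) \<bullet> b)"
      using lu inB by (intro emeasure_lborel_box) (auto simp: Basis_vec_def inner_axis)
    also have "(\<Prod>b\<in>Basis. (?u - ?l) \<bullet> b) = (\<Prod>i\<in>UNIV. (u - l) \<bullet> \<beta> i)"
    proof -
      have B: "Basis = range (\<lambda>i :: 'd bit0. axis i (1::real))" by (auto simp: Basis_vec_def)
      have I: "inj (\<lambda>i :: 'd bit0. axis i (1::real))" by (auto simp: inj_def axis_eq_axis)
      show ?thesis unfolding B prod.reindex[OF I] by (simp add: inner_axis inner_diff_left)
    qed
    also have "\<dots> = (\<Prod>b\<in>?B. (u - l) \<bullet> b)"
      unfolding ran[symmetric] using inj by (simp add: prod.reindex)
    finally show "emeasure (distr lborel borel J) (box l u) = (\<Prod>b\<in>?B. (u - l) \<bullet> b)" .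
  qed simp
  then show ?thesis using lin bij nrm by metis
qed

text \<open>Conjugation by the isometry \<open>J\<close> turns \<open>U\<close> into an orthogonal
  map of a real coordinate space, where rotation invariance of volume applies. Compactness makes
  every image involved closed and hence measurable.\<close>

lemma measure_lborel_orthogonal_image:
  fixes U :: "complex ^ 'd::finite \<Rightarrow> complex ^ 'd"
  assumes U: "orthogonal_transformation U" and S: "compact S"
  shows "measure lborel (U ` S) = measure lborel S"
proof -
  obtain J :: "real ^ 'd bit0 \<Rightarrow> complex ^ 'd" where J: "linear J" "bij J" "\<And>v. norm (J v) = norm v"
    and distr: "distr lborel borel J = lborel"
    using ex_lborel_euclidean_isometry by metis
  have meas: "J \<in> borel_measurable lborel"
    using J by (simp add: borel_measurable_continuous_onI linear_continuous_on linear_linear)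
  have m: "measure lborel T = measure lborel (J -` T)" if "T \<in> sets borel" for T
    using measure_distr[OF meas, of T] that by (simp add: distr)
  have linI: "linear (inv J)"
  proof (rule linearI)
    show "inv J (x + y) = inv J x + inv J y" for x y
      using J by (intro inv_f_eq) (auto simp: linear_add bij_is_inj bij_is_surj surj_f_inv_f)
    show "inv J (c *\<^sub>R x) = c *\<^sub>R inv J x" for c x
      using J by (intro inv_f_eq) (auto simp: linear_scale bij_is_inj bij_is_surj surj_f_inv_f)
  qed
  have nI: "norm (inv J x) = norm x" for x
    using J by (metis bij_inv_eq_iff)
  define O' where "O' = inv J \<circ> U \<circ> J"
  have O': "orthogonal_transformation O'"
    unfolding orthogonal_transformation O'_def
    using U J linI nI by (auto intro!: linear_compose simp: orthogonal_transformation)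
  have JS: "J -` S = inv J ` S" using J by (simp add: bij_vimage_eq_inv_image)
  have cS: "compact (J -` S)"
    unfolding JS using S linI by (intro compact_continuous_image linear_continuous_on) (auto simp: linear_linear)
  then have lm: "J -` S \<in> lmeasurable" by (simp add: lmeasurable_compact)
  have im: "J -` (U ` S) = O' ` (J -` S)"
    unfolding O'_def using J by (auto simp: bij_vimage_eq_inv_image image_comp bij_is_surj surj_f_inv_f image_iff)
  have cU: "compact (U ` S)"
    using S U by (intro compact_continuous_image linear_continuous_on) (auto simp: linear_linear orthogonal_transformation)
  have cO: "compact (O' ` (J -` S))"
    using cS O' by (intro compact_continuous_image linear_continuous_on) (auto simp: linear_linear orthogonal_transformation)
  have "measure lborel (U ` S) = measure lborel (O' ` (J -` S))"
    using m[of "U ` S"] cU im by (simp add: borel_compact)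
  also have "\<dots> = measure lebesgue (O' ` (J -` S))" using cO by (simp add: borel_compact)
  also have "\<dots> = measure lebesgue (J -` S)" using measure_orthogonal_image[OF O' lm] .
  also have "\<dots> = measure lborel (J -` S)" using cS by (simp add: borel_compact)
  also have "\<dots> = measure lborel S" using m[of S] S by (simp add: borel_compact)
  finally show ?thesis .
qed

section \<open>Hermitian products and volumes of coordinate boxes\<close>

lemma herm_commute: "herm y x = cnj (herm x y)"
  by (simp add: herm_def mult.commute)

lemma herm_smult_right: "herm x (c *s y) = cnj c * herm x y"
  by (simp add: herm_def sum_distrib_left mult_ac)

lemma herm_diff_right: "herm x (y - z) = herm x y - herm x z"
  by (simp add: herm_def sum_subtractf algebra_simps)

lemma norm_sq_eq_herm: "(norm x)\<^sup>2 = Re (herm x x)"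
  by (simp add: herm_self)

text \<open>For a suitable unimodular \<open>\<theta>\<close> the inner product of \<open>e\<close> and \<open>axis k \<theta>\<close> is real, so the complex
  reflection along \<open>e - axis k \<theta>\<close> exchanges the two vectors.\<close>

lemma ex_unitary_axis:
  fixes e :: "complex ^ 'd::finite" and k :: 'd
  assumes e: "norm e = 1"
  shows "\<exists>U \<theta>. orthogonal_transformation U \<and> (\<forall>x y. herm (U x) (U y) = herm x y)
     \<and> cmod \<theta> = 1 \<and> U (axis k \<theta>) = e"
proof -
  define \<theta> where "\<theta> = (if e $ k = 0 then 1 else e $ k / cmod (e $ k))"
  define a where "a = (axis k \<theta> :: complex ^ 'd)"
  define u where "u = e - a"
  define N where "N = (norm u)\<^sup>2"
  define U where "U x = x - (2 * herm x u / N) *s u" for x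
  have th: "cmod \<theta> = 1" unfolding \<theta>_def by (simp add: norm_divide)
  have hu: "herm u u = of_real N" by (simp add: N_def herm_self)
  have herm_U: "herm (U x) (U y) = herm x y" for x y
  proof -
    have 1: "herm (U x) (U y) = herm x y - cnj (2 * herm y u / N) * herm x u
       - (2 * herm x u / N) * herm u y + (2 * herm x u / N) * cnj (2 * herm y u / N) * N"
      by (simp add: U_def herm_diff_left herm_diff_right herm_smult_left herm_smult_right hu algebra_simps)
    show ?thesis
    proof (cases "N = 0")
      case False
      then show ?thesis unfolding 1 herm_commute[of u y] by (simp add: field_simps)
    qed (simp add: 1)
  qed
  have lin: "linear U"
  proof (rule linearI)
    show "U (x + y) = U x + U y" for x y
      by (simp add: U_def vec_eq_iff herm_def distrib_right sum.distrib add_divide_distrib distrib_left)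
    show "U (c *\<^sub>R x) = c *\<^sub>R U x" for c x
      by (simp add: U_def vec_eq_iff herm_scaleR_left scaleR_conv_of_real[where 'a=complex] algebra_simps)
  qed
  have "norm (U x) = norm x" for x
    using norm_sq_eq_herm[of "U x"] norm_sq_eq_herm[of x] herm_U[of x x]
    by (metis norm_ge_zero power2_eq_iff_nonneg)
  then have "orthogonal_transformation U" using lin by (simp add: orthogonal_transformation)
  moreover have "U a = e"
  proof (cases "u = 0")
    case True
    then show ?thesis by (simp add: U_def u_def)
  next
    case False
    have ha: "herm e a = of_real (cmod (e $ k))"
    proof -
      have "herm e a = e $ k * cnj \<theta>"
        by (simp add: herm_def a_def axis_def if_distrib sum.delta cong: if_cong)
      also have "\<dots> = of_real (cmod (e $ k))"
        by (simp add: \<theta>_def complex_norm_square[symmetric] power2_eq_square)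
      finally show ?thesis .
    qed
    have haa: "herm a a = 1"
    proof -
      have "herm a a = \<theta> * cnj \<theta>" 
        by (simp add: herm_def a_def axis_def if_distrib sum.delta cong: if_cong)
      then show ?thesis using th by (simp add: complex_norm_square[symmetric])
    qed
    have "of_real N = 2 * (1 - of_real (cmod (e $ k)) :: complex)"
      unfolding hu[symmetric] u_def herm_diff_left herm_diff_right ha haa herm_commute[of a e]
      using e by (simp add: herm_self)
    moreover have "herm a u = - (1 - of_real (cmod (e $ k)))"
      by (simp add: u_def herm_diff_right haa ha herm_commute[of a e])
    moreover have "N \<noteq> 0" using False by (simp add: N_def)
    ultimately have "2 * herm a u / of_real N = -1"
      by (metis (no_types, opaque_lifting) divide_self mult_minus_right of_real_eq_0_iff minus_divide_left)
    then show ?thesis by (simp add: U_def u_def)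
  qed
  ultimately show ?thesis using herm_U th by (auto simp: a_def)
qed

text \<open>Products of squares rather than of discs, so that the set is a box in real coordinates
  with an explicit volume.\<close>

definition polybox :: "('d::finite \<Rightarrow> complex) \<Rightarrow> ('d \<Rightarrow> real) \<Rightarrow> (complex ^ 'd) set" where
  "polybox c r = {x. \<forall>i. \<bar>Re (x $ i - c i)\<bar> \<le> r i \<and> \<bar>Im (x $ i - c i)\<bar> \<le> r i}"

lemma polybox_eq_cbox: "polybox c r = cbox (\<chi> i. c i - Complex (r i) (r i)) (\<chi> i. c i + Complex (r i) (r i))"
  by (auto simp: polybox_def mem_box Basis_vec_def Basis_complex_def inner_axis abs_le_iff algebra_simps)

lemma measure_polybox:
  assumes "\<And>i. 0 \<le> r i"
  shows "measure lborel (polybox c r) = (\<Prod>i\<in>UNIV. (2 * r i)\<^sup>2)"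
proof -
  let ?l = "\<chi> i. c i - Complex (r i) (r i)" and ?u = "\<chi> i. c i + Complex (r i) (r i)"
  have "measure lborel (cbox ?l ?u) = (\<Prod>b\<in>Basis. (?u - ?l) \<bullet> b)"
    using assms by (intro measure_lborel_cbox) (auto simp: Basis_vec_def Basis_complex_def inner_axis)
  also have "Basis = (\<lambda>(i, u). axis i u) ` (UNIV \<times> {1, \<i>})"
    by (auto simp: Basis_vec_def Basis_complex_def)
  also have "(\<Prod>b\<in>\<dots>. (?u - ?l) \<bullet> b) = (\<Prod>(i, u)\<in>UNIV \<times> {1, \<i>}. (?u - ?l) \<bullet> axis i u)"
    by (subst prod.reindex) (auto simp: inj_on_def axis_eq_axis case_prod_unfold)
  also have "\<dots> = (\<Prod>i\<in>UNIV. \<Prod>u\<in>{1, \<i>}. (?u - ?l) \<bullet> axis i u)"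
    by (subst prod.cartesian_product) auto
  also have "\<dots> = (\<Prod>i\<in>UNIV. (2 * r i)\<^sup>2)"
    by (intro prod.cong refl) (simp add: inner_axis inner_diff_left power2_eq_square)
  finally show ?thesis by (simp add: polybox_eq_cbox)
qed

lemma measure_polybox_axis:
  fixes c :: "'d::finite \<Rightarrow> complex"
  assumes "0 \<le> s" "0 \<le> t"
  shows "measure lborel (polybox c (\<lambda>i. if i = k then s else t)) = (2 * s)\<^sup>2 * (4 * t\<^sup>2) ^ (CARD('d) - 1)"
proof -
  have "(\<Prod>i\<in>UNIV - {k}. (2 * (if i = k then s else t))\<^sup>2) = (\<Prod>i\<in>UNIV - {k}. 4 * t\<^sup>2)"
    by (intro prod.cong) (auto simp: power_mult_distrib)
  then show ?thesis
    using assms by (subst measure_polybox) (auto simp: prod.remove[of UNIV k])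
qed

lemma compact_polybox: "compact (polybox c r)"
  by (simp add: polybox_eq_cbox compact_cbox)

lemma norm_sq_vec: "(norm (x :: complex ^ 'd::finite))\<^sup>2 = (\<Sum>i\<in>UNIV. (cmod (x $ i))\<^sup>2)"
  by (simp add: norm_vec_def L2_set_def sum_nonneg)

lemma herm_axis: "herm x (axis k \<theta>) = x $ k * cnj \<theta>"
  by (simp add: herm_def axis_def if_distrib sum.delta cong: if_cong)

lemma cmod_diff_unimodular:
  assumes "cmod \<theta> = 1"
  shows "cmod (x * cnj \<theta> - a) = cmod (x - a * \<theta>)"
proof -
  have "x - a * \<theta> = \<theta> * (x * cnj \<theta> - a)"
    using assms by (simp add: algebra_simps complex_norm_square[symmetric])
  then show ?thesis using assms by (simp add: norm_mult)
qed

text \<open>After a unitary change of coordinates \<open>e\<close> is a unimodular multiple of an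
  axis. The component along it is within \<open>h\<close> of \<open>\<theta>\<close>, so its modulus
  is at least \<open>1 - h\<close> and at most \<open>sqrt (2 * h)\<close> is left for each other
  component. The volume \<open>(2 * h)\<^sup>2 * (8 * h) ^ (CARD('d) - 1)\<close> of the resulting
  box gives the constant and the exponent.\<close>

lemma carleson_region_volume:
  "\<exists>C > 0. \<forall>(e :: complex ^ 'd::finite) h. norm e = 1 \<longrightarrow> 0 < h \<longrightarrow>
     (\<exists>P. compact P \<and> {\<zeta>. norm \<zeta> < 1 \<and> cmod (1 - herm \<zeta> e) \<le> h} \<subseteq> P
       \<and> measure lborel P \<le> C * h ^ (CARD('d) + 1))"
proof (intro exI[of _ "4 * 8 ^ (CARD('d) - 1)"] conjI allI impI)
  fix e :: "complex ^ 'd" and h :: real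
  assume e: "norm e = 1" and h: "0 < h"
  obtain U \<theta> and k :: 'd where U: "orthogonal_transformation U" and hU: "\<And>x y. herm (U x) (U y) = herm x y"
    and th: "cmod \<theta> = 1" and Uk: "U (axis k \<theta>) = e"
    using ex_unitary_axis[OF e] by metis
  let ?P = "polybox (\<lambda>i. if i = k then \<theta> else 0) (\<lambda>i. if i = k then h else sqrt (2 * h))"
  have "{\<zeta>. norm \<zeta> < 1 \<and> cmod (1 - herm \<zeta> e) \<le> h} \<subseteq> U ` ?P"
  proof
    fix \<zeta> assume z: "\<zeta> \<in> {\<zeta>. norm \<zeta> < 1 \<and> cmod (1 - herm \<zeta> e) \<le> h}"
    obtain x where x: "\<zeta> = U x" using orthogonal_transformation_surj[OF U] by (metis surjD)
    have nx: "norm x < 1" using z U x by (simp add: orthogonal_transformation)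
    have "herm \<zeta> e = x $ k * cnj \<theta>" using hU Uk x herm_axis by metis
    then have "cmod (x $ k * cnj \<theta> - 1) \<le> h" using z by (simp add: norm_minus_commute)
    then have kk: "cmod (x $ k - \<theta>) \<le> h" using cmod_diff_unimodular[OF th, of "x $ k" 1] by simp
    have "cmod (x $ k) \<ge> 1 - h" using kk th norm_triangle_ineq2[of \<theta> "x $ k"] by (simp add: norm_minus_commute)
    moreover have "cmod (x $ k) < 1" using Finite_Cartesian_Product.norm_nth_le[of x k] nx by linarith
    ultimately have k2: "1 - (cmod (x $ k))\<^sup>2 \<le> 2 * h"
    proof -
      assume a: "cmod (x $ k) \<ge> 1 - h" "cmod (x $ k) < 1"
      then have "(1 - cmod (x $ k)) * (1 + cmod (x $ k)) \<le> (1 - cmod (x $ k)) * 2"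
        by (intro mult_left_mono) auto
      then show ?thesis using a by (simp add: power2_eq_square algebra_simps)
    qed
    have "cmod (x $ i) \<le> sqrt (2 * h)" if "i \<noteq> k" for i
    proof -
      have "(cmod (x $ i))\<^sup>2 + (cmod (x $ k))\<^sup>2 = (\<Sum>j\<in>{i, k}. (cmod (x $ j))\<^sup>2)" using that by simp
      also have "\<dots> \<le> (norm x)\<^sup>2" unfolding norm_sq_vec by (intro sum_mono2) auto
      also have "\<dots> \<le> 1" using nx by (simp add: power_le_one)
      finally show ?thesis using k2 by (intro real_le_rsqrt) linarith
    qed
    then have "x \<in> ?P"
      using order_trans[OF abs_Re_le_cmod kk] order_trans[OF abs_Im_le_cmod kk]
        order_trans[OF abs_Re_le_cmod] order_trans[OF abs_Im_le_cmod]
      unfolding polybox_def by simp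
    then show "\<zeta> \<in> U ` ?P" using x by auto
  qed
  moreover have "compact (U ` ?P)"
    using U compact_polybox by (intro compact_continuous_image linear_continuous_on)
       (auto simp: linear_linear orthogonal_transformation)
  moreover have "measure lborel (U ` ?P) \<le> 4 * 8 ^ (CARD('d) - 1) * h ^ (CARD('d) + 1)"
  proof -
    have "measure lborel (U ` ?P) = (2 * h)\<^sup>2 * (4 * (sqrt (2 * h))\<^sup>2) ^ (CARD('d) - 1)"
      using h by (simp add: measure_lborel_orthogonal_image[OF U compact_polybox] measure_polybox_axis)
    also have "\<dots> = 4 * 8 ^ (CARD('d) - 1) * (h\<^sup>2 * h ^ (CARD('d) - 1))"
      using h by (simp add: power_mult_distrib)
    also have "h\<^sup>2 * h ^ (CARD('d) - 1) = h ^ (CARD('d) + 1)"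
    proof -
      have "CARD('d) + 1 = 2 + (CARD('d) - 1)" by (simp add: Suc_leI)
      then show ?thesis by (simp only: power_add)
    qed
    finally show ?thesis by simp
  qed
  ultimately show "\<exists>P. compact P \<and> {\<zeta>. norm \<zeta> < 1 \<and> cmod (1 - herm \<zeta> e) \<le> h} \<subseteq> P
       \<and> measure lborel P \<le> 4 * 8 ^ (CARD('d) - 1) * h ^ (CARD('d) + 1)"
    by blast
qed simp

text \<open>The half side \<open>x / 2\<close> along \<open>e\<close> keeps the modulus of the
  deviation within \<open>x\<close>, and the transversal half side is chosen so that each other
  coordinate contributes at most \<open>x / CARD('d)\<close> to the squared norm. The volume has the
  same homogeneity as that of a Carleson tent, which makes it usable as a lower bound for
  kubes.\<close>

lemma adapted_box_volume:
  "\<exists>c > 0. \<forall>(e :: complex ^ 'd::finite) (\<rho>::real) x. norm e = 1 \<longrightarrow> 0 < x \<longrightarrow>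
     (\<exists>P. compact P \<and> P \<subseteq> {\<zeta>. cmod (herm \<zeta> e - \<rho>) \<le> x \<and> (norm \<zeta>)\<^sup>2 \<le> (cmod (herm \<zeta> e))\<^sup>2 + x}
       \<and> measure lborel P = c * x ^ (CARD('d) + 1))"
proof (intro exI[of _ "(2 / CARD('d)) ^ (CARD('d) - 1)"] conjI allI impI)
  fix e :: "complex ^ 'd" and \<rho> x :: real
  assume e: "norm e = 1" and x: "0 < x"
  obtain U \<theta> and k :: 'd where U: "orthogonal_transformation U" and hU: "\<And>x y. herm (U x) (U y) = herm x y"
    and th: "cmod \<theta> = 1" and Uk: "U (axis k \<theta>) = e"
    using ex_unitary_axis[OF e] by metis
  define t where "t = sqrt (x / (2 * CARD('d)))"
  have t2: "t\<^sup>2 = x / (2 * CARD('d))" and t0: "0 \<le> t" using x by (auto simp: t_def)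
  let ?P = "polybox (\<lambda>i. if i = k then \<rho> * \<theta> else 0) (\<lambda>i. if i = k then x / 2 else t)"
  have "U ` ?P \<subseteq> {\<zeta>. cmod (herm \<zeta> e - \<rho>) \<le> x \<and> (norm \<zeta>)\<^sup>2 \<le> (cmod (herm \<zeta> e))\<^sup>2 + x}"
  proof safe
    fix y assume y: "y \<in> ?P"
    have hy: "herm (U y) e = y $ k * cnj \<theta>" using hU Uk herm_axis by metis
    have "cmod (y $ k - \<rho> * \<theta>) \<le> \<bar>Re (y $ k - \<rho> * \<theta>)\<bar> + \<bar>Im (y $ k - \<rho> * \<theta>)\<bar>"
      by (rule cmod_le)
    also have "\<dots> \<le> x / 2 + x / 2" using y by (intro add_mono) (auto simp: polybox_def dest!: spec[of _ k])
    finally show "cmod (herm (U y) e - \<rho>) \<le> x"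
      using cmod_diff_unimodular[OF th, of "y $ k" \<rho>] hy by simp
    have "cmod (herm (U y) e) = cmod (y $ k)" using hy th by (simp add: norm_mult)
    moreover have "(norm (U y))\<^sup>2 = (cmod (y $ k))\<^sup>2 + (\<Sum>i\<in>UNIV - {k}. (cmod (y $ i))\<^sup>2)"
      using U by (simp add: orthogonal_transformation norm_sq_vec sum.remove[of UNIV k])
    moreover have "(\<Sum>i\<in>UNIV - {k}. (cmod (y $ i))\<^sup>2) \<le> (\<Sum>i\<in>UNIV - {k}. x / CARD('d))"
    proof (intro sum_mono)
      fix i assume "i \<in> UNIV - {k}"
      then have "\<bar>Re (y $ i)\<bar> \<le> t" "\<bar>Im (y $ i)\<bar> \<le> t" using y by (auto simp: polybox_def dest!: spec[of _ i])
      then have "(Re (y $ i))\<^sup>2 \<le> t\<^sup>2" "(Im (y $ i))\<^sup>2 \<le> t\<^sup>2"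
        using t0 by (auto simp: abs_le_square_iff[symmetric])
      then have "(cmod (y $ i))\<^sup>2 \<le> t\<^sup>2 + t\<^sup>2" by (simp add: cmod_power2)
      then show "(cmod (y $ i))\<^sup>2 \<le> x / CARD('d)" by (simp add: t2 field_simps)
    qed
    moreover have "(\<Sum>i\<in>UNIV - {k}. x / CARD('d)) \<le> x"
    proof -
      have "(\<Sum>i\<in>UNIV - {k}. x / CARD('d)) \<le> (\<Sum>i\<in>(UNIV::'d set). x / CARD('d))"
        using x by (intro sum_mono2) auto
      then show ?thesis by simp
    qed
    ultimately show "(norm (U y))\<^sup>2 \<le> (cmod (herm (U y) e))\<^sup>2 + x" by simp
  qed
  moreover have "compact (U ` ?P)"
    using U compact_polybox by (intro compact_continuous_image linear_continuous_on)
       (auto simp: linear_linear orthogonal_transformation)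
  moreover have "measure lborel (U ` ?P) = (2 / CARD('d)) ^ (CARD('d) - 1) * x ^ (CARD('d) + 1)"
  proof -
    have "measure lborel (U ` ?P) = (2 * (x / 2))\<^sup>2 * (4 * t\<^sup>2) ^ (CARD('d) - 1)"
      using x t0 by (subst measure_lborel_orthogonal_image[OF U compact_polybox], subst measure_polybox_axis) auto
    also have "4 * t\<^sup>2 = (2 / CARD('d)) * x" by (simp add: t2)
    also have "(2 * (x / 2))\<^sup>2 * ((2 / CARD('d)) * x) ^ (CARD('d) - 1)
        = (2 / CARD('d)) ^ (CARD('d) - 1) * (x\<^sup>2 * x ^ (CARD('d) - 1))"
      by (simp only: power_mult_distrib) (simp add: power_divide)
    also have "x\<^sup>2 * x ^ (CARD('d) - 1) = x ^ (CARD('d) + 1)"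
    proof -
      have "CARD('d) + 1 = 2 + (CARD('d) - 1)" by (simp add: Suc_leI)
      then show ?thesis by (simp only: power_add)
    qed
    finally show ?thesis .
  qed
  ultimately show "\<exists>P. compact P \<and> P \<subseteq> {\<zeta>. cmod (herm \<zeta> e - \<rho>) \<le> x \<and> (norm \<zeta>)\<^sup>2 \<le> (cmod (herm \<zeta> e))\<^sup>2 + x}
       \<and> measure lborel P = (2 / CARD('d)) ^ (CARD('d) - 1) * x ^ (CARD('d) + 1)"
    by blast
qed simp

section \<open>Normalised volume and Lebesgue measure\<close>

lemma space_nu: "space nu = unit_ball"
  by (simp add: nu_def)

lemma sets_nu: "sets nu = sets (lebesgue_on unit_ball)"
  by (simp add: nu_def)

lemma sets_nu_iff: "S \<in> sets nu \<longleftrightarrow> S \<subseteq> unit_ball \<and> S \<in> sets lebesgue"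
  unfolding sets_nu by (subst sets_restrict_space_iff) auto

lemma finite_measure_nu: "finite_measure nu"
  by (rule finite_measureI) (simp add: space_nu emeasure_nu_unit_ball)

lemma measure_nu_le_1: "measure nu S \<le> 1"
  using finite_measure.bounded_measure[OF finite_measure_nu, of S]
  by (simp add: space_nu measure_def emeasure_nu_unit_ball)

definition ball_vol :: "'d::finite itself \<Rightarrow> real" where
  "ball_vol _ = measure lborel (ball 0 1 :: (complex ^ 'd) set)"

lemma ball_vol_pos: "0 < ball_vol TYPE('d::finite)"
  unfolding ball_vol_def by (rule content_ball_pos) simp

lemma measure_nu_eq:
  fixes S :: "(complex ^ 'd::finite) set"
  assumes "S \<in> sets nu"
  shows "measure nu S = measure lebesgue S / ball_vol TYPE('d)"
proof -
  have S: "S \<subseteq> unit_ball" "S \<in> sets lebesgue" using assms by (auto simp: sets_nu_iff)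
  have "emeasure nu S = emeasure (lebesgue_on unit_ball) S / emeasure (lebesgue_on unit_ball) (unit_ball :: (complex ^ 'd) set)"
    unfolding nu_def using assms S by (subst emeasure_uniform_measure) (auto simp: sets_nu Int_absorb1)
  also have "emeasure (lebesgue_on unit_ball) S = emeasure lebesgue S"
    using S by (intro emeasure_restrict_space) auto
  also have "emeasure (lebesgue_on unit_ball) (unit_ball :: (complex ^ 'd) set) = emeasure lborel (unit_ball :: (complex ^ 'd) set)"
    by (subst emeasure_restrict_space) auto
  finally have "measure nu S = enn2real (emeasure lebesgue S / emeasure lborel (unit_ball :: (complex ^ 'd) set))"
    by (simp add: measure_def)
  also have "emeasure lborel (unit_ball :: (complex ^ 'd) set) = ennreal (ball_vol TYPE('d))"
    unfolding ball_vol_def using emeasure_lborel_ball_finite[of "0 :: complex ^ 'd" 1]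
    by (simp add: emeasure_eq_ennreal_measure less_top)
  also have "emeasure lebesgue S = ennreal (measure lebesgue S)"
    using S bounded_set_imp_lmeasurable[of S] bounded_subset[OF bounded_ball]
    by (intro emeasure_eq_measure2) auto
  also have "ennreal (measure lebesgue S) / ennreal (ball_vol TYPE('d)) = ennreal (measure lebesgue S / ball_vol TYPE('d))"
    using ball_vol_pos[where 'd='d] by (intro divide_ennreal) auto
  finally show ?thesis using ball_vol_pos[where 'd='d] by simp
qed

text \<open>For a set that is not measurable the left side is 0 by the convention of
  \<open>measure\<close>, so a Carleson tent can be estimated by a compact superset alone.\<close>

lemma measure_nu_le_compact:
  fixes P :: "(complex ^ 'd::finite) set"
  assumes "compact P" "S \<subseteq> P"
  shows "measure nu S \<le> measure lborel P / ball_vol TYPE('d)"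
proof (cases "S \<in> sets nu")
  case True
  then have S: "S \<in> sets lebesgue" by (simp add: sets_nu_iff)
  have "measure lebesgue S \<le> measure lebesgue P"
    using assms S by (intro measure_mono_fmeasurable) (auto simp: lmeasurable_compact)
  also have "\<dots> = measure lborel P" using assms by (simp add: borel_compact)
  finally show ?thesis using True ball_vol_pos[where 'd='d] by (simp add: measure_nu_eq divide_right_mono)
next
  case False
  then show ?thesis using ball_vol_pos[where 'd='d] by (simp add: measure_notin_sets)
qed

lemma measure_nu_ge_compact:
  fixes P :: "(complex ^ 'd::finite) set"
  assumes "compact P" "P \<subseteq> S" "S \<in> sets nu"
  shows "measure lborel P / ball_vol TYPE('d) \<le> measure nu S"
proof -
  have S: "S \<in> sets lebesgue" "S \<subseteq> unit_ball" using assms by (simp_all add: sets_nu_iff)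
  then have "S \<in> lmeasurable" by (intro bounded_set_imp_lmeasurable) (auto intro: bounded_subset)
  then have "measure lebesgue P \<le> measure lebesgue S"
    using assms by (intro measure_mono_fmeasurable) (auto simp: lmeasurable_compact borel_compact)
  moreover have "measure lborel P = measure lebesgue P" using assms by (simp add: borel_compact)
  ultimately show ?thesis using assms(3) ball_vol_pos[where 'd='d] by (simp add: measure_nu_eq divide_right_mono)
qed

section \<open>Carleson tents\<close>

lemma herm_proj_decomp:
  assumes "norm e = 1"
  shows "(norm (x - herm x e *s e))\<^sup>2 = (norm x)\<^sup>2 - (cmod (herm x e))\<^sup>2"
proof -
  have "herm (x - herm x e *s e) (x - herm x e *s e)
      = herm x x - herm x e * cnj (herm x e)"
    using assms unfolding herm_diff_left herm_diff_right herm_smult_left herm_smult_right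
    by (simp add: herm_self herm_commute[of e x])
  also have "\<dots> = of_real ((norm x)\<^sup>2 - (cmod (herm x e))\<^sup>2)"
    by (simp only: herm_self complex_norm_square[symmetric] of_real_diff)
  finally show ?thesis by (simp add: norm_sq_eq_herm[of "x - herm x e *s e"])
qed

lemma cmod_herm_le: "cmod (herm x e) \<le> norm x" if "norm e = 1"
proof -
  have "0 \<le> (norm x)\<^sup>2 - (cmod (herm x e))\<^sup>2"
    using herm_proj_decomp[OF that, of x] by (metis zero_le_power2)
  then show ?thesis by (simp add: abs_le_square_iff[symmetric])
qed

lemma herm_scaleR_right: "herm z (r *\<^sub>R v) = complex_of_real r * herm z v"
  by (subst herm_commute, subst herm_scaleR_left, subst herm_commute[of z v]) simp

lemma cmod_herm_le_mult: "cmod (herm x y) \<le> norm x * norm y"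
proof (cases "y = 0")
  case False
  define e where "e = (1 / norm y) *\<^sub>R y"
  have "y = norm y *\<^sub>R e" using False by (simp add: e_def)
  then have "herm x y = norm y * herm x e" using herm_scaleR_right by metis
  moreover have "norm e = 1" using False by (simp add: e_def)
  ultimately show ?thesis using cmod_herm_le[of e x]
    by (simp add: norm_mult mult_right_mono mult.commute[of "norm y"])
qed simp

lemma self_in_carleson_tent:
  assumes "u \<in> unit_ball"
  shows "u \<in> carleson_tent u"
proof (cases "u = 0")
  case False
  have "herm u ((1 / norm u) *\<^sub>R u) = of_real (norm u)"
    using False by (simp add: herm_scaleR_right herm_self power2_eq_square)
  then have "cmod (1 - herm u ((1 / norm u) *\<^sub>R u)) = cmod (of_real (1 - norm u))" by simp
  also have "\<dots> = 1 - norm u" using assms by (simp only: norm_of_real) simp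
  finally show ?thesis using False assms by (simp add: carleson_tent_def)
qed (simp add: carleson_tent_def)

lemma carleson_tent_volume:
  "\<exists>C > 0. \<forall>u \<in> (unit_ball :: (complex ^ 'd::finite) set).
     measure nu (carleson_tent u) \<le> C * (1 - norm u) ^ (CARD('d) + 1)"
proof -
  obtain C where C: "C > 0" "\<And>(e :: complex ^ 'd) h. norm e = 1 \<Longrightarrow> 0 < h \<Longrightarrow>
     (\<exists>P. compact P \<and> {\<zeta>. norm \<zeta> < 1 \<and> cmod (1 - herm \<zeta> e) \<le> h} \<subseteq> P
       \<and> measure lborel P \<le> C * h ^ (CARD('d) + 1))"
    using carleson_region_volume[where 'd='d] by blast
  define v where "v = ball_vol TYPE('d)"
  have v: "v > 0" unfolding v_def by (rule ball_vol_pos)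
  show ?thesis
  \<comment> \<open>The entry 1 takes care of \<open>u = 0\<close>: there the tent is the whole ball
    and has no direction.\<close>
  proof (intro exI[of _ "max 1 (C / v)"] conjI ballI)
    fix u :: "complex ^ 'd" assume u: "u \<in> unit_ball"
    show "measure nu (carleson_tent u) \<le> max 1 (C / v) * (1 - norm u) ^ (CARD('d) + 1)"
    proof (cases "u = 0")
      case True
      then show ?thesis using measure_nu_le_1[of "carleson_tent u"] by (simp add: le_max_iff_disj)
    next
      case False
      define e where "e = (1 / norm u) *\<^sub>R u"
      have e: "norm e = 1" using False by (simp add: e_def)
      have h: "0 < 1 - norm u" using u by simp
      obtain P where P: "compact P" "{\<zeta>. norm \<zeta> < 1 \<and> cmod (1 - herm \<zeta> e) \<le> 1 - norm u} \<subseteq> P"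
        "measure lborel P \<le> C * (1 - norm u) ^ (CARD('d) + 1)" using C(2)[OF e h] by blast
      have "carleson_tent u \<subseteq> P" using P(2) False by (auto simp: carleson_tent_def e_def)
      then have "measure nu (carleson_tent u) \<le> measure lborel P / v"
        unfolding v_def by (intro measure_nu_le_compact P)
      also have "\<dots> \<le> C * (1 - norm u) ^ (CARD('d) + 1) / v" using P v by (simp add: divide_right_mono)
      also have "\<dots> = (C / v) * (1 - norm u) ^ (CARD('d) + 1)" by simp
      also have "\<dots> \<le> max 1 (C / v) * (1 - norm u) ^ (CARD('d) + 1)"
        using h by (intro mult_right_mono) auto
      finally show ?thesis .
    qed
  qed simp
qed

text \<open>With \<open>h\<close> the modulus of \<open>1 - herm z \<zeta>\<close> and
  \<open>e\<close> the direction of \<open>z\<close>, the depth \<open>1 - norm z\<close> is at most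
  \<open>h\<close>, and replacing \<open>z\<close> by \<open>e\<close> in the product with
  \<open>\<zeta>\<close> costs at most \<open>1 - norm z\<close> more. So both points satisfy the
  tent inequality in the direction \<open>e\<close> with bound \<open>2 * h\<close>, which fixes
  \<open>u\<close>. If \<open>2 * h\<close> is at least 1 or \<open>z\<close> is 0, the tent of the
  origin serves.\<close>

lemma common_carleson_tent:
  assumes z: "z \<in> unit_ball" and \<zeta>: "\<zeta> \<in> unit_ball"
  obtains u where "u \<in> unit_ball" "z \<in> carleson_tent u" "\<zeta> \<in> carleson_tent u"
    "1 - norm u \<le> 2 * cmod (1 - herm z \<zeta>)"
proof -
  define h where "h = cmod (1 - herm z \<zeta>)"
  show ?thesis
  proof (cases "2 * h < 1 \<and> z \<noteq> 0")
    case False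
    have "1 \<le> 2 * h" using False by (auto simp: h_def)
    then show ?thesis using z \<zeta> by (intro that[of 0]) (auto simp: carleson_tent_def h_def)
  next
    case True
    define e where "e = (1 / norm z) *\<^sub>R z"
    have e: "norm e = 1" using True by (simp add: e_def)
    have ze: "z = norm z *\<^sub>R e" using True by (simp add: e_def)
    have nz: "norm z < 1" "0 < norm z" using z True by auto
    have hz: "herm \<zeta> z = norm z * herm \<zeta> e" using ze herm_scaleR_right by metis
    have h': "h = cmod (1 - herm \<zeta> z)"
      unfolding h_def by (subst herm_commute[of z \<zeta>]) (metis complex_cnj_diff complex_cnj_one complex_mod_cnj)
    have le1: "cmod (herm \<zeta> e) \<le> 1" using cmod_herm_le[OF e, of \<zeta>] \<zeta> by simp
    have "1 - norm z \<le> h"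
    proof -
      have "1 - cmod (herm \<zeta> z) \<le> h" using h' norm_triangle_ineq2[of 1 "herm \<zeta> z"] by simp
      moreover have "cmod (herm \<zeta> z) \<le> norm z * 1" unfolding hz norm_mult using le1 nz by (simp add: mult_left_le)
      ultimately show ?thesis by simp
    qed
    moreover have "0 < 1 - norm z" using nz by simp
    ultimately have h0: "0 < h" by linarith
    define u where "u = (1 - 2 * h) *\<^sub>R e"
    have nu: "norm u = 1 - 2 * h" using True e by (simp add: u_def)
    have ue: "(1 / norm u) *\<^sub>R u = e" using True nu by (simp add: u_def)
    have u0: "u \<noteq> 0" using True nu by auto
    have "cmod (1 - herm z e) \<le> 2 * h"
    proof -
      have "herm z e = norm z" using ze e herm_scaleR_left[of "norm z" e e] by (simp add: herm_self)
      then have "cmod (1 - herm z e) = cmod (of_real (1 - norm z))" by simp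
      also have "\<dots> = 1 - norm z" using nz by (simp only: norm_of_real)
      finally show ?thesis using \<open>1 - norm z \<le> h\<close> h0 by simp
    qed
    moreover have "cmod (1 - herm \<zeta> e) \<le> 2 * h"
    proof -
      have "1 - herm \<zeta> e = (1 - herm \<zeta> z) - of_real (1 - norm z) * herm \<zeta> e"
        by (simp add: hz algebra_simps)
      then have "cmod (1 - herm \<zeta> e) \<le> h + cmod (of_real (1 - norm z) * herm \<zeta> e)"
        unfolding h' by (metis norm_triangle_ineq4)
      also have "cmod (of_real (1 - norm z) * herm \<zeta> e) \<le> (1 - norm z) * 1"
        unfolding norm_mult norm_of_real using nz le1 by (intro mult_mono) auto
      finally show ?thesis using \<open>1 - norm z \<le> h\<close> by simp
    qed
    ultimately have "z \<in> carleson_tent u" "\<zeta> \<in> carleson_tent u"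
      using u0 ue nu z \<zeta> by (simp_all add: carleson_tent_def)
    then show ?thesis using nu h0 True by (intro that[of u]) (auto simp: h_def)
  qed
qed

section \<open>Bergman balls and shells\<close>

lemma ball_invol_norm:
  assumes z: "z \<in> unit_ball" "z \<noteq> 0" and w: "w \<in> unit_ball"
  shows "1 - (norm (ball_invol z w))\<^sup>2
    = (1 - (norm z)\<^sup>2) * (1 - (norm w)\<^sup>2) / (cmod (1 - herm w z))\<^sup>2"
proof -
  define N where "N = (norm z)\<^sup>2"
  define t where "t = herm w z"
  define p where "p = (herm w z / herm z z) *s z"
  define s where "s = sqrt (1 - N)"
  have N0: "N \<noteq> 0" "N > 0" using z by (auto simp: N_def)
  have N1: "N < 1" using z by (simp add: N_def power_less_one_iff)
  have s2: "s\<^sup>2 = 1 - N" using N1 by (simp add: s_def)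
  have hz: "herm z z = of_real N" by (simp add: N_def herm_self)
  have p: "p = (t / of_real N) *s z" by (simp add: p_def t_def hz)
  have "cmod t \<le> norm w * norm z" unfolding t_def by (rule cmod_herm_le_mult)
  also have "\<dots> < 1 * 1" using z w by (intro mult_strict_mono) auto
  finally have t1: "t \<noteq> 1" by auto
  have hqz: "herm (w - p) z = 0"
    using N0 by (simp add: herm_diff_left p herm_smult_left hz t_def)
  have hqq: "herm (w - p) (w - p) = of_real ((norm w)\<^sup>2 - (cmod t)\<^sup>2 / N)"
  proof -
    have "herm (w - p) (w - p) = herm (w - p) w"
      using hqz by (subst herm_diff_right) (simp add: p herm_smult_right)
    also have "\<dots> = of_real ((norm w)\<^sup>2) - t / of_real N * cnj t"
      by (simp add: herm_diff_left herm_self p herm_smult_left t_def herm_commute[of z w])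
    also have "t / of_real N * cnj t = of_real ((cmod t)\<^sup>2 / N)"
      by (simp add: complex_norm_square[symmetric])
    finally show ?thesis by simp
  qed
  \<comment> \<open>\<open>x\<close> is the numerator of the involution. Since \<open>z - p\<close>
    is a multiple of \<open>z\<close> while \<open>w - p\<close> is orthogonal to \<open>z\<close>,
    its norm follows from Pythagoras.\<close>
  define x where "x = z - p - s *\<^sub>R (w - p)"
  have hzq: "herm z (w - p) = 0" using hqz by (subst herm_commute) simp
  have zp: "z - p = (1 - t / of_real N) *s z" by (simp add: p vec_eq_iff algebra_simps)
  have "herm x x = herm (z - p) (z - p) + s * s * herm (w - p) (w - p)"
    unfolding x_def herm_diff_left[of "z - p"] herm_diff_right[of _ "z - p"] herm_scaleR_left herm_scaleR_right
    unfolding zp herm_smult_left herm_smult_right hqz hzq by (simp add: algebra_simps)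
  also have "herm (z - p) (z - p) = (1 - t / of_real N) * cnj (1 - t / of_real N) * of_real N"
    unfolding zp herm_smult_left herm_smult_right hz by simp
  also have "\<dots> = of_real ((cmod (1 - t / of_real N))\<^sup>2 * N)" by (simp only: complex_norm_square of_real_mult)
  finally have "herm x x = of_real ((cmod (1 - t / of_real N))\<^sup>2 * N + s\<^sup>2 * ((norm w)\<^sup>2 - (cmod t)\<^sup>2 / N))"
    unfolding hqq by (simp add: power2_eq_square)
  then have nx: "(norm x)\<^sup>2 = (cmod (1 - t / of_real N))\<^sup>2 * N + s\<^sup>2 * ((norm w)\<^sup>2 - (cmod t)\<^sup>2 / N)"
    by (simp only: norm_sq_eq_herm Re_complex_of_real)
  have c1: "(cmod (1 - t / of_real N))\<^sup>2 = 1 - 2 * Re t / N + (cmod t)\<^sup>2 / N\<^sup>2"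
  proof -
    have "(cmod (1 - t / of_real N))\<^sup>2 = (1 - Re t / N)\<^sup>2 + (Im t / N)\<^sup>2"
      by (subst cmod_power2) simp
    also have "\<dots> = 1 - 2 * Re t / N + ((Re t)\<^sup>2 + (Im t)\<^sup>2) / N\<^sup>2"
      by (simp add: power2_diff power_divide add_divide_distrib)
    finally show ?thesis by (simp add: cmod_power2)
  qed
  have c2: "(cmod (1 - t))\<^sup>2 = 1 - 2 * Re t + (cmod t)\<^sup>2"
    unfolding cmod_power2 by (simp add: power2_diff)
  have key: "(cmod (1 - t))\<^sup>2 - (norm x)\<^sup>2 = (1 - N) * (1 - (norm w)\<^sup>2)"
  proof -
    define T where "T = (cmod t)\<^sup>2"
    show ?thesis
      unfolding nx c1 c2 s2 T_def[symmetric] using N0 by (simp add: field_simps power2_eq_square)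
  qed
  have "ball_invol z w = inverse (1 - t) *s x"
    by (simp add: ball_invol_def Let_def x_def p_def t_def s_def N_def)
  moreover have "norm (a *s y) = cmod a * norm y" for a and y :: "complex ^ 'a"
    by (simp add: norm_vec_def norm_mult L2_set_right_distrib)
  ultimately have "(norm (ball_invol z w))\<^sup>2 = (norm x)\<^sup>2 / (cmod (1 - t))\<^sup>2"
    by (simp add: norm_inverse power_mult_distrib power_inverse divide_inverse mult.commute)
  moreover have "(cmod (1 - t))\<^sup>2 \<noteq> 0" using t1 by simp
  ultimately have "1 - (norm (ball_invol z w))\<^sup>2 = ((cmod (1 - t))\<^sup>2 - (norm x)\<^sup>2) / (cmod (1 - t))\<^sup>2"
    by (simp add: diff_divide_distrib)
  then show ?thesis unfolding key by (simp add: N_def t_def)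
qed

text \<open>For two points of norm \<open>r\<close> the identity for the involution gives
  \<open>1 - x\<^sup>2\<close> as the square of \<open>(1 - r\<^sup>2) / D\<close>. With
  \<open>a\<close> a quarter of the square of \<open>tanh \<delta>\<close>, the lower bound
  \<open>1 - 2 * a\<close> for \<open>1 / (1 + a)\<^sup>2\<close> leaves \<open>x\<^sup>2\<close> at
  most \<open>2 * a\<close>, half the square of \<open>tanh \<delta>\<close>.\<close>

lemma in_bergman_ball_if:
  fixes z :: "complex ^ 'd::finite"
  assumes z: "norm z = r" and w: "norm w = r" and r: "0 < r" "r < 1" and \<delta>: "0 < \<delta>"
    and close: "cmod (1 - herm w z) \<le> (1 + (tanh \<delta>)\<^sup>2 / 4) * (1 - r\<^sup>2)"
  shows "w \<in> bergman_ball z \<delta>"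
proof -
  define a where "a = (tanh \<delta>)\<^sup>2 / 4"
  define x where "x = norm (ball_invol z w)"
  define D where "D = cmod (1 - herm w z)"
  have t: "0 < tanh \<delta>" "tanh \<delta> < 1" using \<delta> tanh_real_lt_1 by auto
  have a: "0 < a" using t by (simp add: a_def)
  have r2: "0 < 1 - r\<^sup>2" using r by (simp add: power_less_one_iff)
  have zw: "z \<in> unit_ball" "z \<noteq> 0" "w \<in> unit_ball" using assms by auto
  have "cmod (herm w z) \<le> r\<^sup>2" using cmod_herm_le_mult[of w z] z w by (simp add: power2_eq_square)
  then have D0: "0 < D" unfolding D_def using r2 by (metis norm_one right_minus_eq not_less zero_less_norm_iff diff_gt_0_iff_gt)
  have x2: "1 - x\<^sup>2 = (1 - r\<^sup>2)\<^sup>2 / D\<^sup>2"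
    unfolding x_def D_def ball_invol_norm[OF zw] z w by (simp add: power2_eq_square)
  have "D\<^sup>2 \<le> ((1 + a) * (1 - r\<^sup>2))\<^sup>2" using close D0 by (intro power_mono) (auto simp: D_def a_def)
  then have "1 / (1 + a)\<^sup>2 \<le> (1 - r\<^sup>2)\<^sup>2 / D\<^sup>2"
    using D0 a r2 unfolding power_mult_distrib
    by (subst pos_le_divide_eq) (simp_all add: pos_divide_le_eq mult.commute)
  moreover have "1 - 2 * a \<le> 1 / (1 + a)\<^sup>2"
  proof -
    have "(1 - 2 * a) * (1 + a)\<^sup>2 = 1 - 3 * a\<^sup>2 - 2 * a ^ 3" by (simp add: algebra_simps power2_eq_square power3_eq_cube)
    also have "\<dots> \<le> 1"
      using zero_le_power[of a 2] zero_le_power[of a 3] a by linarith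
    finally show ?thesis using a by (simp add: field_simps)
  qed
  ultimately have "x\<^sup>2 \<le> 2 * a" using x2 by linarith
  also have "\<dots> < (tanh \<delta>)\<^sup>2" using t by (simp add: a_def)
  finally have xt: "x < tanh \<delta>" using t by (simp add: power_less_imp_less_base)
  have x0: "0 \<le> x" by (simp add: x_def)
  have "(1 + x) / (1 - x) < (1 + tanh \<delta>) / (1 - tanh \<delta>)"
    using xt x0 t by (intro frac_less2) auto
  then have "bergman_dist z w < artanh (tanh \<delta>)"
    unfolding bergman_dist_def artanh_def x_def[symmetric] using xt x0 t by simp
  then show ?thesis using zw by (simp add: bergman_ball_def artanh_tanh_real)
qed

text \<open>By the addition theorem it suffices that \<open>(a + b) / (1 + a * b)\<close> is at
  least \<open>a + b - a * b\<close> for \<open>a\<close> and \<open>b\<close> between 0 and 1. This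
  bounds the thickness of a shell below by a fixed multiple of the distance of its inner sphere from
  the boundary.\<close>

lemma one_minus_tanh_add_le:
  fixes x y :: real
  assumes "0 \<le> x" "0 \<le> y"
  shows "1 - tanh (x + y) \<le> (1 - tanh x) * (1 - tanh y)"
proof -
  define a b where "a = tanh x" and "b = tanh y"
  have ab: "0 \<le> a" "a < 1" "0 \<le> b" "b < 1" using assms tanh_real_lt_1 by (auto simp: a_def b_def)
  have "tanh (x + y) = (a + b) / (1 + a * b)"
    unfolding a_def b_def by (rule tanh_add) (simp_all add: cosh_real_nonzero)
  moreover have "a + b - a * b \<le> (a + b) / (1 + a * b)"
  proof -
    have "0 \<le> a * b * ((1 - a) * (1 - b))" using ab by simp
    then have "(a + b - a * b) * (1 + a * b) \<le> a + b" by (simp add: algebra_simps)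
    moreover have "0 < 1 + a * b" using ab by (simp add: add_pos_nonneg)
    ultimately show ?thesis by (simp add: pos_le_divide_eq)
  qed
  ultimately show ?thesis by (simp add: a_def b_def algebra_simps)
qed

text \<open>The number \<open>1 - (2 - tanh R) * h / 2\<close> equals
  \<open>tanh (n * R) + tanh R * h / 2\<close>, the middle of the part of the shell guaranteed by
  \<open>one_minus_tanh_add_le\<close>. A box of size \<open>x\<close> around the corresponding
  point of the ray through \<open>z\<close> has to stay in the shell and to project into the
  \<open>\<delta>\<close>-ball of \<open>z\<close>; both margins are proportional to
  \<open>h\<close>.\<close>

lemma adapted_box_in_shell:
  fixes z :: "complex ^ 'd::finite"
  assumes R: "0 < R" and \<delta>: "0 < \<delta>" and n: "0 < n"
    and z: "norm z = tanh (real n * R)" and e: "e = (1 / norm z) *\<^sub>R z"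
  defines "h \<equiv> 1 - tanh (real n * R)"
  defines "x \<equiv> (tanh \<delta>)\<^sup>2 * (tanh R)\<^sup>2 / 32 * h"
  assumes \<zeta>: "cmod (herm \<zeta> e - of_real (1 - (2 - tanh R) * h / 2)) \<le> x"
    "(norm \<zeta>)\<^sup>2 \<le> (cmod (herm \<zeta> e))\<^sup>2 + x"
  shows "\<zeta> \<in> bergman_ball 0 ((real n + 1) * R) - bergman_ball 0 (real n * R)"
    and "radial_proj (real n * R) \<zeta> \<in> bergman_ball z \<delta> \<inter> bergman_sphere (real n * R)"
proof -
  define r where "r = tanh (real n * R)"
  define r1 where "r1 = tanh R"
  define \<gamma> where "\<gamma> = (tanh \<delta>)\<^sup>2 / 4"
  define a where "a = herm \<zeta> e"
  define \<rho> where "\<rho> = 1 - (2 - r1) * h / 2"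
  have nR: "R \<le> real n * R" using n R by simp
  have r1: "0 < r1" "r1 < 1" using R tanh_real_lt_1 by (auto simp: r1_def)
  have r: "r1 \<le> r" "r < 1" using nR tanh_real_lt_1 by (auto simp: r_def r1_def)
  have \<gamma>: "0 < \<gamma>" "\<gamma> < 1 / 4" using \<delta> tanh_real_lt_1[of \<delta>] by (auto simp: \<gamma>_def power_less_one_iff abs_if)
  have h: "0 < h" using r by (simp add: h_def r_def)
  have hr: "h = 1 - r" by (simp add: h_def r_def)
  have xe: "x = \<gamma> * r1\<^sup>2 / 8 * h" by (simp add: x_def \<gamma>_def r1_def)
  have x0: "0 < x" using \<gamma> r1 h by (simp add: xe)
  \<comment> \<open>The two factors \<open>tanh R\<close> in \<open>x\<close> pay for two divisions
    by norms that are only known to be at least \<open>r1\<close>: one in passing from squared norms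
    to norms, one in normalising \<open>\<zeta>\<close>. \<open>y\<close> is what remains after the
    first.\<close>
  define y where "y = x / r1"
  have x1: "y \<le> r1 * h / 32"
  proof -
    have "x / r1 = \<gamma> * (r1 * h) / 8" using r1 by (simp add: xe power2_eq_square)
    also have "\<dots> \<le> (1 / 4) * (r1 * h) / 8" using \<gamma> r1 h by (intro divide_right_mono mult_right_mono) auto
    finally show ?thesis by (simp add: y_def)
  qed
  have xx: "x \<le> y" using x0 r1 by (simp add: field_simps y_def)
  have "z \<noteq> 0" using z r r1 unfolding r_def by auto
  then have e1: "norm e = 1" by (simp add: e)
  have \<rho>r: "\<rho> = r + r1 * h / 2" unfolding \<rho>_def hr by (simp add: field_simps)
  have za: "cmod (a - \<rho>) \<le> x" "(norm \<zeta>)\<^sup>2 \<le> (cmod a)\<^sup>2 + x" using \<zeta> by (simp_all add: a_def \<rho>_def r1_def)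
  have "0 < r1 * h" using r1 h by simp
  have \<rho>0: "0 < \<rho>" using \<rho>r r r1 \<open>0 < r1 * h\<close> by linarith
  have al: "\<rho> - x \<le> cmod a" "cmod a \<le> \<rho> + x"
    using za(1) norm_triangle_ineq3[of a "of_real \<rho>"] \<rho>0 by auto
  have ar: "r \<le> cmod a" using al \<rho>r x1 xx \<open>0 < r1 * h\<close> by linarith
  have nz: "cmod a \<le> norm \<zeta>" unfolding a_def by (rule cmod_herm_le[OF e1])
  have nu: "norm \<zeta> \<le> cmod a + x / (2 * r1)"
  proof -
    have "(norm \<zeta> - cmod a) * (2 * r1) \<le> (norm \<zeta> - cmod a) * (norm \<zeta> + cmod a)"
      using nz ar r by (intro mult_left_mono) auto
    also have "\<dots> \<le> x" using za(2) by (simp add: power2_eq_square algebra_simps)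
    finally show ?thesis using r1 by (simp add: field_simps)
  qed
  have "1 - tanh ((real n + 1) * R) \<le> (1 - tanh (real n * R)) * (1 - tanh R)"
    using one_minus_tanh_add_le[of "real n * R" R] R by (simp add: distrib_right)
  then have r': "r + r1 * h \<le> tanh ((real n + 1) * R)"
    by (simp add: h_def r_def r1_def algebra_simps)
  have half: "x / (2 * r1) = y / 2" by (simp add: y_def)
  have "norm \<zeta> < r + r1 * h"
    using nu al \<rho>r x1 xx \<open>0 < r1 * h\<close> unfolding half by linarith
  then have "norm \<zeta> < tanh ((real n + 1) * R)" using r' by linarith
  moreover have nr: "r \<le> norm \<zeta>" using ar nz by linarith
  moreover have "0 < (real n + 1) * R" "0 < real n * R" using R n by simp_all
  ultimately show "\<zeta> \<in> bergman_ball 0 ((real n + 1) * R) - bergman_ball 0 (real n * R)"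
    by (simp add: bergman_ball_0_eq r_def)
  define w where "w = radial_proj (real n * R) \<zeta>"
  have n0: "0 < norm \<zeta>" using nr r r1 by linarith
  have w: "w = (r / norm \<zeta>) *\<^sub>R \<zeta>" by (simp add: w_def radial_proj_def r_def)
  have nw: "norm w = r" using n0 r r1 by (simp add: w)
  have ze: "z = r *\<^sub>R e" using z r r1 by (auto simp: e r_def)
  have hw: "herm w z = of_real (r\<^sup>2) * (a / of_real (norm \<zeta>))"
    by (simp add: w ze herm_scaleR_left herm_scaleR_right a_def power2_eq_square)
  have "cmod (of_real (norm \<zeta>) - a) \<le> 3 * y"
  proof -
    have "cmod (of_real (norm \<zeta>) - a) \<le> cmod (of_real (norm \<zeta> - \<rho>)) + cmod (a - \<rho>)"
      using norm_triangle_ineq4[of "of_real (norm \<zeta> - \<rho>)" "a - of_real \<rho>"] by simp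
    also have "cmod (of_real (norm \<zeta> - \<rho>)) = \<bar>norm \<zeta> - \<rho>\<bar>" by (simp only: norm_of_real)
    also have "\<bar>norm \<zeta> - \<rho>\<bar> \<le> x + x / (2 * r1)" using nu al nz x0 r1 by auto
    finally show ?thesis using za(1) xx x0 unfolding half by linarith
  qed
  then have "cmod (of_real (norm \<zeta>) - a) / norm \<zeta> \<le> 3 * y / r1"
    using nr r r1 x0 xx by (intro frac_le) auto
  also have "cmod (of_real (norm \<zeta>) - a) / norm \<zeta> = cmod (1 - a / of_real (norm \<zeta>))"
  proof -
    have "1 - a / of_real (norm \<zeta>) = (of_real (norm \<zeta>) - a) / of_real (norm \<zeta>)" using n0 by (simp add: field_simps)
    then show ?thesis by (simp add: norm_divide)
  qed
  also have "3 * y / r1 = 3 / 8 * \<gamma> * h" using r1 by (simp add: y_def xe power2_eq_square)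
  finally have d1: "cmod (1 - a / of_real (norm \<zeta>)) \<le> 3 / 8 * \<gamma> * h" .
  have "cmod (1 - herm w z) \<le> (1 + \<gamma>) * (1 - r\<^sup>2)"
  proof -
    have "1 - herm w z = of_real (1 - r\<^sup>2) + of_real (r\<^sup>2) * (1 - a / of_real (norm \<zeta>))"
      by (simp add: hw algebra_simps)
    then have "cmod (1 - herm w z) \<le> cmod (of_real (1 - r\<^sup>2)) + cmod (of_real (r\<^sup>2) * (1 - a / of_real (norm \<zeta>)))"
      by (metis norm_triangle_ineq)
    also have "cmod (of_real (1 - r\<^sup>2)) = 1 - r\<^sup>2"
      using r r1 unfolding norm_of_real by (simp add: power_le_one)
    also have "cmod (of_real (r\<^sup>2) * (1 - a / of_real (norm \<zeta>))) \<le> 1 * (3 / 8 * \<gamma> * h)"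
      unfolding norm_mult norm_of_real using d1 r r1 by (intro mult_mono) (auto simp: power_le_one)
    also have "3 / 8 * \<gamma> * h \<le> \<gamma> * (1 - r\<^sup>2)"
    proof -
      have "1 - r\<^sup>2 = h * (1 + r)" by (simp add: hr algebra_simps power2_eq_square)
      moreover have "h * 1 \<le> h * (1 + r)" using h r r1 by (intro mult_left_mono) auto
      ultimately have "3 / 8 * h \<le> 1 - r\<^sup>2" using h by linarith
      then have "\<gamma> * (3 / 8 * h) \<le> \<gamma> * (1 - r\<^sup>2)" using \<gamma> by (intro mult_left_mono) auto
      then show ?thesis by (simp add: mult_ac)
    qed
    finally show ?thesis by (simp add: algebra_simps)
  qed
  then have "w \<in> bergman_ball z \<delta>"
    using in_bergman_ball_if[OF _ nw _ r(2) \<delta>, of z] z r r1 R n by (simp add: r_def \<gamma>_def)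
  moreover have "w \<in> bergman_sphere (real n * R)"
    using nw R by (simp add: bergman_sphere_eq r_def)
  ultimately show "radial_proj (real n * R) \<zeta> \<in> bergman_ball z \<delta> \<inter> bergman_sphere (real n * R)"
    by (simp add: w_def)
qed

section \<open>Geometry of a Bergman tree\<close>

locale bergman_tree =
  fixes R \<delta> :: real and T :: "'d::finite bergman_tree"
  assumes R: "0 < R" and \<delta>: "0 < \<delta>" and tree: "is_bergman_tree R \<delta> T"
begin

lemma cells:
  shows UN_cell: "(\<Union>j\<in>{1..num T n}. cell T n j) = bergman_sphere (n * R)"
    and disjoint_cell: "disjoint_family_on (cell T n) {1..num T n}"
    and pt_sphere: "j \<in> {1..num T n} \<Longrightarrow> pt T n j \<in> bergman_sphere (n * R)"
    and cell_borel: "j \<in> {1..num T n} \<Longrightarrow> cell T n j \<in> sets borel"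
    and ball_subset_cell: "j \<in> {1..num T n} \<Longrightarrow> bergman_ball (pt T n j) \<delta> \<inter> bergman_sphere (n * R) \<subseteq> cell T n j"
  using tree unfolding is_bergman_tree_def by blast+

lemma norm_pt: "(n, j) \<in> vertices T \<Longrightarrow> norm (pt T n j) = tanh (n * R)"
  using pt_sphere[of j n] R by (simp add: vertices_def bergman_sphere_eq)

text \<open>The sphere of generation 0 is the single point 0, and each cell of that generation
  contains it, since a cell contains the part of its sphere near its own point. Disjointness leaves
  room for one cell.\<close>

lemma root_unique:
  assumes "(0, i) \<in> vertices T" "(0, j) \<in> vertices T"
  shows "i = j"
proof -
  have s: "bergman_sphere (real 0 * R) = {0 :: complex ^ 'd}" by (simp add: bergman_sphere_def)
  have "0 \<in> cell T 0 k" if "(0, k) \<in> vertices T" for k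
  proof -
    have k: "k \<in> {1..num T 0}" using that by (simp add: vertices_def)
    have "pt T 0 k = 0" using pt_sphere[OF k] s by simp
    then have "(0 :: complex ^ 'd) \<in> bergman_ball (pt T 0 k) \<delta>"
      using \<delta> by (simp add: bergman_ball_0_eq)
    then show ?thesis using ball_subset_cell[OF k] s by auto
  qed
  then have "0 \<in> cell T 0 i \<inter> cell T 0 j" using assms by simp
  then show ?thesis using assms disjoint_cell[of 0]
    unfolding disjoint_family_on_def vertices_def by blast
qed

lemma parent_unique:
  assumes "child_of R T p c" "child_of R T q c"
  shows "p = q"
proof -
  obtain n k m i where *: "p = (n, k)" "q = (m, i)" by (metis surj_pair)
  obtain l o' where c: "c = (l, o')" by (metis surj_pair)
  have "m = n" using assms by (auto simp: child_of_def * c)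
  moreover have "k = i"
  proof (cases "n = 0")
    case True
    then show ?thesis using assms \<open>m = n\<close> by (intro root_unique) (auto simp: child_of_def * c)
  next
    case False
    then have "radial_proj (n * R) (centre R T (n + 1) o') \<in> cell T n k \<inter> cell T n i"
      and "k \<in> {1..num T n}" "i \<in> {1..num T n}"
      using assms \<open>m = n\<close> by (auto simp: child_of_def * c vertices_def)
    then show ?thesis using disjoint_family_onD[OF disjoint_cell[of n], of k i] by auto
  qed
  ultimately show ?thesis by (simp add: *)
qed

lemma kube_subset_ball: "kube R T a \<subseteq> unit_ball"
  by (auto simp: kube_def bergman_ball_def split: prod.splits if_splits)

lemma norm_kube:
  assumes "\<zeta> \<in> kube R T (n, j)"
  shows "tanh (n * R) \<le> norm \<zeta>" "norm \<zeta> < tanh ((real n + 1) * R)"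
  using assms R by (auto simp: kube_def bergman_ball_0_eq algebra_simps split: if_splits)

lemma kube_generation:
  assumes "\<zeta> \<in> kube R T (n, j)" "\<zeta> \<in> kube R T (m, i)"
  shows "n \<le> m"
proof (rule ccontr)
  assume "\<not> n \<le> m"
  then have "(real m + 1) * R \<le> real n * R" using R by (intro mult_right_mono) auto
  then have "tanh ((real m + 1) * R) \<le> tanh (real n * R)" by (simp only: tanh_real_le_iff)
  then show False using norm_kube(1)[OF assms(1)] norm_kube(2)[OF assms(2)] by linarith
qed

lemma kubes_disjoint:
  assumes "a \<in> vertices T" "b \<in> vertices T" "\<zeta> \<in> kube R T a" "\<zeta> \<in> kube R T b"
  shows "a = b"
proof -
  obtain n k m i where *: "a = (n, k)" "b = (m, i)" by (metis surj_pair)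
  have nm: "m = n" using kube_generation assms unfolding * by (meson order_antisym)
  show ?thesis
  proof (cases "n = 0")
    case True
    then show ?thesis using assms nm root_unique by (auto simp: *)
  next
    case False
    then have "radial_proj (n * R) \<zeta> \<in> cell T n k \<inter> cell T n i"
      using assms nm by (auto simp: * kube_def)
    then show ?thesis using disjoint_cell[of n] assms nm
      unfolding disjoint_family_on_def vertices_def * by blast
  qed
qed

lemma radial_proj_borel: "radial_proj r \<in> borel_measurable (borel :: (complex ^ 'd) measure)"
  unfolding radial_proj_def[abs_def] by measurable

lemma kube_sets: "a \<in> vertices T \<Longrightarrow> kube R T a \<in> sets nu"
proof -
  assume a: "a \<in> vertices T"
  obtain n j where nj: "a = (n, j)" by (metis surj_pair)
  have bb: "bergman_ball (0 :: complex ^ 'd) r \<in> sets borel" for r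
    by (simp add: bergman_ball_0_eq)
  have "kube R T a \<in> sets borel"
  proof (cases "n = 0")
    case True
    then show ?thesis using bb by (simp add: nj kube_def)
  next
    case False
    have j: "j \<in> {1..num T n}" using a by (simp add: nj vertices_def)
    have "radial_proj (n * R) -` cell T n j \<inter> space borel \<in> sets (borel :: (complex ^ 'd) measure)"
      using radial_proj_borel cell_borel[OF j] by (rule measurable_sets)
    then have "(bergman_ball 0 ((real n + 1) * R) - bergman_ball 0 (real n * R)) \<inter> (radial_proj (n * R) -` cell T n j) \<in> sets borel"
      using bb by (intro sets.Int sets.Diff) auto
    also have "(bergman_ball 0 ((real n + 1) * R) - bergman_ball 0 (real n * R)) \<inter> (radial_proj (n * R) -` cell T n j) = kube R T a"
      using False by (auto simp: nj kube_def)
    finally show ?thesis .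
  qed
  then show ?thesis using kube_subset_ball[of a] by (simp add: sets_nu_iff lborelD)
qed

abbreviation desc :: "nat \<times> nat \<Rightarrow> nat \<times> nat \<Rightarrow> bool" where
  "desc \<equiv> (child_of R T)\<^sup>*\<^sup>*"

lemma desc_vertices: "desc a b \<Longrightarrow> a \<in> vertices T \<Longrightarrow> b \<in> vertices T"
  by (induction rule: rtranclp_induct) (auto simp: child_of_def)

lemma desc_generation: "desc a b \<Longrightarrow> fst a \<le> fst b"
  by (induction rule: rtranclp_induct) (auto simp: child_of_def)

text \<open>Parents are unique, so two upward paths from the same vertex agree until the shorter one
  ends.\<close>

lemma ancestors_comparable:
  assumes "desc a c" "desc b c"
  shows "desc a b \<or> desc b a"
  using assms
proof (induction arbitrary: b rule: rtranclp_induct)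
  case (step y c)
  from step.prems show ?case
  proof (cases rule: rtranclp.cases)
    case (rtrancl_into_rtrancl q)
    then show ?thesis using step parent_unique by metis
  next
    case rtrancl_refl
    then show ?thesis using step by auto
  qed
qed auto

lemma kube_subset_tent: "kube R T a \<subseteq> dyadic_tent R T a"
  by (auto simp: dyadic_tent_def)

lemma tent_sets: "a \<in> vertices T \<Longrightarrow> dyadic_tent R T a \<in> sets nu"
proof -
  assume a: "a \<in> vertices T"
  have "kube R T b \<in> sets nu" if "b \<in> {b. desc a b}" for b
    using that a desc_vertices by (intro kube_sets) auto
  then show ?thesis unfolding dyadic_tent_def by (intro sets.countable_UN') auto
qed

lemma tent_mono: "desc a b \<Longrightarrow> dyadic_tent R T b \<subseteq> dyadic_tent R T a"
  unfolding dyadic_tent_def by (auto intro: rtranclp_trans)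

text \<open>A common point lies in a single kube, and the vertex of this kube descends from both
  \<open>a\<close> and \<open>b\<close>.\<close>

lemma tents_laminar:
  assumes "a \<in> vertices T" "b \<in> vertices T" "dyadic_tent R T a \<inter> dyadic_tent R T b \<noteq> {}"
  shows "dyadic_tent R T a \<subseteq> dyadic_tent R T b \<or> dyadic_tent R T b \<subseteq> dyadic_tent R T a"
proof -
  obtain c d \<zeta> where cd: "desc a c" "desc b d" "\<zeta> \<in> kube R T c" "\<zeta> \<in> kube R T d"
    using assms(3) by (auto simp: dyadic_tent_def)
  have "c = d"
    by (rule kubes_disjoint[OF desc_vertices[OF cd(1) assms(1)] desc_vertices[OF cd(2) assms(2)] cd(3,4)])
  then show ?thesis using ancestors_comparable[of a c b] cd tent_mono[of a b] tent_mono[of b a] by auto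
qed

lemma norm_tent: "\<zeta> \<in> dyadic_tent R T a \<Longrightarrow> tanh (real (fst a) * R) \<le> norm \<zeta>"
proof -
  assume "\<zeta> \<in> dyadic_tent R T a"
  then obtain b where b: "desc a b" "\<zeta> \<in> kube R T b" by (auto simp: dyadic_tent_def)
  have "real (fst a) * R \<le> real (fst b) * R"
    using desc_generation[OF b(1)] R by (intro mult_right_mono) auto
  then have "tanh (real (fst a) * R) \<le> tanh (real (fst b) * R)" by simp
  also have "\<dots> \<le> norm \<zeta>" using norm_kube(1)[of \<zeta> "fst b" "snd b"] b(2) by simp
  finally show ?thesis .
qed

end

text \<open>The adapted box over the point of a cell lies in the kube, because the cell contains the
  part of its sphere within Bergman distance \<open>\<delta>\<close> of that point. The constant is
  chosen before the tree, so it is the same for all trees with the same \<open>R\<close> and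
  \<open>\<delta>\<close>.\<close>

lemma kube_volume:
  fixes R \<delta> :: real
  assumes R: "0 < R" and \<delta>: "0 < \<delta>"
  shows "\<exists>c > 0. \<forall>(T :: 'd::finite bergman_tree). is_bergman_tree R \<delta> T \<longrightarrow> (\<forall>a\<in>vertices T.
    c * (1 - tanh (real (fst a) * R)) ^ (CARD('d) + 1) \<le> measure nu (kube R T a))"
proof -
  obtain c where c: "c > 0" "\<And>(e :: complex ^ 'd) (\<rho>::real) x. norm e = 1 \<Longrightarrow> 0 < x \<Longrightarrow>
     (\<exists>P. compact P \<and> P \<subseteq> {\<zeta>. cmod (herm \<zeta> e - \<rho>) \<le> x \<and> (norm \<zeta>)\<^sup>2 \<le> (cmod (herm \<zeta> e))\<^sup>2 + x}
       \<and> measure lborel P = c * x ^ (CARD('d) + 1))"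
    using adapted_box_volume[where 'd='d] by blast
  define v where "v = ball_vol TYPE('d)"
  have v: "v > 0" unfolding v_def by (rule ball_vol_pos)
  define \<eta> where "\<eta> = (tanh \<delta>)\<^sup>2 * (tanh R)\<^sup>2 / 32"
  have \<eta>: "0 < \<eta>" using R \<delta> by (simp add: \<eta>_def)
  define c1 where "c1 = c * \<eta> ^ (CARD('d) + 1) / v"
  define c0 where "c0 = measure nu (ball 0 (tanh R) :: (complex ^ 'd) set)"
  have tR: "0 < tanh R" "tanh R < 1" using R tanh_real_lt_1 by auto
  have c0: "0 < c0"
  proof -
    have "ball 0 (tanh R) \<in> sets (nu :: (complex ^ 'd) measure)" using tR by (auto simp: sets_nu_iff intro: lborelD)
    moreover have "cball 0 (tanh R / 2) \<subseteq> (ball 0 (tanh R) :: (complex ^ 'd) set)"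
      using tR(1) by (auto simp del: tanh_real_pos_iff)
    ultimately have "measure lborel (cball 0 (tanh R / 2) :: (complex ^ 'd) set) / v \<le> c0"
      unfolding c0_def v_def by (intro measure_nu_ge_compact) auto
    moreover have "0 < measure lborel (cball 0 (tanh R / 2) :: (complex ^ 'd) set)"
      using tR by (intro content_cball_pos) auto
    ultimately show ?thesis using v by (meson divide_pos_pos less_le_trans)
  qed
  have c1: "0 < c1" using c v \<eta> by (simp add: c1_def)
  show ?thesis
  \<comment> \<open>The kube of generation 0 is a ball without a distinguished direction; its volume
    \<open>c0\<close> is treated apart.\<close>
  proof (intro exI[of _ "min c0 c1"] conjI allI impI ballI)
    fix T :: "'d bergman_tree" and a
    assume T: "is_bergman_tree R \<delta> T" and a: "a \<in> vertices T"
    interpret bergman_tree R \<delta> T using R \<delta> T by unfold_locales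
    obtain n j where nj: "a = (n, j)" by (metis surj_pair)
    show "min c0 c1 * (1 - tanh (real (fst a) * R)) ^ (CARD('d) + 1) \<le> measure nu (kube R T a)"
    proof (cases "n = 0")
      case True
      then show ?thesis using R by (simp add: nj kube_def bergman_ball_0_eq c0_def)
    next
      case False
      define z where "z = pt T n j"
      define e where "e = (1 / norm z) *\<^sub>R z"
      have nz: "norm z = tanh (n * R)" using norm_pt a by (simp add: nj z_def)
      have z0: "z \<noteq> 0" using nz False R by auto
      define h where "h = 1 - tanh (n * R)"
      have h: "0 < h" using tanh_real_lt_1 by (simp add: h_def)
      have e1: "norm e = 1" using z0 by (simp add: e_def)
      obtain P where P: "compact P"
        "P \<subseteq> {\<zeta>. cmod (herm \<zeta> e - of_real (1 - (2 - tanh R) * h / 2)) \<le> \<eta> * h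
              \<and> (norm \<zeta>)\<^sup>2 \<le> (cmod (herm \<zeta> e))\<^sup>2 + \<eta> * h}"
        "measure lborel P = c * (\<eta> * h) ^ (CARD('d) + 1)"
        using c(2)[OF e1 mult_pos_pos[OF \<eta> h], of "1 - (2 - tanh R) * h / 2"] by blast
      have j: "j \<in> {1..num T n}" using a by (simp add: nj vertices_def)
      have "P \<subseteq> kube R T a"
      proof
        fix \<zeta> assume "\<zeta> \<in> P"
        then have *: "cmod (herm \<zeta> e - of_real (1 - (2 - tanh R) * h / 2)) \<le> \<eta> * h"
           "(norm \<zeta>)\<^sup>2 \<le> (cmod (herm \<zeta> e))\<^sup>2 + \<eta> * h" using P(2) by auto
        have n: "0 < n" using False by simp
        note ** = adapted_box_in_shell[OF R \<delta> n nz e_def *[unfolded h_def \<eta>_def]]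
        show "\<zeta> \<in> kube R T a"
          using ** ball_subset_cell[OF j] False by (auto simp: nj kube_def z_def)
      qed
      then have "measure lborel P / v \<le> measure nu (kube R T a)"
        unfolding v_def using P(1) kube_sets[OF a] by (intro measure_nu_ge_compact)
      then have "c1 * h ^ (CARD('d) + 1) \<le> measure nu (kube R T a)"
        unfolding P(3) by (simp add: c1_def power_mult_distrib mult_ac)
      moreover have "min c0 c1 * h ^ (CARD('d) + 1) \<le> c1 * h ^ (CARD('d) + 1)"
        using h by (intro mult_right_mono) auto
      ultimately show ?thesis by (simp add: nj h_def)
    qed
  qed (use c0 c1 in simp)
qed


text \<open>This is the sparseness inequality, with the top kube in the role of the large disjoint
  part of the tent.\<close>

definition good_vertices :: "real \<Rightarrow> real \<Rightarrow> 'd::finite bergman_tree \<Rightarrow> (nat \<times> nat) set" where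
  "good_vertices C R T = {a \<in> vertices T. measure nu (dyadic_tent R T a) \<le> C * measure nu (kube R T a)}"

text \<open>A tent that is comparable to the Carleson tent of some \<open>u\<close> contains \<open>u\<close>, hence its
  generation \<open>n\<close> satisfies \<open>1 - norm u \<le> 1 - tanh (n R)\<close>. This bounds its volume by that of
  its top kube, without any analysis of how the cells of different generations fit together.\<close>

lemma good_tents:
  fixes Ts :: "'d::finite bergman_tree set" and R \<delta> :: real
  assumes R: "0 < R" and \<delta>: "0 < \<delta>" and adm: "admissible_trees R \<delta> Ts"
  shows "\<exists>C > 0. (\<forall>T\<in>Ts. \<forall>a\<in>vertices T. 0 < measure nu (kube R T a)) \<and>
    (\<forall>z\<in>unit_ball. \<forall>\<zeta>\<in>unit_ball. \<exists>T\<in>Ts. \<exists>a\<in>good_vertices C R T.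
       z \<in> dyadic_tent R T a \<and> \<zeta> \<in> dyadic_tent R T a \<and>
       measure nu (dyadic_tent R T a) \<le> C * cmod (1 - herm z \<zeta>) ^ (CARD('d) + 1))"
proof -
  define D where "D = CARD('d) + 1"
  have is_tree: "is_bergman_tree R \<delta> T" if "T \<in> Ts" for T using adm that by (simp add: admissible_trees_def)
  obtain ck where ck: "ck > 0" "\<And>(T :: 'd bergman_tree) a. is_bergman_tree R \<delta> T \<Longrightarrow> a \<in> vertices T \<Longrightarrow>
    ck * (1 - tanh (real (fst a) * R)) ^ D \<le> measure nu (kube R T a)"
    using kube_volume[OF R \<delta>, where 'd='d] unfolding D_def by blast
  obtain Ct where Ct: "Ct > 0" "\<And>u. u \<in> (unit_ball :: (complex ^ 'd) set) \<Longrightarrow>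
     measure nu (carleson_tent u) \<le> Ct * (1 - norm u) ^ D"
    using carleson_tent_volume[where 'd='d] unfolding D_def by blast
  have "tents_cover R Ts" using adm by (simp add: admissible_trees_def)
  then obtain c where c: "c > 0" and cover': "\<forall>z\<in>unit_ball. \<exists>K\<in>dyadic_tents R Ts.
      carleson_tent z \<subseteq> K \<and> measure nu K \<le> c * measure nu (carleson_tent z) \<and>
      measure nu (carleson_tent z) \<le> c * measure nu K"
    unfolding tents_cover_def by (elim exE conjE)
  \<comment> \<open>The first entry serves the comparison of a tent with its top kube, the second
    the comparison of its volume with the Bergman kernel.\<close>
  define C where "C = max (c * Ct / ck) (c * Ct * 2 ^ D)"
  have C: "C > 0" using c Ct ck by (simp add: C_def less_max_iff_disj)
  have pos: "0 < measure nu (kube R T a)" if "T \<in> Ts" "a \<in> vertices T" for T a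
  proof -
    have "0 < ck * (1 - tanh (real (fst a) * R)) ^ D" using ck tanh_real_lt_1 by simp
    then show ?thesis using ck(2)[OF is_tree[OF that(1)] that(2)] by linarith
  qed
  have cover: "\<exists>T\<in>Ts. \<exists>a\<in>good_vertices C R T.
       z \<in> dyadic_tent R T a \<and> \<zeta> \<in> dyadic_tent R T a \<and>
       measure nu (dyadic_tent R T a) \<le> C * cmod (1 - herm z \<zeta>) ^ D"
    if z: "z \<in> unit_ball" and \<zeta>: "\<zeta> \<in> unit_ball" for z \<zeta> :: "complex ^ 'd"
  proof -
    obtain u where u: "u \<in> unit_ball" "z \<in> carleson_tent u" "\<zeta> \<in> carleson_tent u"
      "1 - norm u \<le> 2 * cmod (1 - herm z \<zeta>)"
      using common_carleson_tent[OF z \<zeta>] by metis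
    obtain K where K: "K \<in> dyadic_tents R Ts" "carleson_tent u \<subseteq> K"
      "measure nu K \<le> c * measure nu (carleson_tent u)" using bspec[OF cover' u(1)] by (elim bexE conjE)
    then obtain T a where Ta: "T \<in> Ts" "a \<in> vertices T" "K = dyadic_tent R T a"
      by (auto simp: dyadic_tents_def)
    interpret bergman_tree R \<delta> T using R \<delta> is_tree[OF Ta(1)] by unfold_locales
    have "u \<in> dyadic_tent R T a" using self_in_carleson_tent[OF u(1)] K Ta by auto
    then have nu: "1 - norm u \<le> 1 - tanh (real (fst a) * R)" using norm_tent by simp
    have u1: "0 \<le> 1 - norm u" using u(1) by simp
    have "c * measure nu (carleson_tent u) \<le> c * (Ct * (1 - norm u) ^ D)"
      using Ct(2)[OF u(1)] c by (intro mult_left_mono) auto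
    then have vol: "measure nu K \<le> c * Ct * (1 - norm u) ^ D" using K(3) by simp
    have "c * Ct * (1 - norm u) ^ D \<le> c * Ct * (1 - tanh (real (fst a) * R)) ^ D"
      using nu u1 c Ct by (intro mult_left_mono power_mono) auto
    also have "\<dots> = (c * Ct / ck) * (ck * (1 - tanh (real (fst a) * R)) ^ D)" using ck by simp
    also have "\<dots> \<le> (c * Ct / ck) * measure nu (kube R T a)"
      using ck(2)[OF is_tree[OF Ta(1)] Ta(2)] c Ct ck(1) by (intro mult_left_mono) auto
    also have "\<dots> \<le> C * measure nu (kube R T a)"
      by (intro mult_right_mono) (auto simp: C_def)
    finally have "a \<in> good_vertices C R T" using vol Ta by (simp add: good_vertices_def)
    moreover have "measure nu K \<le> C * cmod (1 - herm z \<zeta>) ^ D"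
    proof -
      have "c * Ct * (1 - norm u) ^ D \<le> c * Ct * (2 * cmod (1 - herm z \<zeta>)) ^ D"
        using u(4) u1 c Ct by (intro mult_left_mono power_mono) auto
      also have "\<dots> = c * Ct * 2 ^ D * cmod (1 - herm z \<zeta>) ^ D" by (simp add: power_mult_distrib)
      also have "\<dots> \<le> C * cmod (1 - herm z \<zeta>) ^ D" by (intro mult_right_mono) (auto simp: C_def)
      finally show ?thesis using vol by simp
    qed
    ultimately show ?thesis using Ta K u by blast
  qed
  show ?thesis
    unfolding D_def[symmetric] by (intro exI[of _ C] conjI ballI C pos cover)
qed

section \<open>Sparse operators over a finite laminar family\<close>

definition laminar :: "'a set set \<Rightarrow> bool" where
  "laminar V \<longleftrightarrow> (\<forall>P\<in>V. \<forall>Q\<in>V. P \<inter> Q \<noteq> {} \<longrightarrow> P \<subseteq> Q \<or> Q \<subseteq> P)"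

text \<open>For a finite laminar \<open>V\<close> these are the points for which \<open>Q\<close> is
  the smallest member containing them, so every point covered by \<open>V\<close> lies in exactly
  one atom.\<close>

definition atom :: "'a set set \<Rightarrow> 'a set \<Rightarrow> 'a set" where
  "atom V Q = Q - \<Union>{P \<in> V. P \<subset> Q}"

lemma atom_subset: "atom V Q \<subseteq> Q"
  by (auto simp: atom_def)

lemma atom_unique:
  assumes "laminar V" "P \<in> V" "Q \<in> V" "x \<in> atom V P" "x \<in> Q"
  shows "P \<subseteq> Q"
  using assms unfolding laminar_def atom_def by blast

lemma atoms_disjoint:
  assumes "laminar V" "U \<subseteq> V"
  shows "disjoint_family_on (atom V) U"
  unfolding disjoint_family_on_def
proof (intro ballI impI)
  fix P Q assume PQ: "P \<in> U" "Q \<in> U" "P \<noteq> Q"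
  show "atom V P \<inter> atom V Q = {}"
  proof (rule ccontr)
    assume "atom V P \<inter> atom V Q \<noteq> {}"
    then obtain x where x: "x \<in> atom V P" "x \<in> atom V Q" by auto
    have "x \<in> P" "x \<in> Q" using x atom_subset by (meson subsetD)+
    then have "P \<subseteq> Q" "Q \<subseteq> P"
      using atom_unique[OF assms(1) _ _ x(1), of Q] atom_unique[OF assms(1) _ _ x(2), of P] PQ assms(2) by blast+
    then show False using PQ by auto
  qed
qed

lemma ex_atom:
  assumes "finite V" "laminar V" "Q \<in> V" "x \<in> Q"
  shows "\<exists>P\<in>V. P \<subseteq> Q \<and> x \<in> atom V P"
proof -
  define Y where "Y = {P \<in> V. x \<in> P \<and> P \<subseteq> Q}"
  have "finite Y" "Y \<noteq> {}" using assms by (auto simp: Y_def)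
  then obtain P where P: "P \<in> Y" "\<And>R. R \<in> Y \<Longrightarrow> R \<subseteq> P \<Longrightarrow> P = R"
    using finite_has_minimal[of Y] by metis
  then have "x \<in> atom V P" by (auto simp: atom_def Y_def)
  then show ?thesis using P by (auto simp: Y_def)
qed

lemma UN_atoms:
  assumes "finite V" "laminar V" "Q \<in> V"
  shows "(\<Union>P\<in>{P \<in> V. P \<subseteq> Q}. atom V P) = Q"
proof
  show "(\<Union>P\<in>{P \<in> V. P \<subseteq> Q}. atom V P) \<subseteq> Q" using atom_subset by fastforce
  show "Q \<subseteq> (\<Union>P\<in>{P \<in> V. P \<subseteq> Q}. atom V P)" using ex_atom[OF assms] by fastforce
qed

lemma atom_sets:
  assumes "finite V" "V \<subseteq> sets M" "Q \<in> V"
  shows "atom V Q \<in> sets M"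
  unfolding atom_def using assms by (intro sets.Diff sets.finite_Union) auto

lemma integrable_if_square_integrable:
  fixes h :: "'a \<Rightarrow> real"
  assumes "finite_measure M" "h \<in> borel_measurable M" "integrable M (\<lambda>x. (h x)\<^sup>2)"
  shows "integrable M h"
proof (rule Bochner_Integration.integrable_bound)
  show "integrable M (\<lambda>x. 1 + (h x)\<^sup>2)"
    using assms finite_measure.integrable_const[OF assms(1)] by (intro Bochner_Integration.integrable_add) auto
  have "\<bar>y\<bar> \<le> 1 + y\<^sup>2" for y :: real
    using zero_le_power2[of "\<bar>y\<bar> - 1"] zero_le_power2[of y] unfolding power2_diff power2_abs one_power2 mult_1_right by linarith
  then show "AE x in M. norm (h x) \<le> norm (1 + (h x)\<^sup>2)"
    by (intro AE_I2) (simp only: real_norm_def, metis abs_ge_self order_trans)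
qed (use assms in simp)

lemma set_integrable_if_integrable:
  fixes h :: "'a \<Rightarrow> real"
  assumes "integrable M h" "A \<in> sets M"
  shows "set_integrable M A h"
  unfolding set_integrable_def using assms(2,1) by (rule integrable_mult_indicator)

text \<open>Expand the nonnegative integral of \<open>(h x - t)\<^sup>2\<close> over
  \<open>A\<close>, with \<open>t\<close> the average of \<open>h\<close>.\<close>

lemma square_average_le:
  fixes h :: "'a \<Rightarrow> real"
  assumes fin: "finite_measure M" and h: "h \<in> borel_measurable M" "integrable M (\<lambda>x. (h x)\<^sup>2)"
    and A: "A \<in> sets M" and pos: "0 < measure M A"
  shows "((LINT x:A|M. h x) / measure M A)\<^sup>2 * measure M A \<le> (LINT x:A|M. (h x)\<^sup>2)"
proof -
  define t where "t = (LINT x:A|M. h x) / measure M A"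
  have int: "set_integrable M A h" "set_integrable M A (\<lambda>x. (h x)\<^sup>2)" "set_integrable M A (\<lambda>x. c)" for c :: real
    using integrable_if_square_integrable[OF fin h] h A finite_measure.integrable_const[OF fin, of c]
    by (auto intro!: set_integrable_if_integrable)
  have "0 \<le> (LINT x:A|M. (h x - t)\<^sup>2)"
    unfolding set_lebesgue_integral_def by (intro integral_nonneg_AE) auto
  also have "(LINT x:A|M. (h x - t)\<^sup>2) = (LINT x:A|M. ((h x)\<^sup>2 - (2 * t) * h x) + t\<^sup>2)"
    by (intro set_lebesgue_integral_cong A) (auto simp: power2_diff)
  also have "\<dots> = (LINT x:A|M. (h x)\<^sup>2) - 2 * t * (LINT x:A|M. h x) + (LINT x:A|M. t\<^sup>2)"
    using int by (subst set_integral_add, simp_all add: set_integral_diff set_integral_mult_right set_integrable_mult_right)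
  also have "(LINT x:A|M. t\<^sup>2) = t\<^sup>2 * measure M A"
    using A fin by (simp add: set_integral_const finite_measure.emeasure_finite)
  also have "(LINT x:A|M. h x) = t * measure M A" using pos by (simp add: t_def)
  finally show ?thesis by (simp add: t_def[symmetric] power2_eq_square)
qed

text \<open>The output is constant on each atom, with value \<open>g P\<close>, and \<open>h\<close>
  enters it only through its integrals over atoms. Applied to the averages \<open>f\<close> and to
  the output \<open>g\<close> itself, the bilinear bound says that \<open>Y\<close> is at most
  \<open>K\<close> times the norm of \<open>h\<close> times the root of \<open>Y\<close>; dividing
  by that root gives the norm bound.\<close>

lemma sparse_operator_bound:
  fixes h :: "'a \<Rightarrow> real" and m :: "'a set \<Rightarrow> real" and A a b c :: real
  assumes M: "finite_measure M" and N: "finite_measure N" and sets: "sets N = sets M"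
    and V: "finite V" "V \<subseteq> sets M" "laminar V"
    and m: "\<And>Q. Q \<in> V \<Longrightarrow> 0 < m Q" and A: "0 \<le> A" "0 \<le> c" "0 \<le> a" "0 \<le> b"
    and pos: "\<And>Q. Q \<in> V \<Longrightarrow> 0 < measure M Q" "\<And>Q. Q \<in> V \<Longrightarrow> 0 < measure N Q"
    and B: "\<And>Q. Q \<in> V \<Longrightarrow> measure M Q * measure N Q \<le> A * (m Q)\<^sup>2"
    and C: "\<And>Q. Q \<in> V \<Longrightarrow> (\<Sum>P | P \<in> V \<and> P \<subseteq> Q. m P) \<le> c * m Q"
    and S: "\<And>Q. Q \<in> V \<Longrightarrow> (\<Sum>P | P \<in> V \<and> P \<subseteq> Q. measure M P) \<le> a * measure M Q"
    and W: "\<And>Q. Q \<in> V \<Longrightarrow> (\<Sum>P | P \<in> V \<and> P \<subseteq> Q. measure N P) \<le> b * measure N Q"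
    and h: "h \<in> borel_measurable M" "\<And>x. 0 \<le> h x" "integrable M (\<lambda>x. (h x)\<^sup>2)"
  shows "(\<integral>\<^sup>+z. ennreal ((\<Sum>Q\<in>V. indicator Q z * ((LINT x:Q|M. h x) / m Q))\<^sup>2) \<partial>N)
    \<le> ennreal ((20 * sqrt (2 * A * c) * (sqrt a + sqrt b))\<^sup>2 * (LINT x|M. (h x)\<^sup>2))"
proof -
  interpret finite_forest V
  proof
    fix P Q R assume "P \<in> V" "Q \<in> V" "R \<in> V" "P \<subseteq> Q" "P \<subseteq> R"
    \<comment> \<open>The empty set lies below disjoint members and would destroy the forest
      property; positive measure excludes it.\<close>
    moreover have "P \<noteq> {}" using pos(1)[OF \<open>P \<in> V\<close>] by auto
    ultimately show "Q \<subseteq> R \<or> R \<subseteq> Q" using V(3) unfolding laminar_def by blast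
  qed (rule V)
  define At where "At = atom V"
  have At: "At Q \<in> sets M" if "Q \<in> V" for Q unfolding At_def using atom_sets V that by blast
  have inth: "integrable M h" using integrable_if_square_integrable[OF M h(1,3)] .
  have seth: "set_integrable M Q h" "set_integrable M Q (\<lambda>x. (h x)\<^sup>2)" if "Q \<in> sets M" for Q
    using inth h that by (auto intro!: set_integrable_if_integrable)
  define s where "s P = measure M (At P)" for P
  define w where "w P = measure N (At P)" for P
  define F where "F Q = (LINT x:Q|M. h x)" for Q
  define f where "f P = F (At P) / s P" for P
  define g where "g P = (\<Sum>Q | Q \<in> V \<and> P \<le> Q. F Q / m Q)" for P
  define K where "K = 20 * sqrt (2 * A * c) * (sqrt a + sqrt b)"
  have K0: "0 \<le> K" using A by (simp add: K_def)
  have F0: "0 \<le> F Q" for Q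
    unfolding F_def set_lebesgue_integral_def using h by (intro integral_nonneg_AE) auto
  have swf0: "0 \<le> s P" "0 \<le> w P" "0 \<le> f P" for P using F0 by (simp_all add: s_def w_def f_def)
  have add: "measure M' Q = (\<Sum>P | P \<in> V \<and> P \<le> Q. measure M' (At P))"
    if "Q \<in> V" "finite_measure M'" "sets M' = sets M" for Q and M' :: "'a measure"
  proof -
    have "measure M' (\<Union>P\<in>{P \<in> V. P \<subseteq> Q}. At P) = (\<Sum>P | P \<in> V \<and> P \<le> Q. measure M' (At P))"
      using that At V finite_measure.emeasure_finite[OF that(2)]
      by (intro measure_finite_Union) (auto simp: At_def intro!: atoms_disjoint)
    then show ?thesis unfolding At_def UN_atoms[OF V(1,3) that(1)] .
  qed
  have below_s: "below s Q = measure M Q" if "Q \<in> V" for Q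
    using add[OF that M refl] by (simp add: below_def s_def)
  have below_w: "below w Q = measure N Q" if "Q \<in> V" for Q
    using add[OF that N sets] by (simp add: below_def w_def)
  \<comment> \<open>On an atom of measure 0 the quotient \<open>f P\<close> is 0 by convention; the
    integral of \<open>h\<close> over it vanishes as well, so nothing is lost.\<close>
  have fs: "f P * s P = F (At P)" if "P \<in> V" for P
  proof (cases "s P = 0")
    case True
    then have "At P \<in> null_sets M"
      using At[OF that] finite_measure.emeasure_finite[OF M, of "At P"]
      by (auto simp: s_def measure_def null_sets_def enn2real_eq_0_iff)
    then have "AE x in M. indicator (At P) x *\<^sub>R h x = 0"
      by (rule eventually_mono[OF AE_not_in]) simp
    then have "F (At P) = 0"
      unfolding F_def set_lebesgue_integral_def by (rule integral_eq_zero_AE)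
    then show ?thesis using True by simp
  qed (simp add: f_def)
  have below_F: "below (\<lambda>P. f P * s P) Q = F Q" if "Q \<in> V" for Q
  proof -
    have "F (\<Union>P\<in>{P \<in> V. P \<subseteq> Q}. At P) = (\<Sum>P | P \<in> V \<and> P \<le> Q. F (At P))"
      unfolding F_def using that At V seth
      by (intro set_integral_finite_Union) (auto simp: At_def intro!: atoms_disjoint)
    then have "F Q = (\<Sum>P | P \<in> V \<and> P \<le> Q. F (At P))" unfolding At_def UN_atoms[OF V(1,3) that] .
    then show ?thesis using fs by (simp add: below_def)
  qed
  define Y where "Y = (\<Sum>P\<in>V. (g P)\<^sup>2 * w P)"
  have Y0: "0 \<le> Y" unfolding Y_def w_def by (intro sum_nonneg) auto
  have nf: "(\<Sum>P\<in>V. (f P)\<^sup>2 * s P) \<le> (LINT x|M. (h x)\<^sup>2)"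
  proof -
    have "(\<Sum>P\<in>V. (f P)\<^sup>2 * s P) \<le> (\<Sum>P\<in>V. LINT x:At P|M. (h x)\<^sup>2)"
    proof (intro sum_mono)
      fix P assume P: "P \<in> V"
      have nn: "0 \<le> (LINT x:At P|M. (h x)\<^sup>2)"
        unfolding set_lebesgue_integral_def by (intro integral_nonneg_AE) auto
      show "(f P)\<^sup>2 * s P \<le> (LINT x:At P|M. (h x)\<^sup>2)"
      proof (cases "s P = 0")
        case False
        then have "0 < measure M (At P)" unfolding s_def by (simp add: zero_less_measure_iff)
        from square_average_le[OF M h(1,3) At[OF P] this] show ?thesis
          by (simp add: f_def s_def F_def)
      qed (use nn in simp)
    qed
    also have "\<dots> = (LINT x:(\<Union>P\<in>V. At P)|M. (h x)\<^sup>2)"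
      using At V seth by (intro set_integral_finite_Union[symmetric]) (auto simp: At_def intro!: atoms_disjoint)
    also have "\<dots> \<le> (LINT x|M. (h x)\<^sup>2)"
      unfolding set_lebesgue_integral_def using seth(2)[of "\<Union>P\<in>V. At P"] At V h(3)
      by (intro integral_mono) (auto simp: set_integrable_def indicator_def intro!: sets.finite_UN)
    finally show ?thesis .
  qed
  have "Y = (\<Sum>P\<in>V. (g P * w P) * (\<Sum>Q | Q \<in> V \<and> P \<le> Q. F Q / m Q))"
    unfolding Y_def g_def by (simp add: power2_eq_square mult_ac)
  also have "\<dots> = (\<Sum>Q\<in>V. (F Q / m Q) * below (\<lambda>P. g P * w P) Q)"
    by (rule sum_below_swap[symmetric]) simp
  also have "\<dots> = (\<Sum>Q\<in>V. below (\<lambda>P. f P * s P) Q * below (\<lambda>P. g P * w P) Q / m Q)"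
    using below_F by (intro sum.cong) auto
  also have "\<dots> \<le> K * sqrt (\<Sum>P\<in>V. (f P)\<^sup>2 * s P) * sqrt Y"
    unfolding K_def Y_def
  proof (rule two_weight)
    show "below m Q \<le> c * m Q" if "Q \<in> V" for Q using C[OF that] by (simp add: below_def)
    show "below (below s) Q \<le> a * below s Q" if "Q \<in> V" for Q
      using S[OF that] below_s that by (simp add: below_def[of "below s"])
    show "below (below w) Q \<le> b * below w Q" if "Q \<in> V" for Q
      using W[OF that] below_w that by (simp add: below_def[of "below w"])
    show "0 \<le> g P" if "P \<in> V" for P
      unfolding g_def using F0 m by (intro sum_nonneg divide_nonneg_pos) auto
  qed (use m A pos B below_s below_w swf0 in auto)
  also have "\<dots> \<le> K * sqrt (LINT x|M. (h x)\<^sup>2) * sqrt Y"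
    using nf K0 Y0 by (intro mult_right_mono mult_left_mono real_sqrt_le_mono) auto
  finally have Y1: "Y \<le> K * sqrt (LINT x|M. (h x)\<^sup>2) * sqrt Y" .
  have h2: "0 \<le> (LINT x|M. (h x)\<^sup>2)" by (intro integral_nonneg_AE) auto
  have Y2: "Y \<le> K\<^sup>2 * (LINT x|M. (h x)\<^sup>2)"
  proof (cases "Y = 0")
    case False
    have "Y\<^sup>2 \<le> (K * sqrt (LINT x|M. (h x)\<^sup>2) * sqrt Y)\<^sup>2" using Y1 Y0 by (intro power_mono)
    also have "\<dots> = (K\<^sup>2 * (LINT x|M. (h x)\<^sup>2)) * Y" using h2 Y0 by (simp add: power_mult_distrib)
    finally show ?thesis using Y0 False by (simp add: power2_eq_square)
  qed (use h2 in simp)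
  \<comment> \<open>A point \<open>z\<close> covered by \<open>V\<close> lies in exactly one atom
    \<open>At P\<close>, and the members containing \<open>z\<close> are exactly those above
    \<open>P\<close>; so the operator takes the value \<open>g P\<close> there.\<close>
  have "(\<Sum>Q\<in>V. indicator Q z * (F Q / m Q))\<^sup>2 = (\<Sum>P\<in>V. (g P)\<^sup>2 * indicator (At P) z)" for z
  proof (cases "\<exists>Q\<in>V. z \<in> Q")
    case False
    then have "z \<notin> At P" if "P \<in> V" for P using that atom_subset[of V P] by (auto simp: At_def)
    then show ?thesis using False by simp
  next
    case True
    then obtain P where P: "P \<in> V" "z \<in> At P" using ex_atom[OF V(1,3)] unfolding At_def by blast
    have iff: "z \<in> Q \<longleftrightarrow> P \<subseteq> Q" if "Q \<in> V" for Q
      using atom_unique[OF V(3) P(1) that] P(2) atom_subset[of V P] by (auto simp: At_def)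
    have "(\<Sum>Q\<in>V. indicator Q z * (F Q / m Q)) = (\<Sum>Q\<in>V. if P \<le> Q then F Q / m Q else 0)"
      using iff by (intro sum.cong) (auto simp: indicator_def)
    also have "\<dots> = g P" unfolding g_def using V(1) by (simp add: sum.inter_filter)
    finally have "(\<Sum>Q\<in>V. indicator Q z * (F Q / m Q)) = g P" .
    moreover have "(\<Sum>Q\<in>V. (g Q)\<^sup>2 * indicator (At Q) z) = (\<Sum>Q\<in>V. if Q = P then (g P)\<^sup>2 else 0)"
    proof (intro sum.cong refl)
      fix Q assume Q: "Q \<in> V"
      have "Q = P" if "z \<in> At Q"
        using atom_unique[OF V(3) Q P(1)] that iff[OF Q] P atom_subset by (fastforce simp: At_def)
      then show "(g Q)\<^sup>2 * indicator (At Q) z = (if Q = P then (g P)\<^sup>2 else 0)"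
        using P(2) by (cases "z \<in> At Q") auto
    qed
    ultimately show ?thesis using P V(1) by simp
  qed
  moreover have "ennreal (\<Sum>P\<in>V. (g P)\<^sup>2 * indicator (At P) z)
      = (\<Sum>P\<in>V. ennreal ((g P)\<^sup>2) * indicator (At P) z)" for z
  proof -
    have "ennreal ((g P)\<^sup>2 * indicator (At P) z) = ennreal ((g P)\<^sup>2) * indicator (At P) z" for P
      by (cases "z \<in> At P") auto
    then show ?thesis by (subst sum_ennreal[symmetric]) auto
  qed
  ultimately have "(\<integral>\<^sup>+z. ennreal ((\<Sum>Q\<in>V. indicator Q z * (F Q / m Q))\<^sup>2) \<partial>N)
      = (\<integral>\<^sup>+z. (\<Sum>P\<in>V. ennreal ((g P)\<^sup>2) * indicator (At P) z) \<partial>N)"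
    by simp
  also have "\<dots> = (\<Sum>P\<in>V. ennreal ((g P)\<^sup>2) * emeasure N (At P))"
    using At sets by (subst nn_integral_sum) (auto simp: nn_integral_cmult_indicator)
  also have "\<dots> = ennreal Y"
  proof -
    have "ennreal ((g P)\<^sup>2) * emeasure N (At P) = ennreal ((g P)\<^sup>2 * w P)" for P
      by (simp add: w_def finite_measure.emeasure_eq_measure[OF N] ennreal_mult)
    then show ?thesis unfolding Y_def using swf0 by (simp add: sum_ennreal)
  qed
  also have "\<dots> \<le> ennreal (K\<^sup>2 * (LINT x|M. (h x)\<^sup>2))" using Y2 by (rule ennreal_leI)
  finally show ?thesis by (simp add: K_def F_def)
qed

section \<open>Consequences of finite characteristics\<close>

lemma sets_wmeasure [simp]: "sets (wmeasure w) = sets nu"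
  by (simp add: wmeasure_def)

lemma space_wmeasure [simp]: "space (wmeasure w) = unit_ball"
  by (simp add: wmeasure_def space_nu)

lemma emeasure_wmeasure:
  "weight w \<Longrightarrow> S \<in> sets nu \<Longrightarrow> emeasure (wmeasure w) S = (\<integral>\<^sup>+x\<in>S. ennreal (w x) \<partial>nu)"
  unfolding wmeasure_def by (rule emeasure_density) (auto simp: weight_def)

lemma emeasure_wmeasure_pos:
  assumes w: "weight w" and S: "S \<in> sets nu" "0 < measure nu S"
  shows "0 < emeasure (wmeasure w) S"
proof (rule ccontr)
  assume "\<not> 0 < emeasure (wmeasure w) S"
  then have "S \<in> null_sets (wmeasure w)" using S by (auto simp: null_sets_def)
  then have "AE x in nu. x \<in> S \<longrightarrow> ennreal (w x) = 0"
    unfolding wmeasure_def using w by (subst (asm) null_sets_density_iff) (auto simp: weight_def)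
  then have "AE x in nu. x \<notin> S"
    using AE_space[of nu]
  proof eventually_elim
    case (elim x)
    then have "w x > 0" using w by (auto simp: weight_def space_nu)
    then show ?case using elim by auto
  qed
  then have "S \<in> null_sets nu" using S by (simp add: AE_iff_null_sets)
  then show False using S by (auto simp: measure_def null_sets_def)
qed

text \<open>With the ball among the tents, the product of the two total masses is finite. Both are
  positive, so neither can be infinite.\<close>

lemma B2_finite_measures:
  fixes w \<sigma> :: "complex ^ 'd::finite \<Rightarrow> real"
  assumes w: "weight w" "weight \<sigma>" and K: "unit_ball \<in> \<K>" and B2: "B2_char \<K> w \<sigma> < \<infinity>"
  shows "finite_measure (wmeasure w)" "finite_measure (wmeasure \<sigma>)"
proof -
  let ?B = "unit_ball :: (complex ^ 'd) set"
  have B: "?B \<in> sets nu" using sets.top[of nu] by (simp add: space_nu)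
  have m: "measure nu ?B = 1" by (simp add: measure_def emeasure_nu_unit_ball)
  have pos: "0 < emeasure (wmeasure w) ?B" "0 < emeasure (wmeasure \<sigma>) ?B"
    using m by (simp_all add: emeasure_wmeasure_pos[OF w(1) B] emeasure_wmeasure_pos[OF w(2) B])
  have "emeasure (wmeasure w) ?B / emeasure nu ?B * (emeasure (wmeasure \<sigma>) ?B / emeasure nu ?B) \<le> B2_char \<K> w \<sigma>"
    unfolding B2_char_def using K by (intro SUP_upper)
  then have "emeasure (wmeasure w) ?B * emeasure (wmeasure \<sigma>) ?B < \<infinity>"
    using B2 by (simp add: emeasure_nu_unit_ball divide_ennreal_def)
  then have "emeasure (wmeasure w) ?B \<noteq> \<infinity>" "emeasure (wmeasure \<sigma>) ?B \<noteq> \<infinity>"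
    using pos by (auto simp: ennreal_mult_less_top)
  then show "finite_measure (wmeasure w)" "finite_measure (wmeasure \<sigma>)"
    by (auto intro!: finite_measureI)
qed

lemma B2_le:
  assumes fin: "finite_measure (wmeasure w)" "finite_measure (wmeasure \<sigma>)"
    and K: "K \<in> \<K>" "0 < measure nu K" and B2: "B2_char \<K> w \<sigma> < \<infinity>"
  shows "measure (wmeasure \<sigma>) K * measure (wmeasure w) K \<le> enn2real (B2_char \<K> w \<sigma>) * (measure nu K)\<^sup>2"
proof -
  have "emeasure (wmeasure w) K / emeasure nu K * (emeasure (wmeasure \<sigma>) K / emeasure nu K) \<le> B2_char \<K> w \<sigma>"
    unfolding B2_char_def using K by (intro SUP_upper)
  also have "emeasure (wmeasure w) K / emeasure nu K * (emeasure (wmeasure \<sigma>) K / emeasure nu K)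
     = ennreal (measure (wmeasure w) K / measure nu K * (measure (wmeasure \<sigma>) K / measure nu K))"
    using K unfolding finite_measure.emeasure_eq_measure[OF fin(1)] finite_measure.emeasure_eq_measure[OF fin(2)]
      finite_measure.emeasure_eq_measure[OF finite_measure_nu]
    by (simp add: divide_ennreal ennreal_mult[symmetric])
  finally have "measure (wmeasure w) K / measure nu K * (measure (wmeasure \<sigma>) K / measure nu K) \<le> enn2real (B2_char \<K> w \<sigma>)"
    using B2 by (metis enn2real_ennreal enn2real_mono mult_nonneg_nonneg divide_nonneg_nonneg measure_nonneg infinity_ennreal_def)
  then show ?thesis using K by (simp add: field_simps power2_eq_square)
qed

definition sparse_sets :: "real \<Rightarrow> (complex ^ 'd::finite) set set \<Rightarrow> ((complex ^ 'd) set \<Rightarrow> (complex ^ 'd) set) \<Rightarrow> bool" where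
  "sparse_sets C V E \<longleftrightarrow> disjoint_family_on E V \<and>
     (\<forall>Q\<in>V. E Q \<in> sets nu \<and> E Q \<subseteq> Q \<and> 0 < measure nu (E Q) \<and> measure nu Q \<le> C * measure nu (E Q))"

lemma sparse_packing:
  assumes V: "finite V" "V \<subseteq> sets nu" and sp: "sparse_sets C V E" and C: "0 < C" and Q: "Q \<in> V"
  shows "(\<Sum>P | P \<in> V \<and> P \<subseteq> Q. measure nu P) \<le> C * measure nu Q"
proof -
  let ?I = "{P \<in> V. P \<subseteq> Q}"
  have "(\<Sum>P\<in>?I. measure nu P) \<le> (\<Sum>P\<in>?I. C * measure nu (E P))"
    using sp by (intro sum_mono) (auto simp: sparse_sets_def)
  also have "\<dots> = C * measure nu (\<Union>P\<in>?I. E P)"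
    using sp V finite_measure.emeasure_finite[OF finite_measure_nu]
    by (subst measure_finite_Union)
      (auto simp: sparse_sets_def sum_distrib_left disjoint_family_on_def)
  also have "\<dots> \<le> C * measure nu Q"
    using sp V Q C by (intro mult_left_mono finite_measure.finite_measure_mono[OF finite_measure_nu])
      (auto simp: sparse_sets_def)
  finally show ?thesis .
qed

text \<open>On the part \<open>E P\<close> of \<open>Q\<close> the maximal function of \<open>\<sigma> 1\<^sub>Q\<close> is at least \<open>\<sigma>(P) / |P|\<close>, and
  \<open>|E P|\<close> is comparable to \<open>|P|\<close>.\<close>

lemma Binf_packing:
  assumes \<sigma>: "weight \<sigma>" and fin: "finite_measure (wmeasure \<sigma>)"
    and V: "finite V" "V \<subseteq> \<K>" "V \<subseteq> sets nu" and sp: "sparse_sets C V E" and C: "0 < C"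
    and Q: "Q \<in> V" and Binf: "Binf_char \<K> \<sigma> < \<infinity>"
  shows "(\<Sum>P | P \<in> V \<and> P \<subseteq> Q. measure (wmeasure \<sigma>) P)
    \<le> C * enn2real (Binf_char \<K> \<sigma>) * measure (wmeasure \<sigma>) Q"
proof -
  let ?I = "{P \<in> V. P \<subseteq> Q}" and ?M = "maximal_fn \<K> (\<lambda>\<zeta>. \<sigma> \<zeta> * indicator Q \<zeta>)"
  define a where "a P = measure (wmeasure \<sigma>) P / measure nu P" for P
  define X where "X = (\<integral>\<^sup>+z\<in>Q. ?M z \<partial>nu)"
  have E: "E P \<in> sets nu" "E P \<subseteq> P" "0 < measure nu (E P)" "measure nu P \<le> C * measure nu (E P)" if "P \<in> V" for P
    using sp that by (auto simp: sparse_sets_def)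
  have Psets: "P \<in> sets nu" if "P \<in> V" for P using V that by auto
  have Ppos: "0 < measure nu P" if "P \<in> V" for P
    using E[OF that] finite_measure.finite_measure_mono[OF finite_measure_nu E(2)[OF that] Psets[OF that]] by linarith
  have Qpos: "0 < measure (wmeasure \<sigma>) Q"
    using emeasure_wmeasure_pos[OF \<sigma> Psets[OF Q] Ppos[OF Q]]
    by (simp add: finite_measure.emeasure_eq_measure[OF fin])
  have a0: "0 \<le> a P" for P by (simp add: a_def)
  have M_ge: "ennreal (a P) \<le> ?M z" if P: "P \<in> ?I" and z: "z \<in> P" for P z
  proof -
    have "(\<integral>\<^sup>+\<zeta>\<in>P. ennreal \<bar>\<sigma> \<zeta> * indicator Q \<zeta>\<bar> \<partial>nu) = (\<integral>\<^sup>+\<zeta>\<in>P. ennreal (\<sigma> \<zeta>) \<partial>nu)"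
      using \<sigma> P by (intro nn_integral_cong) (auto simp: weight_def space_nu indicator_def abs_of_pos)
    also have "\<dots> = emeasure (wmeasure \<sigma>) P" using emeasure_wmeasure[OF \<sigma>] Psets P by simp
    finally have "ennreal (a P) = (\<integral>\<^sup>+\<zeta>\<in>P. ennreal \<bar>\<sigma> \<zeta> * indicator Q \<zeta>\<bar> \<partial>nu) / emeasure nu P * indicator P z"
      using z P Ppos by (simp add: a_def divide_ennreal finite_measure.emeasure_eq_measure[OF fin]
          finite_measure.emeasure_eq_measure[OF finite_measure_nu])
    also have "\<dots> \<le> ?M z" unfolding maximal_fn_def using V P by (intro SUP_upper) auto
    finally show ?thesis .
  qed
  \<comment> \<open>The parts \<open>E P\<close> are disjoint, so at most one term of the sum is
    nonzero at \<open>z\<close>.\<close>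
  have "(\<Sum>P\<in>?I. ennreal (a P) * indicator (E P) z) \<le> ?M z * indicator Q z" for z
  proof (cases "\<exists>P\<in>?I. z \<in> E P")
    case True
    then obtain P where P: "P \<in> ?I" "z \<in> E P" by auto
    have "z \<notin> E P'" if "P' \<in> ?I" "P' \<noteq> P" for P'
      using sp P that unfolding sparse_sets_def disjoint_family_on_def by blast
    then have "(\<Sum>P'\<in>?I. ennreal (a P') * indicator (E P') z) = (\<Sum>P'\<in>?I. if P' = P then ennreal (a P) else 0)"
      using P(2) by (intro sum.cong) auto
    also have "\<dots> = ennreal (a P)" using P V by simp
    also have "\<dots> \<le> ?M z * indicator Q z"
      using M_ge[OF P(1), of z] E(2)[of P] P by (auto simp: indicator_def)
    finally show ?thesis .
  next
    case False
    then show ?thesis by (auto intro!: order_trans[OF eq_refl[OF sum.neutral]])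
  qed
  then have "(\<integral>\<^sup>+z. (\<Sum>P\<in>?I. ennreal (a P) * indicator (E P) z) \<partial>nu) \<le> X"
    unfolding X_def by (intro nn_integral_mono)
  also have "(\<integral>\<^sup>+z. (\<Sum>P\<in>?I. ennreal (a P) * indicator (E P) z) \<partial>nu) = ennreal (\<Sum>P\<in>?I. a P * measure nu (E P))"
  proof -
    have "(\<integral>\<^sup>+z. (\<Sum>P\<in>?I. ennreal (a P) * indicator (E P) z) \<partial>nu) = (\<Sum>P\<in>?I. ennreal (a P) * emeasure nu (E P))"
      using E(1) by (subst nn_integral_sum) (auto simp: nn_integral_cmult_indicator)
    also have "\<dots> = (\<Sum>P\<in>?I. ennreal (a P * measure nu (E P)))"
      using a0 by (simp add: finite_measure.emeasure_eq_measure[OF finite_measure_nu] ennreal_mult)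
    also have "\<dots> = ennreal (\<Sum>P\<in>?I. a P * measure nu (E P))" using a0 by (intro sum_ennreal) auto
    finally show ?thesis .
  qed
  finally have low: "ennreal (\<Sum>P\<in>?I. a P * measure nu (E P)) \<le> X" .
  have "X / emeasure (wmeasure \<sigma>) Q \<le> Binf_char \<K> \<sigma>"
    unfolding Binf_char_def X_def using V Q by (intro SUP_upper) auto
  \<comment> \<open>Multiplying the quotient out again recovers \<open>X\<close> in
    \<open>ennreal\<close>, since the mass of \<open>Q\<close> is positive and finite.\<close>
  then have "X / ennreal (measure (wmeasure \<sigma>) Q) * ennreal (measure (wmeasure \<sigma>) Q)
      \<le> Binf_char \<K> \<sigma> * ennreal (measure (wmeasure \<sigma>) Q)"
    unfolding finite_measure.emeasure_eq_measure[OF fin] by (rule mult_right_mono) simp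
  also have "X / ennreal (measure (wmeasure \<sigma>) Q) * ennreal (measure (wmeasure \<sigma>) Q) = X"
    using Qpos by (subst mult.commute, subst ennreal_times_divide, subst mult.commute)
      (simp add: mult_divide_eq_ennreal)
  finally have "X \<le> Binf_char \<K> \<sigma> * ennreal (measure (wmeasure \<sigma>) Q)" .
  also have "\<dots> = ennreal (enn2real (Binf_char \<K> \<sigma>) * measure (wmeasure \<sigma>) Q)"
    using Binf by (simp add: ennreal_mult)
  finally have "ennreal (\<Sum>P\<in>?I. a P * measure nu (E P)) \<le> ennreal (enn2real (Binf_char \<K> \<sigma>) * measure (wmeasure \<sigma>) Q)"
    using low by (rule order_trans[rotated])
  then have "(\<Sum>P\<in>?I. a P * measure nu (E P)) \<le> enn2real (Binf_char \<K> \<sigma>) * measure (wmeasure \<sigma>) Q"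
    by (subst (asm) ennreal_le_iff) (simp_all add: enn2real_nonneg)
  then have "C * (\<Sum>P\<in>?I. a P * measure nu (E P)) \<le> C * (enn2real (Binf_char \<K> \<sigma>) * measure (wmeasure \<sigma>) Q)"
    using C by (intro mult_left_mono) auto
  moreover have "(\<Sum>P\<in>?I. measure (wmeasure \<sigma>) P) \<le> C * (\<Sum>P\<in>?I. a P * measure nu (E P))"
    unfolding sum_distrib_left
  proof (intro sum_mono)
    fix P assume P: "P \<in> ?I"
    then have "a P * measure nu P \<le> a P * (C * measure nu (E P))"
      using E(4)[of P] a0 by (intro mult_left_mono) auto
    then show "measure (wmeasure \<sigma>) P \<le> C * (a P * measure nu (E P))"
      using Ppos[of P] P by (simp add: a_def mult_ac)
  qed
  ultimately show ?thesis by (simp add: mult.assoc)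
qed

text \<open>Sparseness enters three times with the same constant: in the packing of volumes and in
  the packing of each weight. The root of \<open>2 * A * C\<close> and the roots of
  \<open>C * a\<close> and \<open>C * b\<close> combine to one full factor \<open>C\<close>.\<close>

lemma tent_operator_bound:
  fixes h :: "complex ^ 'd::finite \<Rightarrow> real"
  assumes \<sigma>: "weight \<sigma>" "finite_measure (wmeasure \<sigma>)" and w: "weight w" "finite_measure (wmeasure w)"
    and V: "finite V" "V \<subseteq> \<K>" "V \<subseteq> sets nu" "laminar V" and sp: "sparse_sets C V E" and C: "0 < C"
    and B2: "B2_char \<K> w \<sigma> < \<infinity>" and Binf: "Binf_char \<K> \<sigma> < \<infinity>" "Binf_char \<K> w < \<infinity>"
    and h: "h \<in> borel_measurable (wmeasure \<sigma>)" "\<And>x. 0 \<le> h x" "integrable (wmeasure \<sigma>) (\<lambda>x. (h x)\<^sup>2)"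
  shows "(\<integral>\<^sup>+z. ennreal ((\<Sum>Q\<in>V. indicator Q z * ((LINT x:Q|wmeasure \<sigma>. h x) / measure nu Q))\<^sup>2) \<partial>wmeasure w)
    \<le> ennreal ((20 * sqrt 2 * C * sqrt (enn2real (B2_char \<K> w \<sigma>))
        * (sqrt (enn2real (Binf_char \<K> w)) + sqrt (enn2real (Binf_char \<K> \<sigma>))))\<^sup>2
        * (LINT x|wmeasure \<sigma>. (h x)\<^sup>2))"
proof -
  define A a b where "A = enn2real (B2_char \<K> w \<sigma>)" and "a = enn2real (Binf_char \<K> \<sigma>)"
    and "b = enn2real (Binf_char \<K> w)"
  have pos: "0 < measure nu Q" if "Q \<in> V" for Q
  proof -
    have "0 < measure nu (E Q)" "E Q \<subseteq> Q" using sp that by (auto simp: sparse_sets_def)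
    then show ?thesis
      using finite_measure.finite_measure_mono[OF finite_measure_nu, of "E Q" Q] V that by fastforce
  qed
  have wpos: "0 < measure (wmeasure u) Q" if "weight u" "finite_measure (wmeasure u)" "Q \<in> V" for u Q
    using emeasure_wmeasure_pos[OF that(1) _ pos[OF that(3)]] V that
    by (auto simp: finite_measure.emeasure_eq_measure[OF that(2)])
  have "(\<integral>\<^sup>+z. ennreal ((\<Sum>Q\<in>V. indicator Q z * ((LINT x:Q|wmeasure \<sigma>. h x) / measure nu Q))\<^sup>2) \<partial>wmeasure w)
    \<le> ennreal ((20 * sqrt (2 * A * C) * (sqrt (C * a) + sqrt (C * b)))\<^sup>2 * (LINT x|wmeasure \<sigma>. (h x)\<^sup>2))"
  proof (rule sparse_operator_bound[OF \<sigma>(2) w(2) _ V(1) _ V(4)])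
    show "measure (wmeasure \<sigma>) Q * measure (wmeasure w) Q \<le> A * (measure nu Q)\<^sup>2" if "Q \<in> V" for Q
      unfolding A_def using B2_le[OF w(2) \<sigma>(2) _ pos[OF that] B2] V that by auto
    show "(\<Sum>P | P \<in> V \<and> P \<subseteq> Q. measure nu P) \<le> C * measure nu Q" if "Q \<in> V" for Q
      by (rule sparse_packing[OF V(1,3) sp C that])
    show "(\<Sum>P | P \<in> V \<and> P \<subseteq> Q. measure (wmeasure \<sigma>) P) \<le> C * a * measure (wmeasure \<sigma>) Q" if "Q \<in> V" for Q
      unfolding a_def by (rule Binf_packing[OF \<sigma> V(1-3) sp C that Binf(1)])
    show "(\<Sum>P | P \<in> V \<and> P \<subseteq> Q. measure (wmeasure w) P) \<le> C * b * measure (wmeasure w) Q" if "Q \<in> V" for Q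
      unfolding b_def by (rule Binf_packing[OF w V(1-3) sp C that Binf(2)])
  qed (use V C h pos wpos \<sigma> w in \<open>auto simp: A_def a_def b_def\<close>)
  also have "20 * sqrt (2 * A * C) * (sqrt (C * a) + sqrt (C * b))
      = 20 * sqrt 2 * (sqrt C * sqrt C) * sqrt A * (sqrt b + sqrt a)"
    unfolding real_sqrt_mult by (simp only: algebra_simps)
  also have "sqrt C * sqrt C = C" using C by simp
  finally show ?thesis by (simp add: A_def a_def b_def)
qed

section \<open>Good tents of bounded generation\<close>

context bergman_tree
begin

definition good_tents_upto :: "real \<Rightarrow> nat \<Rightarrow> (complex ^ 'd) set set" where
  "good_tents_upto C n = dyadic_tent R T ` {a \<in> good_vertices C R T. fst a < n}"

lemma finite_good_tents_upto: "finite (good_tents_upto C n)"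
proof -
  have "{a \<in> good_vertices C R T. fst a < n} \<subseteq> (\<Union>k<n. {k} \<times> {1..num T k})"
    by (auto simp: good_vertices_def vertices_def)
  then have "finite {a \<in> good_vertices C R T. fst a < n}" by (rule finite_subset) auto
  then show ?thesis unfolding good_tents_upto_def by (rule finite_imageI)
qed

lemma laminar_good_tents_upto: "laminar (good_tents_upto C n)"
  using tents_laminar unfolding laminar_def good_tents_upto_def good_vertices_def by blast

lemma good_tents_upto_sets: "good_tents_upto C n \<subseteq> sets nu"
  using tent_sets unfolding good_tents_upto_def good_vertices_def by blast

lemma sparse_good_tents_upto:
  assumes "\<And>a. a \<in> vertices T \<Longrightarrow> 0 < measure nu (kube R T a)"
  shows "\<exists>E. sparse_sets C (good_tents_upto C n) E"
proof -
  define G where "G = {a \<in> good_vertices C R T. fst a < n}"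
  \<comment> \<open>The family consists of sets, whereas kubes belong to vertices;
    \<open>top\<close> picks a vertex for each tent, and different tents receive different
    vertices.\<close>
  define top where "top = inv_into G (dyadic_tent R T)"
  have top: "top Q \<in> G" "dyadic_tent R T (top Q) = Q" if "Q \<in> good_tents_upto C n" for Q
    using that unfolding top_def good_tents_upto_def G_def[symmetric]
    by (rule inv_into_into, rule f_inv_into_f)
  have GV: "a \<in> vertices T" "measure nu (dyadic_tent R T a) \<le> C * measure nu (kube R T a)" if "a \<in> G" for a
    using that by (auto simp: G_def good_vertices_def)
  have "sparse_sets C (good_tents_upto C n) (\<lambda>Q. kube R T (top Q))"
    unfolding sparse_sets_def disjoint_family_on_def
  proof (intro conjI ballI impI)
    fix P Q assume PQ: "P \<in> good_tents_upto C n" "Q \<in> good_tents_upto C n" "P \<noteq> Q"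
    then have "top P \<noteq> top Q" using top(2) by metis
    then show "kube R T (top P) \<inter> kube R T (top Q) = {}"
      using kubes_disjoint[OF GV(1)[OF top(1)[OF PQ(1)]] GV(1)[OF top(1)[OF PQ(2)]]] by auto
  next
    fix Q assume Q: "Q \<in> good_tents_upto C n"
    note t = GV[OF top(1)[OF Q]]
    show "kube R T (top Q) \<in> sets nu" using kube_sets[OF t(1)] .
    show "kube R T (top Q) \<subseteq> Q" using kube_subset_tent[of "top Q"] top(2)[OF Q] by simp
    show "0 < measure nu (kube R T (top Q))" using assms[OF t(1)] .
    show "measure nu Q \<le> C * measure nu (kube R T (top Q))" using t(2) top(2)[OF Q] by simp
  qed
  then show ?thesis by blast
qed

end

section \<open>The Bergman projection\<close>

text \<open>A product of two suprema of an increasing sequence is the supremum of the diagonal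
  products. The pointwise bound for the projection is a supremum that may be infinite, so it cannot
  be squared within the reals.\<close>

lemma square_le_SUP_square:
  fixes u :: "nat \<Rightarrow> real"
  assumes x: "0 \<le> x" and u: "\<And>n. 0 \<le> u n" "incseq u" and le: "ennreal x \<le> (SUP n. ennreal (u n))"
  shows "ennreal (x\<^sup>2) \<le> (SUP n. ennreal ((u n)\<^sup>2))"
proof -
  have "ennreal (x\<^sup>2) = ennreal x * ennreal x" using x by (simp add: power2_eq_square ennreal_mult)
  also have "\<dots> \<le> (SUP n. ennreal (u n)) * (SUP n. ennreal (u n))" using le by (intro mult_mono) auto
  also have "\<dots> = (SUP i. SUP j. ennreal (u i) * ennreal (u j))"
    by (simp add: SUP_mult_left_ennreal mult.commute[of "Sup _"])
  also have "\<dots> \<le> (SUP n. ennreal ((u n)\<^sup>2))"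
  proof (intro SUP_least)
    fix i j
    have "u i * u j \<le> u (max i j) * u (max i j)"
      using u by (intro mult_mono) (auto simp: incseq_def)
    then have "ennreal (u i) * ennreal (u j) \<le> ennreal ((u (max i j))\<^sup>2)"
      using u by (simp add: ennreal_mult[symmetric] power2_eq_square)
    also have "\<dots> \<le> (SUP n. ennreal ((u n)\<^sup>2))" by (intro SUP_upper) auto
    finally show "ennreal (u i) * ennreal (u j) \<le> (SUP n. ennreal ((u n)\<^sup>2))" .
  qed
  finally show ?thesis .
qed

lemma nn_integral_wmeasure:
  assumes w: "weight w" and h: "h \<in> borel_measurable nu"
  shows "(\<integral>\<^sup>+x. ennreal (h x) \<partial>wmeasure w) = (\<integral>\<^sup>+x. ennreal (w x * h x) \<partial>nu)"
proof -
  have "(\<integral>\<^sup>+x. ennreal (h x) \<partial>wmeasure w) = (\<integral>\<^sup>+x. ennreal (w x) * ennreal (h x) \<partial>nu)"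
    unfolding wmeasure_def using w h by (intro nn_integral_density) (auto simp: weight_def)
  also have "\<dots> = (\<integral>\<^sup>+x. ennreal (w x * h x) \<partial>nu)"
    using w by (intro nn_integral_cong) (auto simp: weight_def space_nu ennreal_mult' less_imp_le)
  finally show ?thesis .
qed

lemma id_nu_borel: "(\<lambda>x. x) \<in> measurable nu borel"
proof -
  have "(\<lambda>x :: complex ^ 'd. x) \<in> measurable (lebesgue_on unit_ball) borel"
    by (intro measurable_restrict_space1 measurable_completion) (simp add: measurable_lborel2)
  then show ?thesis by (simp add: measurable_cong_sets[OF sets_nu refl])
qed

lemma herm_borel [measurable]:
  fixes f g :: "'a \<Rightarrow> complex ^ 'd::finite"
  assumes "f \<in> borel_measurable M" "g \<in> borel_measurable M"
  shows "(\<lambda>x. herm (f x) (g x)) \<in> borel_measurable M"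
proof -
  have "continuous_on UNIV (\<lambda>p :: (complex ^ 'd) \<times> (complex ^ 'd). herm (fst p) (snd p))"
    unfolding herm_def by (intro continuous_intros)
  from borel_measurable_continuous_Pair[OF assms, of herm] this show ?thesis by (simp add: case_prod_unfold)
qed

lemma bergman_proj_measurable:
  assumes "g \<in> borel_measurable (nu :: (complex ^ 'd::finite) measure)"
  shows "bergman_proj g \<in> borel_measurable (nu :: (complex ^ 'd::finite) measure)"
proof -
  interpret finite_measure "nu :: (complex ^ 'd) measure" by (rule finite_measure_nu)
  have [measurable]: "(\<lambda>p. snd p) \<in> borel_measurable ((nu :: (complex ^ 'd) measure) \<Otimes>\<^sub>M nu)"
    "(\<lambda>p. fst p) \<in> borel_measurable ((nu :: (complex ^ 'd) measure) \<Otimes>\<^sub>M nu)"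
    using measurable_compose[OF measurable_snd id_nu_borel] measurable_compose[OF measurable_fst id_nu_borel] by auto
  have [measurable]: "(\<lambda>p. g (snd p)) \<in> borel_measurable ((nu :: (complex ^ 'd) measure) \<Otimes>\<^sub>M nu)"
    using measurable_compose[OF measurable_snd assms] .
  have "case_prod (\<lambda>z \<zeta>. g \<zeta> / (1 - herm z \<zeta>) ^ (CARD('d) + 1)) \<in> borel_measurable (nu \<Otimes>\<^sub>M nu)"
    unfolding case_prod_unfold by measurable
  then show ?thesis unfolding bergman_proj_def[abs_def] by (rule borel_measurable_lebesgue_integral)
qed

theorem theorem1:
  fixes Ts :: "'d::finite bergman_tree set" and R \<delta> :: real
  assumes "R > 0" and "\<delta> > 0" and "admissible_trees R \<delta> Ts"
  shows "\<exists>C > 0. \<forall>\<sigma> w :: complex ^ 'd \<Rightarrow> real.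
           weight \<sigma> \<and> weight w \<and>
           Binf_char (dyadic_tents R Ts) \<sigma> < \<infinity> \<and>
           Binf_char (dyadic_tents R Ts) w < \<infinity> \<and>
           B2_char (dyadic_tents R Ts) w \<sigma> < \<infinity> \<longrightarrow>
           (\<forall>f \<in> L2 \<sigma>.
              bergman_proj (\<lambda>\<zeta>. complex_of_real (\<sigma> \<zeta>) * f \<zeta>) \<in> L2 w \<and>
              L2norm w (bergman_proj (\<lambda>\<zeta>. complex_of_real (\<sigma> \<zeta>) * f \<zeta>))
                \<le> C * sqrt (enn2real (B2_char (dyadic_tents R Ts) w \<sigma>))
                    * (sqrt (enn2real (Binf_char (dyadic_tents R Ts) w))
                       + sqrt (enn2real (Binf_char (dyadic_tents R Ts) \<sigma>)))
                    * L2norm \<sigma> f)"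
proof -
  define D where "D = CARD('d) + 1"
  define \<K> where "\<K> = dyadic_tents R Ts"
  obtain C where C: "C > 0" and kpos: "\<forall>T\<in>Ts. \<forall>a\<in>vertices T. 0 < measure nu (kube R T a)"
    and cover: "\<forall>z\<in>unit_ball. \<forall>\<zeta>\<in>unit_ball. \<exists>T\<in>Ts. \<exists>a\<in>good_vertices C R T.
       z \<in> dyadic_tent R T a \<and> \<zeta> \<in> dyadic_tent R T a \<and>
       measure nu (dyadic_tent R T a) \<le> C * cmod (1 - herm z \<zeta>) ^ D"
    using good_tents[OF assms] unfolding D_def by (elim exE conjE)
  have finTs: "finite Ts" and is_tree: "\<And>T. T \<in> Ts \<Longrightarrow> is_bergman_tree R \<delta> T" and cov: "tents_cover R Ts"
    using assms(3) by (auto simp: admissible_trees_def)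
  have bt: "bergman_tree R \<delta> T" if "T \<in> Ts" for T
    using assms is_tree[OF that] by unfold_locales
  have Ksets: "\<K> \<subseteq> sets nu"
    using bergman_tree.tent_sets[OF bt] by (auto simp: \<K>_def dyadic_tents_def)
  \<comment> \<open>The Carleson tent of the origin is the whole ball, so a dyadic tent containing
    it is the ball itself.\<close>
  have ballK: "unit_ball \<in> \<K>"
  proof -
    obtain c where "\<forall>z\<in>unit_ball. \<exists>K\<in>\<K>. carleson_tent z \<subseteq> K \<and>
        measure nu K \<le> c * measure nu (carleson_tent z) \<and> measure nu (carleson_tent z) \<le> c * measure nu K"
      using cov unfolding tents_cover_def \<K>_def by (elim exE conjE)
    from bspec[OF this, of 0] obtain K where K: "K \<in> \<K>" "carleson_tent 0 \<subseteq> K" by auto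
    have "K \<in> sets nu" using Ksets K(1) by auto
    then have "K \<subseteq> unit_ball" by (simp add: sets_nu_iff)
    then have "K = unit_ball" using K(2) by (auto simp: carleson_tent_def)
    then show ?thesis using K by simp
  qed
  define V where "V n T = bergman_tree.good_tents_upto R T C n" for n and T :: "'d bergman_tree"
  have V: "finite (V n T)" "V n T \<subseteq> \<K>" "V n T \<subseteq> sets nu" "laminar (V n T)" "\<exists>E. sparse_sets C (V n T) E"
    if T: "T \<in> Ts" for n T
  proof -
    interpret bergman_tree R \<delta> T by (rule bt[OF T])
    show "finite (V n T)" "V n T \<subseteq> sets nu" "laminar (V n T)" "\<exists>E. sparse_sets C (V n T) E"
      unfolding V_def using kpos T
      by (auto intro!: finite_good_tents_upto laminar_good_tents_upto sparse_good_tents_upto good_tents_upto_sets[THEN subsetD])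
    show "V n T \<subseteq> \<K>"
      unfolding V_def good_tents_upto_def \<K>_def dyadic_tents_def good_vertices_def using T by auto
  qed
  have Vmono: "V n T \<subseteq> V m T" if "T \<in> Ts" "n \<le> m" for n m T
    unfolding V_def bergman_tree.good_tents_upto_def[OF bt[OF that(1)]] using that(2) by auto
  define N where "N = card Ts"
  \<comment> \<open>The factor \<open>20 * sqrt 2 * C\<close> comes from the operator bound, the
    second \<open>C\<close> from the comparison with the kernel, and \<open>N\<close> from summing
    over the trees; \<open>real N + 1\<close> makes positivity immediate.\<close>
  define C1 where "C1 = 20 * sqrt 2 * C * C * (real N + 1)"
  have C1: "0 < C1" using C by (simp add: C1_def)
  have bound: "bergman_proj (\<lambda>\<zeta>. complex_of_real (\<sigma> \<zeta>) * f \<zeta>) \<in> L2 w \<and>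
      L2norm w (bergman_proj (\<lambda>\<zeta>. complex_of_real (\<sigma> \<zeta>) * f \<zeta>))
      \<le> C1 * sqrt (enn2real (B2_char \<K> w \<sigma>))
        * (sqrt (enn2real (Binf_char \<K> w)) + sqrt (enn2real (Binf_char \<K> \<sigma>))) * L2norm \<sigma> f"
    if \<sigma>: "weight \<sigma>" and w: "weight w" and B\<sigma>: "Binf_char \<K> \<sigma> < \<infinity>" and Bw: "Binf_char \<K> w < \<infinity>"
      and B2: "B2_char \<K> w \<sigma> < \<infinity>" and f: "f \<in> L2 \<sigma>"
    for \<sigma> w :: "complex ^ 'd \<Rightarrow> real" and f
  proof -
    define M where "M = wmeasure \<sigma>"
    have fin: "finite_measure (wmeasure w)" "finite_measure M"
      unfolding M_def by (rule B2_finite_measures[OF w \<sigma> ballK B2])+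
    define Kc where "Kc = 20 * sqrt 2 * C * sqrt (enn2real (B2_char \<K> w \<sigma>))
        * (sqrt (enn2real (Binf_char \<K> w)) + sqrt (enn2real (Binf_char \<K> \<sigma>)))"
    define H where "H x = cmod (f x)" for x
    have fm: "f \<in> borel_measurable nu" using f by (simp add: L2_def measurable_cong_sets[OF sets_wmeasure refl])
    have Hm [measurable]: "H \<in> borel_measurable nu" "H \<in> borel_measurable M"
      using fm by (auto simp: H_def[abs_def] M_def measurable_cong_sets[OF sets_wmeasure refl])
    have H0: "0 \<le> H x" for x by (simp add: H_def)
    have H2: "integrable M (\<lambda>x. (H x)\<^sup>2)" using f by (simp add: L2_def M_def H_def)
    define nrm where "nrm = (LINT x|M. (H x)\<^sup>2)"
    have nrm0: "0 \<le> nrm" unfolding nrm_def by (intro integral_nonneg_AE) auto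
    have H1: "integrable M H" by (rule integrable_if_square_integrable[OF fin(2) Hm(2) H2])
    define F where "F Q = (LINT x:Q|M. H x) / measure nu Q" for Q
    have F0: "0 \<le> F Q" for Q
      unfolding F_def set_lebesgue_integral_def using H0 by (intro divide_nonneg_nonneg integral_nonneg_AE) auto
    define S where "S n T z = (\<Sum>Q\<in>V n T. indicator Q z * F Q)" for n T z
    have S0: "0 \<le> S n T z" for n T z unfolding S_def using F0 by (intro sum_nonneg) auto
    define U where "U n z = (\<Sum>T\<in>Ts. S n T z)" for n z
    have U0: "0 \<le> U n z" for n z unfolding U_def using S0 by (intro sum_nonneg)
    have Uinc: "incseq (\<lambda>n. U n z)" for z
      unfolding incseq_def U_def S_def using Vmono V F0 by (auto intro!: sum_mono sum_mono2)
    have Um [measurable]: "U n \<in> borel_measurable (wmeasure w)" for n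
      unfolding U_def[abs_def] S_def measurable_cong_sets[OF sets_wmeasure refl]
      using V(3) by (intro borel_measurable_sum borel_measurable_times borel_measurable_indicator) auto
    have S_bound: "(\<integral>\<^sup>+z. ennreal ((S n T z)\<^sup>2) \<partial>wmeasure w) \<le> ennreal (Kc\<^sup>2 * nrm)" if T: "T \<in> Ts" for n T
    proof -
      obtain E where "sparse_sets C (V n T) E" using V(5)[OF T] by blast
      from tent_operator_bound[OF \<sigma> fin(2)[unfolded M_def] w fin(1) V(1-4)[OF T] this C B2 B\<sigma> Bw
          Hm(2)[unfolded M_def] H0 H2[unfolded M_def]]
      show ?thesis by (simp add: S_def F_def Kc_def nrm_def M_def)
    qed
    define g where "g = (\<lambda>\<zeta>. complex_of_real (\<sigma> \<zeta>) * f \<zeta>)"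
    have gm: "g \<in> borel_measurable nu" unfolding g_def using fm \<sigma> by (auto simp: weight_def)
    define P where "P = bergman_proj g"
    have Pm: "P \<in> borel_measurable nu" unfolding P_def by (rule bergman_proj_measurable[OF gm])
    have point: "ennreal (cmod (P z)) \<le> (SUP n. ennreal (C * U n z))" if z: "z \<in> unit_ball" for z
    proof -
      \<comment> \<open>\<open>k n\<close> is the kernel, at the fixed point \<open>z\<close>, of
        the sum over the trees of the truncated sparse operators.\<close>
      define k where "k n \<zeta> = (\<Sum>T\<in>Ts. \<Sum>Q\<in>V n T. indicator Q z / measure nu Q * indicator Q \<zeta> :: real)" for n \<zeta>
      have k0: "0 \<le> k n \<zeta>" for n \<zeta> unfolding k_def by (intro sum_nonneg) auto
      have kinc: "k n \<zeta> \<le> k m \<zeta>" if "n \<le> m" for n m \<zeta>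
        unfolding k_def using Vmono V that by (auto intro!: sum_mono sum_mono2)
      have km: "k n \<in> borel_measurable nu" for n
        unfolding k_def[abs_def]
        using V(3) by (intro borel_measurable_sum borel_measurable_times borel_measurable_indicator borel_measurable_const) auto
      have hm: "(\<lambda>\<zeta>. cmod (1 - herm z \<zeta>) ^ D) \<in> borel_measurable nu"
        using id_nu_borel by measurable
      \<comment> \<open>A nonintegrable integrand makes the projection 0 by convention, so the bound
        holds in either case.\<close>
      have "ennreal (cmod (P z)) \<le> (\<integral>\<^sup>+\<zeta>. ennreal (\<sigma> \<zeta> * (H \<zeta> / cmod (1 - herm z \<zeta>) ^ D)) \<partial>nu)"
      proof (cases "integrable nu (\<lambda>\<zeta>. g \<zeta> / (1 - herm z \<zeta>) ^ D)")
        case True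
        have "ennreal (cmod (P z)) \<le> (\<integral>\<^sup>+\<zeta>. cmod (g \<zeta> / (1 - herm z \<zeta>) ^ D) \<partial>nu)"
          unfolding P_def bergman_proj_def D_def[symmetric] by (rule integral_norm_bound_ennreal[OF True])
        also have "\<dots> = (\<integral>\<^sup>+\<zeta>. ennreal (\<sigma> \<zeta> * (H \<zeta> / cmod (1 - herm z \<zeta>) ^ D)) \<partial>nu)"
          using \<sigma> by (intro nn_integral_cong)
            (auto simp: weight_def space_nu g_def H_def norm_mult norm_divide norm_power abs_of_pos)
        finally show ?thesis .
      next
        case False
        then have "P z = 0" unfolding P_def bergman_proj_def D_def[symmetric] by (rule not_integrable_integral_eq)
        then show ?thesis by simp
      qed
      also have "\<dots> = (\<integral>\<^sup>+\<zeta>. ennreal (H \<zeta> / cmod (1 - herm z \<zeta>) ^ D) \<partial>M)"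
        unfolding M_def using hm Hm by (intro nn_integral_wmeasure[OF \<sigma>, symmetric]) auto
      \<comment> \<open>The tent shared by \<open>z\<close> and \<open>\<zeta>\<close> has a
        generation depending on \<open>\<zeta>\<close>, so the domination is by the supremum over
        all truncations and not by one of them.\<close>
      also have "\<dots> \<le> (\<integral>\<^sup>+\<zeta>. (SUP n. ennreal (C * (H \<zeta> * k n \<zeta>))) \<partial>M)"
      proof (rule nn_integral_mono)
        fix \<zeta> assume "\<zeta> \<in> space M"
        then have "\<zeta> \<in> unit_ball" by (simp add: M_def)
        from bspec[OF bspec[OF cover z] this] obtain T a where T: "T \<in> Ts" and a: "a \<in> good_vertices C R T"
          and za: "z \<in> dyadic_tent R T a" "\<zeta> \<in> dyadic_tent R T a"
          and le: "measure nu (dyadic_tent R T a) \<le> C * cmod (1 - herm z \<zeta>) ^ D" by blast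
        define Q where "Q = dyadic_tent R T a"
        \<comment> \<open>The family \<open>V n T\<close> contains the generations strictly below
          \<open>n\<close>, hence the successor.\<close>
        define n where "n = Suc (fst a)"
        have QV: "Q \<in> V n T"
          using a unfolding V_def bergman_tree.good_tents_upto_def[OF bt[OF T]] Q_def n_def by auto
        have av: "a \<in> vertices T" using a by (simp add: good_vertices_def)
        have "measure nu (kube R T a) \<le> measure nu Q"
          unfolding Q_def using bergman_tree.kube_subset_tent[OF bt[OF T]] bergman_tree.tent_sets[OF bt[OF T] av]
          by (intro finite_measure.finite_measure_mono[OF finite_measure_nu])
        then have Qpos: "0 < measure nu Q" using kpos T av by force
        \<comment> \<open>The covering bound and the positive volume of the tent together show that
          the denominator of the kernel does not vanish at this pair.\<close>
        have d: "0 < cmod (1 - herm z \<zeta>) ^ D"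
          using le Qpos C unfolding Q_def[symmetric] by (metis less_le_trans zero_less_mult_pos)
        have "1 / measure nu Q \<le> k n \<zeta>"
        proof -
          have "1 / measure nu Q = indicator Q z / measure nu Q * indicator Q \<zeta>" using za by (simp add: Q_def)
          also have "\<dots> \<le> (\<Sum>Q\<in>V n T. indicator Q z / measure nu Q * indicator Q \<zeta>)"
            using V(1)[OF T] QV by (intro member_le_sum) auto
          also have "\<dots> \<le> k n \<zeta>" unfolding k_def using finTs T
            by (intro member_le_sum[of T Ts "\<lambda>T. \<Sum>Q\<in>V n T. indicator Q z / measure nu Q * indicator Q \<zeta>"] sum_nonneg) auto
          finally show ?thesis .
        qed
        then have "C * (1 / measure nu Q) \<le> C * k n \<zeta>" using C by (intro mult_left_mono) auto
        moreover have "1 / cmod (1 - herm z \<zeta>) ^ D \<le> C * (1 / measure nu Q)"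
          using le Qpos d unfolding Q_def[symmetric] by (simp add: field_simps)
        ultimately have "H \<zeta> * (1 / cmod (1 - herm z \<zeta>) ^ D) \<le> H \<zeta> * (C * k n \<zeta>)"
          using H0 by (intro mult_left_mono) auto
        then have "ennreal (H \<zeta> / cmod (1 - herm z \<zeta>) ^ D) \<le> ennreal (C * (H \<zeta> * k n \<zeta>))"
          by (intro ennreal_leI) (simp add: mult_ac)
        also have "\<dots> \<le> (SUP n. ennreal (C * (H \<zeta> * k n \<zeta>)))" by (intro SUP_upper) auto
        finally show "ennreal (H \<zeta> / cmod (1 - herm z \<zeta>) ^ D) \<le> (SUP n. ennreal (C * (H \<zeta> * k n \<zeta>)))" .
      qed
      also have "\<dots> = (SUP n. \<integral>\<^sup>+\<zeta>. ennreal (C * (H \<zeta> * k n \<zeta>)) \<partial>M)"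
      proof (rule nn_integral_monotone_convergence_SUP)
        show "incseq (\<lambda>n \<zeta>. ennreal (C * (H \<zeta> * k n \<zeta>)))"
          using kinc C H0 by (auto simp: incseq_def le_fun_def intro!: ennreal_leI mult_left_mono)
        show "(\<lambda>\<zeta>. ennreal (C * (H \<zeta> * k n \<zeta>))) \<in> borel_measurable M" for n
          unfolding M_def measurable_cong_sets[OF sets_wmeasure refl] using km Hm(1) by measurable
      qed
      also have "\<dots> = (SUP n. ennreal (C * U n z))"
      proof (rule SUP_cong[OF refl])
        fix n
        have int: "integrable M (\<lambda>\<zeta>. indicator Q z / measure nu Q * (indicator Q \<zeta> *\<^sub>R H \<zeta>))" if "T \<in> Ts" "Q \<in> V n T" for T Q
          using H1 V(3)[OF that(1)] that(2) by (intro integrable_mult_right integrable_mult_indicator) (auto simp: M_def)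
        have eq: "C * (H \<zeta> * k n \<zeta>) = C * (\<Sum>T\<in>Ts. \<Sum>Q\<in>V n T. indicator Q z / measure nu Q * (indicator Q \<zeta> *\<^sub>R H \<zeta>))" for \<zeta>
          unfolding k_def sum_distrib_left by (intro sum.cong refl) simp
        have "(\<integral>\<^sup>+\<zeta>. ennreal (C * (H \<zeta> * k n \<zeta>)) \<partial>M) = ennreal (LINT \<zeta>|M. C * (H \<zeta> * k n \<zeta>))"
          using C H0 k0 unfolding eq by (intro nn_integral_eq_integral integrable_mult_right Bochner_Integration.integrable_sum int AE_I2)
             (auto intro!: mult_nonneg_nonneg sum_nonneg)
        also have "(LINT \<zeta>|M. C * (H \<zeta> * k n \<zeta>)) = C * U n z"
          unfolding eq U_def S_def F_def set_lebesgue_integral_def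
          using int by (simp add: Bochner_Integration.integral_sum Bochner_Integration.integrable_sum)
        finally show "(\<integral>\<^sup>+\<zeta>. ennreal (C * (H \<zeta> * k n \<zeta>)) \<partial>M) = ennreal (C * U n z)" .
      qed
      finally show ?thesis .
    qed
    have main: "(\<integral>\<^sup>+z. ennreal ((cmod (P z))\<^sup>2) \<partial>wmeasure w) \<le> ennreal ((C * N * Kc)\<^sup>2 * nrm)"
    proof -
      have "(\<integral>\<^sup>+z. ennreal ((cmod (P z))\<^sup>2) \<partial>wmeasure w) \<le> (\<integral>\<^sup>+z. (SUP n. ennreal ((C * U n z)\<^sup>2)) \<partial>wmeasure w)"
      proof (rule nn_integral_mono)
        fix z assume "z \<in> space (wmeasure w)"
        then have z: "z \<in> unit_ball" by simp
        show "ennreal ((cmod (P z))\<^sup>2) \<le> (SUP n. ennreal ((C * U n z)\<^sup>2))"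
          using point[OF z] C U0 Uinc[of z] by (intro square_le_SUP_square) (auto simp: incseq_def)
      qed
      also have "\<dots> = (SUP n. \<integral>\<^sup>+z. ennreal ((C * U n z)\<^sup>2) \<partial>wmeasure w)"
      proof (rule nn_integral_monotone_convergence_SUP)
        show "incseq (\<lambda>n z. ennreal ((C * U n z)\<^sup>2))"
          using Uinc C U0 by (auto simp: incseq_def le_fun_def intro!: ennreal_leI power_mono mult_left_mono)
      qed measurable
      also have "\<dots> \<le> ennreal ((C * N * Kc)\<^sup>2 * nrm)"
      proof (rule SUP_least)
        fix n
        have "(\<integral>\<^sup>+z. ennreal ((C * U n z)\<^sup>2) \<partial>wmeasure w) \<le> (\<integral>\<^sup>+z. (\<Sum>T\<in>Ts. ennreal (C\<^sup>2 * N) * ennreal ((S n T z)\<^sup>2)) \<partial>wmeasure w)"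
        proof (rule nn_integral_mono)
          fix z
          \<comment> \<open>Cauchy-Schwarz over the trees costs one factor \<open>N\<close> in the
            square, and adding the \<open>N\<close> operator bounds costs another; the norm thus
            acquires a single factor \<open>N\<close>.\<close>
          have "(U n z)\<^sup>2 \<le> (\<Sum>T\<in>Ts. (S n T z)\<^sup>2) * N"
            unfolding U_def N_def by (rule sum_squared_le_sum_of_squares)
          then have "C\<^sup>2 * (U n z)\<^sup>2 \<le> C\<^sup>2 * ((\<Sum>T\<in>Ts. (S n T z)\<^sup>2) * N)" by (intro mult_left_mono) auto
          then have "(C * U n z)\<^sup>2 \<le> (\<Sum>T\<in>Ts. C\<^sup>2 * N * (S n T z)\<^sup>2)"
            by (simp add: power_mult_distrib sum_distrib_left sum_distrib_right mult_ac)
          then have "ennreal ((C * U n z)\<^sup>2) \<le> ennreal (\<Sum>T\<in>Ts. C\<^sup>2 * N * (S n T z)\<^sup>2)" by (rule ennreal_leI)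
          also have "\<dots> = (\<Sum>T\<in>Ts. ennreal (C\<^sup>2 * N) * ennreal ((S n T z)\<^sup>2))"
            by (subst sum_ennreal[symmetric]) (auto simp: ennreal_mult)
          finally show "ennreal ((C * U n z)\<^sup>2) \<le> (\<Sum>T\<in>Ts. ennreal (C\<^sup>2 * N) * ennreal ((S n T z)\<^sup>2))" .
        qed
        also have "\<dots> = (\<Sum>T\<in>Ts. ennreal (C\<^sup>2 * N) * (\<integral>\<^sup>+z. ennreal ((S n T z)\<^sup>2) \<partial>wmeasure w))"
        proof -
          have Sm: "S n T \<in> borel_measurable (wmeasure w)" if "T \<in> Ts" for T
            unfolding S_def[abs_def] measurable_cong_sets[OF sets_wmeasure refl]
            using V(3)[OF that] by (intro borel_measurable_sum borel_measurable_times borel_measurable_indicator) auto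
          then show ?thesis
            by (subst nn_integral_sum) (auto simp: nn_integral_cmult)
        qed
        also have "\<dots> \<le> (\<Sum>T\<in>Ts. ennreal (C\<^sup>2 * N) * ennreal (Kc\<^sup>2 * nrm))"
          by (intro sum_mono mult_left_mono S_bound) auto
        also have "\<dots> = ennreal ((C * N * Kc)\<^sup>2 * nrm)"
        proof -
          have "ennreal (C\<^sup>2 * N) * ennreal (Kc\<^sup>2 * nrm) = ennreal (C\<^sup>2 * N * (Kc\<^sup>2 * nrm))"
            using nrm0 by (simp add: ennreal_mult)
          then have "(\<Sum>T\<in>Ts. ennreal (C\<^sup>2 * N) * ennreal (Kc\<^sup>2 * nrm)) = ennreal (\<Sum>T\<in>Ts. C\<^sup>2 * N * (Kc\<^sup>2 * nrm))"
            using nrm0 by (simp only:) (rule sum_ennreal, simp)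
          also have "(\<Sum>T\<in>Ts. C\<^sup>2 * N * (Kc\<^sup>2 * nrm)) = (C * N * Kc)\<^sup>2 * nrm"
            by (simp add: N_def power2_eq_square mult_ac)
          finally show ?thesis .
        qed
        finally show "(\<integral>\<^sup>+z. ennreal ((C * U n z)\<^sup>2) \<partial>wmeasure w) \<le> ennreal ((C * N * Kc)\<^sup>2 * nrm)" .
      qed
      finally show ?thesis .
    qed
    have Pw: "P \<in> borel_measurable (wmeasure w)" using Pm by (simp add: measurable_cong_sets[OF sets_wmeasure refl])
    have P2: "integrable (wmeasure w) (\<lambda>z. (cmod (P z))\<^sup>2)"
      using Pw main by (intro integrableI_nonneg) (auto intro: le_less_trans)
    have PL2: "P \<in> L2 w" using Pw P2 by (simp add: L2_def)
    have "ennreal (LINT z|wmeasure w. (cmod (P z))\<^sup>2) \<le> ennreal ((C * N * Kc)\<^sup>2 * nrm)"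
      using main nn_integral_eq_integral[OF P2] by simp
    then have "(LINT z|wmeasure w. (cmod (P z))\<^sup>2) \<le> (C * N * Kc)\<^sup>2 * nrm"
      using nrm0 by (subst (asm) ennreal_le_iff) auto
    then have "L2norm w P \<le> sqrt ((C * N * Kc)\<^sup>2 * nrm)" unfolding L2norm_def by (rule real_sqrt_le_mono)
    also have "\<dots> = C * N * Kc * L2norm \<sigma> f"
    proof -
      have "0 \<le> Kc" unfolding Kc_def using C by auto
      then show ?thesis using C by (simp add: real_sqrt_mult L2norm_def nrm_def M_def H_def abs_of_nonneg)
    qed
    also have "\<dots> \<le> C * (real N + 1) * Kc * L2norm \<sigma> f"
      unfolding Kc_def L2norm_def using C by (intro mult_right_mono mult_left_mono) (auto intro!: integral_nonneg_AE)
    also have "\<dots> = C1 * sqrt (enn2real (B2_char \<K> w \<sigma>))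
        * (sqrt (enn2real (Binf_char \<K> w)) + sqrt (enn2real (Binf_char \<K> \<sigma>))) * L2norm \<sigma> f"
      unfolding C1_def Kc_def by (simp only: mult_ac)
    finally have final: "L2norm w P \<le> C1 * sqrt (enn2real (B2_char \<K> w \<sigma>))
        * (sqrt (enn2real (Binf_char \<K> w)) + sqrt (enn2real (Binf_char \<K> \<sigma>))) * L2norm \<sigma> f" .
    show ?thesis using PL2 final by (simp add: P_def g_def)
  qed
  show ?thesis
    unfolding \<K>_def[symmetric] using C1 bound by (intro exI[of _ C1] conjI allI impI ballI) auto
qed

end
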